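(* Let $K$ be a finite simplicial complex and $\Gamma\to X\to K$ a covering. Suppose that the spectral distribution $F_{\Gamma,k}(\lambda)=\tau_\Gamma(\chi_A(]0,\lambda]))$ of $A=d_k^*d_k$ on $(\ker d_k)^\perp$ satisfies $F_{\Gamma,k}(\lambda)\le C\lambda^{\alpha/2}$ for some $\alpha>2$. Suppose moreover that the reduced $\ell^2$-cohomology $\overline{H}_2^{k+1}(X)$ vanishes. Then, for every $p\ge 2$ with $1/p\le 1/2-1/\alpha$, $$B^{k+1}_{p,2}(X):=d_k(\ell^pX^k)\cap\ell^2X^{k+1}=\overline{d_k(\ell^2X^k)}^{\ell^2},$$ and the $\ell^{p,2}$-torsion $T^{k+1}_{p,2}(X)$ vanishes.
   Context: $X\to K=X/\Gamma$ is a covering with deck group the discrete group $\Gamma$ acting freely, $X$ carrying the lifted simplicial structure. $\ell^pX^k$ is the space of $\ell^p$ simplicial $k$-cochains of $X$, and $d_k$ is the simplicial coboundary from $k$-cochains to $(k+1)$-cochains, bounded on $\ell^p$ for all $p$. $d_k^*$ and orthogonal complements are taken in $\ell^2$; $\chi_A(]0,\lambda])$ is the spectral projection of $A$ on $]0,\lambda]=(0,\lambda]$. Choosing representatives of the finitely many $\Gamma$-orbits of $k$-simplexes identifies $\ell^2X^k$ with $\ell^2(\Gamma)\otimes H$, $H$ finite dimensional; for a positive $\Gamma$-invariant operator $P$ with kernel $K_P$, the von Neumann $\Gamma$-trace is $\tau_\Gamma(P)=\tau_H(K_P(e,e))$. The reduced $\ell^2$-cohomology is $\overline{H}_2^{k+1}(X)=\ker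 d_{k+1}/\overline{\operatorname{Im}d_k}$ for $d_k:\ell^2X^k\to\ell^2X^{k+1}$. The $\ell^{p,2}$-torsion is $T^{k+1}_{p,2}(X)=\overline{B}^{k+1}_{p,2}(X)/B^{k+1}_{p,2}(X)$, with closure taken in $\ell^2X^{k+1}$; $\overline{\,\cdot\,}^{\ell^2}$ is closure in $\ell^2X^{k+1}$. *)

theory Defs
  imports "HOL-Algebra.Group_Action" "HOL-Analysis.Analysis"
begin

section \<open>The Hilbert space of square-summable functions\<close>

typedef 'a ell2 = "{f :: 'a \<Rightarrow> real. (\<lambda>x. (f x)\<^sup>2) summable_on UNIV}"
  by (rule exI[of _ "\<lambda>_. 0"]) simp

setup_lifting type_definition_ell2

lemma Rep_ell2_summable: "(\<lambda>x. (Rep_ell2 f x)\<^sup>2) summable_on UNIV"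
  using Rep_ell2[of f] by simp

lemma ell2_prod_summable:
  fixes f g :: "'a \<Rightarrow> real"
  assumes "(\<lambda>x. (f x)\<^sup>2) summable_on A" "(\<lambda>x. (g x)\<^sup>2) summable_on A"
  shows "(\<lambda>x. f x * g x) summable_on A"
proof -
  have "(\<lambda>x. (f x)\<^sup>2 + (g x)\<^sup>2) summable_on A"
    by (intro summable_on_add assms)
  moreover have "norm (f x * g x) \<le> (f x)\<^sup>2 + (g x)\<^sup>2" for x
  proof -
    have "2 * (\<bar>f x\<bar> * \<bar>g x\<bar>) \<le> (f x)\<^sup>2 + (g x)\<^sup>2"
      using sum_squares_bound[of "\<bar>f x\<bar>" "\<bar>g x\<bar>"] by (simp add: mult.assoc)
    moreover have "0 \<le> \<bar>f x\<bar> * \<bar>g x\<bar>" by simp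
    ultimately show ?thesis unfolding real_norm_def abs_mult by linarith
  qed
  ultimately have "(\<lambda>x. norm (f x * g x)) summable_on A"
    by (rule summable_on_comparison_test) simp_all
  then show ?thesis
    by (rule abs_summable_summable)
qed

instantiation ell2 :: (type) real_inner
begin

lift_definition zero_ell2 :: "'a ell2" is "\<lambda>_. 0" by simp

lift_definition uminus_ell2 :: "'a ell2 \<Rightarrow> 'a ell2" is "\<lambda>f x. - f x" by simp

lift_definition plus_ell2 :: "'a ell2 \<Rightarrow> 'a ell2 \<Rightarrow> 'a ell2" is "\<lambda>f g x. f x + g x"
proof -
  fix f g :: "'a \<Rightarrow> real"
  assume *: "(\<lambda>x. (f x)\<^sup>2) summable_on UNIV" "(\<lambda>x. (g x)\<^sup>2) summable_on UNIV"
  have "(\<lambda>x. (f x)\<^sup>2 + (g x)\<^sup>2 + 2 * (f x * g x)) summable_on UNIV"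
    by (intro summable_on_add summable_on_cmult_right ell2_prod_summable *)
  then show "(\<lambda>x. (f x + g x)\<^sup>2) summable_on UNIV"
    unfolding power2_sum by (simp only: mult.assoc)
qed

lift_definition scaleR_ell2 :: "real \<Rightarrow> 'a ell2 \<Rightarrow> 'a ell2" is "\<lambda>c f x. c * f x"
  unfolding power_mult_distrib by (rule summable_on_cmult_right)

definition minus_ell2 :: "'a ell2 \<Rightarrow> 'a ell2 \<Rightarrow> 'a ell2"
  where "minus_ell2 f g = f + - g"

lift_definition inner_ell2 :: "'a ell2 \<Rightarrow> 'a ell2 \<Rightarrow> real" is "\<lambda>f g. \<Sum>\<^sub>\<infinity>x. f x * g x" .

definition norm_ell2 :: "'a ell2 \<Rightarrow> real"
  where "norm_ell2 f = sqrt (inner f f)"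

definition dist_ell2 :: "'a ell2 \<Rightarrow> 'a ell2 \<Rightarrow> real"
  where "dist_ell2 f g = norm (f - g)"

definition sgn_ell2 :: "'a ell2 \<Rightarrow> 'a ell2"
  where "sgn_ell2 f = scaleR (inverse (norm f)) f"

definition uniformity_ell2 :: "('a ell2 \<times> 'a ell2) filter"
  where "uniformity_ell2 = (INF e\<in>{0<..}. principal {(f, g). dist f g < e})"

definition open_ell2 :: "'a ell2 set \<Rightarrow> bool"
  where "open_ell2 U \<longleftrightarrow> (\<forall>f\<in>U. \<forall>\<^sub>F (f', g) in uniformity. f' = f \<longrightarrow> g \<in> U)"

instance
proof
  fix f g h :: "'a ell2" and a b :: real
  show "f + g + h = f + (g + h)" by transfer (simp add: add.assoc)
  show "f + g = g + f" by transfer (simp add: add.commute)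
  show "0 + f = f" by transfer simp
  show "- f + f = 0" by transfer simp
  show "f - g = f + - g" by (rule minus_ell2_def)
  show "a *\<^sub>R (f + g) = a *\<^sub>R f + a *\<^sub>R g" by transfer (simp add: algebra_simps)
  show "(a + b) *\<^sub>R f = a *\<^sub>R f + b *\<^sub>R f" by transfer (simp add: algebra_simps)
  show "a *\<^sub>R b *\<^sub>R f = (a * b) *\<^sub>R f" by transfer (simp add: mult.assoc)
  show "1 *\<^sub>R f = f" by transfer simp
  show "sgn f = scaleR (inverse (norm f)) f" by (rule sgn_ell2_def)
  show "dist f g = norm (f - g)" by (rule dist_ell2_def)
  show "uniformity = (INF e\<in>{0<..}. principal {(f :: 'a ell2, g). dist f g < e})"
    by (rule uniformity_ell2_def)
  show "open U \<longleftrightarrow> (\<forall>f\<in>U. \<forall>\<^sub>F (f', g) in uniformity. f' = f \<longrightarrow> g \<in> U)"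
    for U :: "'a ell2 set"
    by (rule open_ell2_def)
  show "inner f g = inner g f" by transfer (simp add: mult.commute)
  show "inner (f + g) h = inner f h + inner g h"
    by transfer (simp add: distrib_right infsum_add ell2_prod_summable)
  show "inner (a *\<^sub>R f) g = a * inner f g"
    by transfer (simp add: mult.assoc infsum_cmult_right')
  show "0 \<le> inner f f" by transfer (simp add: infsum_nonneg)
  show "inner f f = 0 \<longleftrightarrow> f = 0"
  proof
    assume "inner f f = 0"
    then show "f = 0"
    proof transfer
      fix f :: "'a \<Rightarrow> real"
      assume s: "(\<lambda>x. (f x)\<^sup>2) summable_on UNIV" and z: "(\<Sum>\<^sub>\<infinity>x. f x * f x) = 0"
      have "(f x)\<^sup>2 = 0" for x
        by (rule nonneg_infsum_le_0D[where A = UNIV and f = "\<lambda>x. (f x)\<^sup>2"])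
          (use s z in \<open>simp_all add: power2_eq_square\<close>)
      then show "f = (\<lambda>_. 0)" by auto
    qed
  next
    assume "f = 0"
    then show "inner f f = 0" by transfer simp
  qed
  show "norm f = sqrt (inner f f)" by (rule norm_ell2_def)
qed

end


section \<open>Spectral resolutions of self-adjoint operators\<close>

definition orthogonal_projection :: "('h::real_inner \<Rightarrow> 'h) \<Rightarrow> bool" where
  "orthogonal_projection P \<longleftrightarrow>
     bounded_linear P \<and> (\<forall>x. P (P x) = P x) \<and> (\<forall>x y. inner (P x) y = inner x (P y))"

text \<open>A right-continuous resolution of the identity; \<open>E t\<close> stands for the spectral projection
  on \<open>]-\<infinity>, t]\<close>. Limits are in the strong operator topology.\<close>

definition resolution_of_identity :: "(real \<Rightarrow> 'h::real_inner \<Rightarrow> 'h) \<Rightarrow> bool" where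
  "resolution_of_identity E \<longleftrightarrow>
     (\<forall>t. orthogonal_projection (E t)) \<and>
     (\<forall>s t x. s \<le> t \<longrightarrow> E s (E t x) = E s x) \<and>
     (\<forall>t x. continuous (at_right t) (\<lambda>s. E s x)) \<and>
     (\<forall>x. ((\<lambda>t. E t x) \<longlongrightarrow> 0) at_bot) \<and>
     (\<forall>x. ((\<lambda>t. E t x) \<longlongrightarrow> x) at_top)"

text \<open>\<open>A = \<integral> t dE\<^sub>t\<close>, in the weak sense: the quadratic form of \<open>A\<close> is the integral of \<open>t\<close> against the
  Stieltjes measure \<open>d\<langle>E\<^sub>t x, x\<rangle>\<close>. This determines a self-adjoint \<open>A\<close> by polarization.\<close>

definition spectral_resolution ::
    "('h::real_inner \<Rightarrow> 'h) \<Rightarrow> (real \<Rightarrow> 'h \<Rightarrow> 'h) \<Rightarrow> bool" where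
  "spectral_resolution A E \<longleftrightarrow>
     resolution_of_identity E \<and>
     (\<forall>x. integrable (interval_measure (\<lambda>t. inner (E t x) x)) (\<lambda>t. t) \<and>
          inner (A x) x = (\<integral>t. t \<partial>interval_measure (\<lambda>t. inner (E t x) x)))"

text \<open>The spectral projection \<open>\<chi>\<^sub>A(]a, b])\<close>. By the spectral theorem a bounded self-adjoint operator on
  a Hilbert space has exactly one spectral resolution, so the choice is immaterial.\<close>

definition spectral_projection_Ioc ::
    "('h::real_inner \<Rightarrow> 'h) \<Rightarrow> real \<Rightarrow> real \<Rightarrow> 'h \<Rightarrow> 'h" where
  "spectral_projection_Ioc A a b =
     (let E = (SOME E. spectral_resolution A E) in (\<lambda>x. E b x - E a x))"


section \<open>Simplicial complexes and coverings\<close>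

definition abstract_simplicial_complex :: "'v set set \<Rightarrow> bool" where
  "abstract_simplicial_complex X \<longleftrightarrow>
     (\<forall>\<sigma>\<in>X. finite \<sigma> \<and> \<sigma> \<noteq> {} \<and> (\<forall>\<tau>. \<tau> \<subseteq> \<sigma> \<and> \<tau> \<noteq> {} \<longrightarrow> \<tau> \<in> X))"

definition simplexes :: "'v set set \<Rightarrow> nat \<Rightarrow> 'v set set" where
  "simplexes X k = {\<sigma>\<in>X. card \<sigma> = k + 1}"

text \<open>A covering \<open>X \<rightarrow> K\<close> with the lifted simplicial structure on \<open>X\<close>, given by its vertex map:
  every simplex of \<open>X\<close> is mapped bijectively onto a simplex of \<open>K\<close>, and a simplex of \<open>K\<close> has exactly
  one lift through each point above one of its vertices.\<close>

definition simplicial_covering :: "'v set set \<Rightarrow> 'w set set \<Rightarrow> ('v \<Rightarrow> 'w) \<Rightarrow> bool" where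
  "simplicial_covering X K \<pi> \<longleftrightarrow>
     abstract_simplicial_complex X \<and> abstract_simplicial_complex K \<and>
     \<pi> ` \<Union>X = \<Union>K \<and>
     (\<forall>\<sigma>\<in>X. inj_on \<pi> \<sigma> \<and> \<pi> ` \<sigma> \<in> K) \<and>
     (\<forall>v\<in>\<Union>X. \<forall>\<tau>\<in>K. \<pi> v \<in> \<tau> \<longrightarrow> (\<exists>!\<sigma>. \<sigma> \<in> X \<and> v \<in> \<sigma> \<and> \<pi> ` \<sigma> = \<tau>))"

text \<open>\<open>\<Gamma> \<rightarrow> X \<rightarrow> K\<close>: the group acts freely on \<open>X\<close> by simplicial automorphisms and \<open>K = X/\<Gamma>\<close>. As
  \<open>\<pi>\<close> is injective on simplexes and \<open>\<Gamma>\<close>-invariant, acting freely on the vertices is the same as acting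
  freely on the geometric realization.\<close>

definition deck_covering ::
    "('g, 'b) monoid_scheme \<Rightarrow> ('g \<Rightarrow> 'v \<Rightarrow> 'v) \<Rightarrow> 'v set set \<Rightarrow> 'w set set \<Rightarrow> ('v \<Rightarrow> 'w) \<Rightarrow> bool"
  where
  "deck_covering \<Gamma> \<phi> X K \<pi> \<longleftrightarrow>
     simplicial_covering X K \<pi> \<and>
     group_action \<Gamma> (\<Union>X) \<phi> \<and>
     (\<forall>g\<in>carrier \<Gamma>. \<forall>\<sigma>\<in>X. \<phi> g ` \<sigma> \<in> X) \<and>
     (\<forall>v\<in>\<Union>X. stabilizer \<Gamma> \<phi> v = {\<one>\<^bsub>\<Gamma>\<^esub>}) \<and>
     (\<forall>v\<in>\<Union>X. orbit \<Gamma> \<phi> v = {w\<in>\<Union>X. \<pi> w = \<pi> v})"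

definition orbit_representatives ::
    "('g, 'b) monoid_scheme \<Rightarrow> ('g \<Rightarrow> 'v \<Rightarrow> 'v) \<Rightarrow> 'v set set \<Rightarrow> 'v set set \<Rightarrow> bool" where
  "orbit_representatives \<Gamma> \<phi> S R \<longleftrightarrow>
     R \<subseteq> S \<and> (\<forall>\<sigma>\<in>S. \<exists>!\<rho>. \<rho> \<in> R \<and> (\<exists>g\<in>carrier \<Gamma>. \<phi> g ` \<rho> = \<sigma>))"


section \<open>Cochains\<close>

text \<open>A total order on the vertices of \<open>K\<close>, pulled back along \<open>\<pi>\<close>, orders the vertices of each simplex
  of \<open>X\<close> in a \<open>\<Gamma>\<close>-invariant way. A \<open>k\<close>-cochain is identified with the function assigning to a
  \<open>k\<close>-simplex its value on the corresponding orientation, extended by \<open>0\<close> to all finite vertex sets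
  that are not \<open>k\<close>-simplexes of \<open>X\<close>. The exponent of the sign below is the position of \<open>v\<close> in \<open>\<tau>\<close>.\<close>

definition coboundary ::
    "'v set set \<Rightarrow> ('v \<Rightarrow> 'w::linorder) \<Rightarrow> nat \<Rightarrow> ('v set \<Rightarrow> real) \<Rightarrow> 'v set \<Rightarrow> real" where
  "coboundary X \<pi> k f \<tau> =
     (if \<tau> \<in> simplexes X (k + 1)
      then \<Sum>v\<in>\<tau>. (-1) ^ card {u\<in>\<tau>. \<pi> u < \<pi> v} * f (\<tau> - {v}) else 0)"

definition lp_cochains :: "ereal \<Rightarrow> 'v set set \<Rightarrow> nat \<Rightarrow> ('v set \<Rightarrow> real) set" where
  "lp_cochains p X k =
     {f. (\<forall>\<sigma>. \<sigma> \<notin> simplexes X k \<longrightarrow> f \<sigma> = 0) \<and>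
         (if p = \<infinity> then bounded (f ` simplexes X k)
          else (\<lambda>\<sigma>. \<bar>f \<sigma>\<bar> powr real_of_ereal p) summable_on simplexes X k)}"

text \<open>\<open>\<ell>\<^sup>2X\<^sup>k\<close>, as a closed subspace of the Hilbert space of all square-summable functions on vertex
  sets.\<close>

definition ell2_cochains :: "'v set set \<Rightarrow> nat \<Rightarrow> 'v set ell2 set" where
  "ell2_cochains X k = {f. Rep_ell2 f \<in> lp_cochains 2 X k}"

text \<open>\<open>d\<^sub>k : \<ell>\<^sup>2X\<^sup>k \<rightarrow> \<ell>\<^sup>2X\<^sup>k\<^sup>+\<^sup>1\<close>, extended by \<open>0\<close> to the orthogonal complement of \<open>\<ell>\<^sup>2X\<^sup>k\<close>. Hence
  its adjoint is also the extension by \<open>0\<close> of the adjoint of \<open>d\<^sub>k\<close>.\<close>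

definition ell2_coboundary ::
    "'v set set \<Rightarrow> ('v \<Rightarrow> 'w::linorder) \<Rightarrow> nat \<Rightarrow> 'v set ell2 \<Rightarrow> 'v set ell2" where
  "ell2_coboundary X \<pi> k f = Abs_ell2 (coboundary X \<pi> k (Rep_ell2 f))"

definition delta :: "'a \<Rightarrow> 'a ell2" where
  "delta x = Abs_ell2 (indicator {x})"


section \<open>Spectral distribution\<close>

text \<open>The representatives \<open>R\<close> identify \<open>\<ell>\<^sup>2X\<^sup>k\<close> with \<open>\<ell>\<^sup>2(\<Gamma>) \<otimes> H\<close>, where \<open>H\<close> has the orthonormal basis \<open>R\<close> and
  \<open>\<delta>\<^sub>g \<otimes> \<rho>\<close> corresponds to the simplex \<open>g\<rho>\<close>. The following is the matrix entry of the kernel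
  \<open>K\<^sub>P(g, h)\<close>, an endomorphism of \<open>H\<close>, at \<open>(\<rho>, \<rho>')\<close>.\<close>

definition operator_kernel ::
    "('g \<Rightarrow> 'v \<Rightarrow> 'v) \<Rightarrow> ('v set ell2 \<Rightarrow> 'v set ell2) \<Rightarrow> 'g \<Rightarrow> 'g \<Rightarrow> 'v set \<Rightarrow> 'v set \<Rightarrow> real" where
  "operator_kernel \<phi> P g h \<rho> \<rho>' = inner (delta (\<phi> g ` \<rho>)) (P (delta (\<phi> h ` \<rho>')))"

definition von_Neumann_trace ::
    "('g, 'b) monoid_scheme \<Rightarrow> ('g \<Rightarrow> 'v \<Rightarrow> 'v) \<Rightarrow> 'v set set \<Rightarrow> ('v set ell2 \<Rightarrow> 'v set ell2) \<Rightarrow> real"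
  where
  "von_Neumann_trace \<Gamma> \<phi> R P = (\<Sum>\<rho>\<in>R. operator_kernel \<phi> P \<one>\<^bsub>\<Gamma>\<^esub> \<one>\<^bsub>\<Gamma>\<^esub> \<rho> \<rho>)"

text \<open>Since \<open>0 \<notin> ]0, t]\<close>, the projection \<open>\<chi>\<^sub>A(]0, t])\<close> vanishes on \<open>ker A = ker d\<^sub>k\<close>, and so it is the spectral
  projection of the restriction of \<open>A\<close> to \<open>(ker d\<^sub>k)\<^sup>\<bottom>\<close>, extended by \<open>0\<close>.\<close>

definition spectral_distribution ::
    "('g, 'b) monoid_scheme \<Rightarrow> ('g \<Rightarrow> 'v \<Rightarrow> 'v) \<Rightarrow> 'v set set \<Rightarrow>
     'v set set \<Rightarrow> ('v \<Rightarrow> 'w::linorder) \<Rightarrow> nat \<Rightarrow> real \<Rightarrow> real" where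
  "spectral_distribution \<Gamma> \<phi> R X \<pi> k t =
     von_Neumann_trace \<Gamma> \<phi> R
       (spectral_projection_Ioc (adjoint (ell2_coboundary X \<pi> k) \<circ> ell2_coboundary X \<pi> k) 0 t)"


section \<open>Cohomology and torsion\<close>

text \<open>The quotient of a vector space by a subspace, as a set of cosets. It vanishes iff it has a
  single element.\<close>

definition quotient_space :: "'h::real_vector set \<Rightarrow> 'h set \<Rightarrow> 'h set set" where
  "quotient_space V W = (\<lambda>v. (\<lambda>w. v + w) ` W) ` V"

text \<open>The next three objects live in degree \<open>k + 1\<close>.\<close>

definition reduced_ell2_cohomology_Suc ::
    "'v set set \<Rightarrow> ('v \<Rightarrow> 'w::linorder) \<Rightarrow> nat \<Rightarrow> 'v set ell2 set set" where
  "reduced_ell2_cohomology_Suc X \<pi> k =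
     quotient_space {f \<in> ell2_cochains X (k + 1). ell2_coboundary X \<pi> (k + 1) f = 0}
       (closure (ell2_coboundary X \<pi> k ` ell2_cochains X k))"

definition coboundaries_lp2_Suc ::
    "ereal \<Rightarrow> 'v set set \<Rightarrow> ('v \<Rightarrow> 'w::linorder) \<Rightarrow> nat \<Rightarrow> 'v set ell2 set" where
  "coboundaries_lp2_Suc p X \<pi> k =
     {f \<in> ell2_cochains X (k + 1). Rep_ell2 f \<in> coboundary X \<pi> k ` lp_cochains p X k}"

definition torsion_lp2_Suc ::
    "ereal \<Rightarrow> 'v set set \<Rightarrow> ('v \<Rightarrow> 'w::linorder) \<Rightarrow> nat \<Rightarrow> 'v set ell2 set set" where
  "torsion_lp2_Suc p X \<pi> k =
     quotient_space (closure (coboundaries_lp2_Suc p X \<pi> k)) (coboundaries_lp2_Suc p X \<pi> k)"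


section \<open>Well-definedness of the coboundary on square-summable cochains\<close>

lemma simplexes_D:
  assumes "abstract_simplicial_complex X" "\<tau> \<in> simplexes X (k + 1)" "v \<in> \<tau>"
  shows "\<tau> - {v} \<in> simplexes X k"
proof -
  have \<tau>: "\<tau> \<in> X" "card \<tau> = k + 2" using assms(2) by (auto simp: simplexes_def)
  then have fin: "finite \<tau>" using assms(1) by (auto simp: abstract_simplicial_complex_def)
  have c: "card (\<tau> - {v}) = k + 1" using \<tau> fin assms(3) by simp
  then have "\<tau> - {v} \<noteq> {}" by (metis One_nat_def add_is_0 card.empty one_neq_zero)
  with \<tau>(1) assms(1) have "\<tau> - {v} \<in> X"
    unfolding abstract_simplicial_complex_def by (metis Diff_subset)
  with c show ?thesis by (simp add: simplexes_def)
qed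

lemma card_cofaces_le:
  assumes cov: "simplicial_covering X K \<pi>" and K: "finite K" and \<sigma>: "\<sigma> \<noteq> {}"
  shows "finite {\<tau>\<in>X. \<sigma> \<subseteq> \<tau>} \<and> card {\<tau>\<in>X. \<sigma> \<subseteq> \<tau>} \<le> card K"
proof -
  obtain v where v: "v \<in> \<sigma>" using \<sigma> by blast
  have inj: "inj_on ((`) \<pi>) {\<tau>\<in>X. \<sigma> \<subseteq> \<tau>}"
  proof (rule inj_onI)
    fix \<tau> \<tau>' assume *: "\<tau> \<in> {\<tau>\<in>X. \<sigma> \<subseteq> \<tau>}" "\<tau>' \<in> {\<tau>\<in>X. \<sigma> \<subseteq> \<tau>}" "\<pi> ` \<tau> = \<pi> ` \<tau>'"
    have "v \<in> \<Union>X" "\<pi> ` \<tau> \<in> K" "\<pi> v \<in> \<pi> ` \<tau>"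
      using * v cov by (auto simp: simplicial_covering_def)
    note * = * this
    have lift: "\<forall>v\<in>\<Union>X. \<forall>\<tau>\<in>K. \<pi> v \<in> \<tau> \<longrightarrow> (\<exists>!\<sigma>. \<sigma> \<in> X \<and> v \<in> \<sigma> \<and> \<pi> ` \<sigma> = \<tau>)"
      using cov unfolding simplicial_covering_def by (elim conjE)
    have "\<exists>!\<rho>. \<rho> \<in> X \<and> v \<in> \<rho> \<and> \<pi> ` \<rho> = \<pi> ` \<tau>"
      by (rule lift[rule_format]) (fact *)+
    then show "\<tau> = \<tau>'" by (rule ex1E) (use * v in \<open>metis (mono_tags, lifting) mem_Collect_eq subsetD\<close>)
  qed
  have sub: "(`) \<pi> ` {\<tau>\<in>X. \<sigma> \<subseteq> \<tau>} \<subseteq> K"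
    using cov by (auto simp: simplicial_covering_def)
  show ?thesis
    using inj_on_finite[OF inj sub K] card_inj_on_le[OF inj sub K] by blast
qed

lemma lp_cochains_2_iff:
  "f \<in> lp_cochains 2 X k \<longleftrightarrow>
     (\<forall>\<sigma>. \<sigma> \<notin> simplexes X k \<longrightarrow> f \<sigma> = 0) \<and> (\<lambda>\<sigma>. (f \<sigma>)\<^sup>2) summable_on UNIV"
proof -
  have p: "\<bar>f \<sigma>\<bar> powr real_of_ereal 2 = (f \<sigma>)\<^sup>2" for \<sigma>
    by (cases "f \<sigma> = 0") simp_all
  have "(\<lambda>\<sigma>. (f \<sigma>)\<^sup>2) summable_on simplexes X k \<longleftrightarrow> (\<lambda>\<sigma>. (f \<sigma>)\<^sup>2) summable_on UNIV"
    if "\<forall>\<sigma>. \<sigma> \<notin> simplexes X k \<longrightarrow> f \<sigma> = 0"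
    by (rule summable_on_cong_neutral) (use that in auto)
  then show ?thesis unfolding lp_cochains_def using p by auto
qed

lemma ell2_cochains_iff:
  "f \<in> ell2_cochains X k \<longleftrightarrow> (\<forall>\<sigma>. \<sigma> \<notin> simplexes X k \<longrightarrow> Rep_ell2 f \<sigma> = 0)"
  unfolding ell2_cochains_def mem_Collect_eq lp_cochains_2_iff by (simp add: Rep_ell2_summable)

lemma coboundary_square_summable:
  assumes cov: "simplicial_covering X K \<pi>" and K: "finite K"
    and f: "(\<lambda>\<sigma>. (f \<sigma>)\<^sup>2) summable_on UNIV"
  shows "(\<lambda>\<tau>. (coboundary X \<pi> k f \<tau>)\<^sup>2) summable_on UNIV"
proof -
  have asc: "abstract_simplicial_complex X" using cov by (simp add: simplicial_covering_def)
  define M where "M = (\<Sum>\<^sub>\<infinity>\<sigma>. (f \<sigma>)\<^sup>2)"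
  define g where "g \<tau> = (coboundary X \<pi> k f \<tau>)\<^sup>2" for \<tau>
  have pt: "g \<tau> \<le> real (k + 2) * (\<Sum>v\<in>\<tau>. (f (\<tau> - {v}))\<^sup>2)" if "\<tau> \<in> simplexes X (k + 1)" for \<tau>
  proof -
    have sign: "((-1) ^ m * c)\<^sup>2 = c\<^sup>2" for m and c :: real
      by (cases "even m") simp_all
    have "g \<tau> = (\<Sum>v\<in>\<tau>. (-1) ^ card {u\<in>\<tau>. \<pi> u < \<pi> v} * f (\<tau> - {v}))\<^sup>2"
      using that by (simp add: g_def coboundary_def)
    also have "\<dots> \<le> (\<Sum>v\<in>\<tau>. ((-1) ^ card {u\<in>\<tau>. \<pi> u < \<pi> v} * f (\<tau> - {v}))\<^sup>2) * real (card \<tau>)"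
      by (rule sum_squared_le_sum_of_squares)
    also have "\<dots> = real (k + 2) * (\<Sum>v\<in>\<tau>. (f (\<tau> - {v}))\<^sup>2)"
      unfolding sign using that by (simp add: simplexes_def mult.commute)
    finally show ?thesis .
  qed
  have bound: "sum g F \<le> real (k + 2) * (real (card K) * M)"
    if F: "finite F" "F \<subseteq> simplexes X (k + 1)" for F
  proof -
    have finF: "finite \<tau>" if "\<tau> \<in> F" for \<tau>
      using that F asc by (auto simp: simplexes_def abstract_simplicial_complex_def)
    define P where "P = (SIGMA \<tau>:F. \<tau>)"
    define face where "face = (\<lambda>(\<tau>, v). \<tau> - {v} :: 'a set)"
    have finP: "finite P" unfolding P_def using F finF by auto
    have fib: "card {x\<in>P. face x = \<sigma>} \<le> card K" if "\<sigma> \<in> face ` P" for \<sigma>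
    proof -
      have "\<sigma> \<in> simplexes X k"
        using that F simplexes_D[OF asc] by (auto simp: P_def face_def)
      then have "\<sigma> \<noteq> {}" by (auto simp: simplexes_def)
      note c = card_cofaces_le[OF cov K this]
      have "inj_on fst {x\<in>P. face x = \<sigma>}"
      proof (rule inj_onI)
        fix x y assume *: "x \<in> {x\<in>P. face x = \<sigma>}" "y \<in> {x\<in>P. face x = \<sigma>}" "fst x = fst y"
        then obtain \<tau> v w where "x = (\<tau>, v)" "y = (\<tau>, w)" by (cases x, cases y) auto
        with * show "x = y" by (auto simp: P_def face_def)
      qed
      moreover have "fst ` {x\<in>P. face x = \<sigma>} \<subseteq> {\<tau>\<in>X. \<sigma> \<subseteq> \<tau>}"
        using F by (auto simp: P_def face_def simplexes_def)
      ultimately have "card {x\<in>P. face x = \<sigma>} \<le> card {\<tau>\<in>X. \<sigma> \<subseteq> \<tau>}"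
        using c card_inj_on_le by blast
      with c show ?thesis by linarith
    qed
    have "(\<Sum>\<tau>\<in>F. \<Sum>v\<in>\<tau>. (f (\<tau> - {v}))\<^sup>2) = (\<Sum>x\<in>P. (f (face x))\<^sup>2)"
      unfolding P_def face_def using F finF by (subst sum.Sigma) (auto intro!: sum.cong)
    also have "\<dots> = (\<Sum>\<sigma>\<in>face ` P. \<Sum>x\<in>{x\<in>P. face x = \<sigma>}. (f (face x))\<^sup>2)"
      by (rule sum.image_gen[OF finP])
    also have "\<dots> = (\<Sum>\<sigma>\<in>face ` P. real (card {x\<in>P. face x = \<sigma>}) * (f \<sigma>)\<^sup>2)"
      by (intro sum.cong refl) simp
    also have "\<dots> \<le> (\<Sum>\<sigma>\<in>face ` P. real (card K) * (f \<sigma>)\<^sup>2)"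
      using fib by (intro sum_mono mult_right_mono) auto
    also have "\<dots> = real (card K) * (\<Sum>\<sigma>\<in>face ` P. (f \<sigma>)\<^sup>2)"
      by (simp add: sum_distrib_left)
    also have "\<dots> \<le> real (card K) * M"
      unfolding M_def using f finP by (intro mult_left_mono finite_sum_le_infsum) auto
    finally have 1: "(\<Sum>\<tau>\<in>F. \<Sum>v\<in>\<tau>. (f (\<tau> - {v}))\<^sup>2) \<le> real (card K) * M" .
    have "sum g F \<le> (\<Sum>\<tau>\<in>F. real (k + 2) * (\<Sum>v\<in>\<tau>. (f (\<tau> - {v}))\<^sup>2))"
      using F pt by (intro sum_mono) auto
    also have "\<dots> = real (k + 2) * (\<Sum>\<tau>\<in>F. \<Sum>v\<in>\<tau>. (f (\<tau> - {v}))\<^sup>2)"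
      by (simp add: sum_distrib_left)
    also have "\<dots> \<le> real (k + 2) * (real (card K) * M)"
      using 1 by (intro mult_left_mono) auto
    finally show ?thesis .
  qed
  have "g summable_on simplexes X (k + 1)"
    by (rule nonneg_bdd_above_summable_on) (use bound in \<open>auto simp: g_def bdd_above_def\<close>)
  moreover have "g summable_on simplexes X (k + 1) \<longleftrightarrow> g summable_on UNIV"
    by (rule summable_on_cong_neutral) (auto simp: g_def coboundary_def)
  ultimately show ?thesis by (simp add: g_def[abs_def])
qed

lemma Rep_ell2_coboundary:
  assumes "simplicial_covering X K \<pi>" "finite K"
  shows "Rep_ell2 (ell2_coboundary X \<pi> k f) = coboundary X \<pi> k (Rep_ell2 f)"
  unfolding ell2_coboundary_def
  by (rule Abs_ell2_inverse)
    (use coboundary_square_summable[OF assms Rep_ell2_summable] in simp)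

lemma Rep_ell2_delta: "Rep_ell2 (delta x) = indicator {x}"
proof -
  have "(\<lambda>y. (indicator {x} y :: real)\<^sup>2) summable_on UNIV \<longleftrightarrow>
      (\<lambda>y. (indicator {x} y :: real)\<^sup>2) summable_on {x}"
    by (rule summable_on_cong_neutral) auto
  then show ?thesis unfolding delta_def by (intro Abs_ell2_inverse) simp
qed

end

theory Submission
  imports Defs "HOL-Probability.Distribution_Functions"
begin

text \<open>Let \<open>A = d\<^sup>* d\<close> with spectral projections \<open>E\<^sub>t\<close>. The range of \<open>E\<^sub>t\<close> is
  \<open>{x. \<forall>n. \<parallel>A\<^sup>n x\<parallel> \<le> t\<^sup>n \<parallel>x\<parallel>}\<close>; this both constructs the resolution and shows that it is
  unique and hence commutes with the deck group. By invariance the bound on the trace becomes the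
  bound \<open>\<parallel>(E\<^sub>t - E\<^sub>0) \<delta>\<^sub>\<sigma>\<parallel>\<^sup>2 \<le> C t\<^bsup>\<alpha>/2\<^esup>\<close> at every simplex \<open>\<sigma>\<close>. For \<open>z\<close> orthogonal to \<open>ker d\<close>
  it controls the low-frequency part \<open>E\<^sub>t z\<close> in the supremum norm by \<open>t\<^bsup>(\<alpha> - 2)/4\<^esup> \<parallel>d z\<parallel>\<close>, while the
  high-frequency part is controlled in \<open>\<ell>\<^sup>2\<close> by the spectral measure; choosing \<open>t\<close> separately at each simplex
  gives the Sobolev inequality \<open>\<parallel>z\<parallel>\<^sub>q \<le> C' \<parallel>d z\<parallel>\<^sub>2\<close> with \<open>1/q = 1/2 - 1/\<alpha>\<close>. Thus every limit of
  coboundaries is the coboundary of an \<open>\<ell>\<^sup>q\<close> cochain. Conversely an \<open>\<ell>\<^sup>2\<close> coboundary of an \<open>\<ell>\<^sup>p\<close> cochain is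
  a cocycle, so that it lies in the closure since the reduced cohomology vanishes.\<close>


section \<open>Closed subspaces of a Hilbert space\<close>

text \<open>The distribution is built from \<open>SOME E. spectral_resolution A E\<close>: nothing
  is known about this choice until a resolution exists, and nothing about its behaviour under deck
  translations until it is unique. Hence both halves of the spectral theorem are proved; the one
  analytic input is a splitting of \<open>A - t\<close> into a nonpositive and a nonnegative part.
  Put \<beta> = (\<alpha> - 2)/4, so that \<alpha>/2 = 2 \<beta> + 1. On the band from t/2 to t the
  energy D of z bounds the norm of its part by sqrt(2 D/t), and the hypothesis bounds that of the
  simplex by the root of C t^(2 \<beta> + 1). The product is of order t^\<beta>, which can be summed
  over t = l, l/2, l/4, ... exactly because \<alpha> > 2. Treating each size of coefficient
  separately would give only a weak-type bound at q = 2 + 1/\<beta> and lose the endpoint 1/p = 1/2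
  - 1/\<alpha>; summing all dyadic tails against one and the same energy gives the strong bound. The
  spectrum of A may reach down to 0, so preimages of a convergent sequence of coboundaries need not
  converge in the Hilbert space. Limits are therefore taken simplex by simplex, and the limit
  cochain is only claimed to lie in the larger space of exponent q.\<close>

lemma norm_diff_sq_real_inner:
  fixes x y :: "'h::real_inner"
  shows "(norm (x - y))\<^sup>2 = (norm x)\<^sup>2 - 2 * inner x y + (norm y)\<^sup>2"
  by (simp add: power2_norm_eq_inner inner_diff_left inner_diff_right inner_commute)

text \<open>The first-order condition at a minimum: moving the nearest point of a subspace by
  \<open>t\<close> times a direction must not shorten the distance, for either sign of
  \<open>t\<close>.\<close>

lemma linear_coefficient_eq_0:
  fixes a b :: real
  assumes "\<And>t. 2 * t * a \<le> t\<^sup>2 * b"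
  shows "a = 0"
proof (rule ccontr)
  assume a: "a \<noteq> 0"
  define c where "c = \<bar>b\<bar> + 1"
  have c: "c > 0" "b \<le> c" by (auto simp: c_def)
  have "2 * (a / c) * a \<le> (a / c)\<^sup>2 * b" by (rule assms)
  also have "\<dots> \<le> (a / c)\<^sup>2 * c" using c by (intro mult_left_mono) auto
  also have "\<dots> = a\<^sup>2 / c" using c by (simp add: power2_eq_square)
  finally have "2 * (a\<^sup>2 / c) \<le> a\<^sup>2 / c" by (simp add: power2_eq_square)
  moreover have "a\<^sup>2 / c > 0" using a c by simp
  ultimately show False by linarith
qed

lemma closed_subspace_decomposition:
  fixes M :: "'h::{real_inner,complete_space} set"
  assumes M: "closed M" "subspace M"
  shows "\<exists>m\<in>M. \<forall>w\<in>M. inner (x - m) w = 0"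
proof -
  define \<delta> where "\<delta> = (INF m\<in>M. (norm (x - m))\<^sup>2)"
  have M0: "0 \<in> M" using M(2) by (rule subspace_0)
  have bdd: "bdd_below ((\<lambda>m. (norm (x - m))\<^sup>2) ` M)" by (auto intro!: bdd_belowI[of _ 0])
  have \<delta>_le: "\<delta> \<le> (norm (x - m))\<^sup>2" if "m \<in> M" for m
    unfolding \<delta>_def by (rule cINF_lower[OF bdd that])
  have "\<exists>m\<in>M. (norm (x - m))\<^sup>2 < \<delta> + inverse (real (Suc n))" for n
    using cINF_less_iff[OF _ bdd, of "\<delta> + inverse (real (Suc n))"] M0 by (auto simp: \<delta>_def)
  then obtain m where m: "\<And>n. m n \<in> M" "\<And>n. (norm (x - m n))\<^sup>2 < \<delta> + inverse (real (Suc n))"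
    by metis
  \<comment> \<open>Parallelogram law for \<open>x - a\<close> and \<open>x - b\<close>. Midpoints
    stay in \<open>M\<close>, so it forces a minimizing sequence to be Cauchy.\<close>
  have par: "(norm (a - b))\<^sup>2 = 2 * (norm (x - a))\<^sup>2 + 2 * (norm (x - b))\<^sup>2
      - 4 * (norm (x - (1/2) *\<^sub>R (a + b)))\<^sup>2" for a b
    by (simp add: power2_norm_eq_inner inner_diff_left inner_diff_right inner_add_left
        inner_add_right inner_commute algebra_simps)
  have close: "(norm (m i - m j))\<^sup>2 \<le> 2 * inverse (real (Suc i)) + 2 * inverse (real (Suc j))" for i j
  proof -
    have "(1/2) *\<^sub>R (m i + m j) \<in> M" using m M(2) by (simp add: subspace_add subspace_scale)
    from \<delta>_le[OF this] show ?thesis unfolding par[of "m i" "m j"] using m(2)[of i] m(2)[of j] by linarith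
  qed
  have "Cauchy m"
  proof (rule metric_CauchyI)
    fix e :: real assume e: "e > 0"
    then have e2: "e\<^sup>2 / 4 > 0" by simp
    then obtain N where N: "inverse (real (Suc N)) < e\<^sup>2 / 4" using reals_Archimedean by blast
    have "dist (m i) (m j) < e" if "i \<ge> N" "j \<ge> N" for i j
    proof -
      have "inverse (real (Suc i)) \<le> inverse (real (Suc N))" "inverse (real (Suc j)) \<le> inverse (real (Suc N))"
        using that by (auto intro!: le_imp_inverse_le)
      then have "(norm (m i - m j))\<^sup>2 < e\<^sup>2" using close[of i j] N by linarith
      then show ?thesis using e unfolding dist_norm by (rule power2_less_imp_less[OF _ less_imp_le])
    qed
    then show "\<exists>N. \<forall>i\<ge>N. \<forall>j\<ge>N. dist (m i) (m j) < e" by blast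
  qed
  then obtain l where l: "m \<longlonglongrightarrow> l" using Cauchy_convergent convergent_def by blast
  have lM: "l \<in> M" by (rule closed_sequentially[OF M(1) _ l]) (rule m(1))
  have "(\<lambda>n. (norm (x - m n))\<^sup>2) \<longlonglongrightarrow> (norm (x - l))\<^sup>2" by (intro tendsto_intros l)
  moreover have "(\<lambda>n. \<delta> + inverse (real (Suc n))) \<longlonglongrightarrow> \<delta> + 0"
    by (intro tendsto_intros LIMSEQ_inverse_real_of_nat)
  ultimately have le: "(norm (x - l))\<^sup>2 \<le> \<delta>"
    using m(2) by (intro LIMSEQ_le[where Y = "\<lambda>n. \<delta> + inverse (real (Suc n))"]) (auto intro: less_imp_le)
  have "inner (x - l) w = 0" if w: "w \<in> M" for w
  proof (rule linear_coefficient_eq_0[where b = "(norm w)\<^sup>2"])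
    fix t :: real
    have "l + t *\<^sub>R w \<in> M" using lM w M(2) by (simp add: subspace_add subspace_scale)
    from order_trans[OF le \<delta>_le[OF this]]
    have "(norm (x - l))\<^sup>2 \<le> (norm (x - (l + t *\<^sub>R w)))\<^sup>2" .
    also have "\<dots> = (norm (x - l))\<^sup>2 - 2 * t * inner (x - l) w + t\<^sup>2 * (norm w)\<^sup>2"
      using norm_diff_sq_real_inner[of "x - l" "t *\<^sub>R w"]
      by (simp add: diff_diff_eq power_mult_distrib)
    finally show "2 * t * inner (x - l) w \<le> t\<^sup>2 * (norm w)\<^sup>2" by linarith
  qed
  with lM show ?thesis by blast
qed

definition projection_onto :: "'h::real_inner set \<Rightarrow> 'h \<Rightarrow> 'h" where
  "projection_onto M x = (THE m. m \<in> M \<and> (\<forall>w\<in>M. inner (x - m) w = 0))"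

text \<open>Two candidates differ by an element of \<open>M\<close> that is orthogonal to itself.
  Later identities between projections are proved by exhibiting a candidate.\<close>

lemma projection_onto_eqI:
  assumes M: "subspace M" and m: "m \<in> M" "\<And>w. w \<in> M \<Longrightarrow> inner (x - m) w = 0"
  shows "projection_onto M x = m"
  unfolding projection_onto_def
proof (rule the_equality)
  show "m \<in> M \<and> (\<forall>w\<in>M. inner (x - m) w = 0)" using m by blast
  fix l assume l: "l \<in> M \<and> (\<forall>w\<in>M. inner (x - l) w = 0)"
  then have "l - m \<in> M" using m M by (simp add: subspace_diff)
  then have "inner (x - m) (l - m) = 0" "inner (x - l) (l - m) = 0" using l m by auto
  then have "inner (l - m) (l - m) = 0" by (simp add: inner_diff_left)
  then show "l = m" by simp
qed

context
  fixes M :: "'h::{real_inner,complete_space} set"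
  assumes M: "closed M" "subspace M"
begin

lemma projection_onto:
  "projection_onto M x \<in> M" "w \<in> M \<Longrightarrow> inner (x - projection_onto M x) w = 0"
proof -
  obtain m where m: "m \<in> M" "\<And>w. w \<in> M \<Longrightarrow> inner (x - m) w = 0"
    using closed_subspace_decomposition[OF M] by blast
  have "projection_onto M x = m" by (rule projection_onto_eqI[OF M(2) m])
  with m show "projection_onto M x \<in> M" "w \<in> M \<Longrightarrow> inner (x - projection_onto M x) w = 0" by auto
qed

lemma projection_onto_id: "x \<in> M \<Longrightarrow> projection_onto M x = x"
  by (rule projection_onto_eqI[OF M(2)]) auto

lemma orthogonal_projection_onto: "orthogonal_projection (projection_onto M)"
  unfolding orthogonal_projection_def
proof (intro conjI allI)
  let ?P = "projection_onto M"
  have add: "?P (x + y) = ?P x + ?P y" for x y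
  proof (rule projection_onto_eqI[OF M(2)])
    show "?P x + ?P y \<in> M" using M(2) projection_onto by (simp add: subspace_add)
    fix w assume "w \<in> M"
    then have "inner (x - ?P x) w = 0" "inner (y - ?P y) w = 0" by (auto intro: projection_onto)
    then show "inner (x + y - (?P x + ?P y)) w = 0" by (simp add: inner_diff_left inner_add_left)
  qed
  have scale: "?P (c *\<^sub>R x) = c *\<^sub>R ?P x" for c x
  proof (rule projection_onto_eqI[OF M(2)])
    show "c *\<^sub>R ?P x \<in> M" using M(2) projection_onto by (simp add: subspace_scale)
    fix w assume "w \<in> M"
    then have "inner (x - ?P x) w = 0" by (auto intro: projection_onto)
    then show "inner (c *\<^sub>R x - c *\<^sub>R ?P x) w = 0" by (simp flip: scaleR_diff_right)
  qed
  have "norm (?P x) \<le> norm x * 1" for x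
  proof -
    have "inner (x - ?P x) (?P x) = 0" by (intro projection_onto)
    then have "(norm (?P x))\<^sup>2 = inner x (?P x)" by (simp add: inner_diff_left power2_norm_eq_inner)
    also have "\<dots> \<le> norm x * norm (?P x)" by (rule norm_cauchy_schwarz)
    finally show ?thesis
      by (cases "?P x = 0") (auto simp: power2_eq_square)
  qed
  then show "bounded_linear ?P" by (rule bounded_linear_intro[OF add scale])
  show "?P (?P x) = ?P x" for x by (rule projection_onto_id[OF projection_onto(1)])
  show "inner (?P x) y = inner x (?P y)" for x y
  proof -
    have "inner (x - ?P x) (?P y) = 0" "inner (y - ?P y) (?P x) = 0" by (intro projection_onto)+
    then have "inner x (?P y) = inner (?P x) (?P y)" "inner y (?P x) = inner (?P y) (?P x)"
      by (simp_all add: inner_diff_left)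
    then show ?thesis by (metis inner_commute)
  qed
qed

end

lemma orthogonal_projectionD:
  assumes "orthogonal_projection P"
  shows "bounded_linear P" "P (P x) = P x" "inner (P x) y = inner x (P y)"
    "inner (P x) x = (norm (P x))\<^sup>2" "norm (P x) \<le> norm x" "P (x + y) = P x + P y"
    "P (x - y) = P x - P y" "P (c *\<^sub>R x) = c *\<^sub>R P x" "P 0 = 0"
proof -
  show bl: "bounded_linear P" and 2: "P (P x) = P x" and 3: "inner (P x) y = inner x (P y)" for x y
    using assms by (auto simp: orthogonal_projection_def)
  interpret bounded_linear P by (fact bl)
  show "P (x + y) = P x + P y" "P (x - y) = P x - P y" "P (c *\<^sub>R x) = c *\<^sub>R P x" "P 0 = 0"
    by (auto simp: add diff scale zero)
  show *: "inner (P x) x = (norm (P x))\<^sup>2" by (metis 2 3 power2_norm_eq_inner)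
  have "norm (P x) * norm (P x) \<le> norm (P x) * norm x"
    using norm_cauchy_schwarz[of "P x" x] * by (simp add: power2_eq_square)
  then show "norm (P x) \<le> norm x" by (cases "P x = 0") auto
qed

text \<open>\<open>adjoint\<close> is a choice among functions with this property, so only existence
  is at stake: the Riesz representation of the functional
  \<open>\<lambda>x. inner (f x) y\<close>.\<close>

lemma adjoint_bounded:
  fixes f :: "'h::{real_inner,complete_space} \<Rightarrow> 'k::real_inner"
  assumes "bounded_linear f"
  shows "inner (f x) y = inner x (adjoint f y)"
proof -
  interpret f: bounded_linear f by fact
  have "\<exists>z. \<forall>x. inner (f x) y = inner x z" for y
  proof -
    define L where "L = {x. inner (f x) y = 0}"
    have L: "closed L" "subspace L"
    proof -
      have "closed ((\<lambda>x. inner (f x) y) -` {0})"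
        by (intro continuous_closed_vimage closed_singleton) (intro continuous_intros f.isCont continuous_ident)
      then show "closed L" by (simp add: L_def vimage_def)
      show "subspace L" by (auto simp: L_def subspace_def f.add f.scale f.zero inner_add_left)
    qed
    show ?thesis
    proof (cases "L = UNIV")
      case True
      then show ?thesis by (intro exI[of _ 0]) (auto simp: L_def)
    next
      case False
      then obtain u where u: "u \<notin> L" by blast
      \<comment> \<open>A normal vector of the hyperplane \<open>L\<close>; a multiple of it
        represents the functional.\<close>
      define v where "v = u - projection_onto L u"
      have v: "v \<notin> L" using u subspace_add[OF L(2) _ projection_onto(1)[OF L], of v u] by (auto simp: v_def)
      have orth: "inner v w = 0" if "w \<in> L" for w unfolding v_def by (rule projection_onto(2)[OF L that])
      define c where "c = inner (f v) y"
      have c: "c \<noteq> 0" using v by (simp add: c_def L_def)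
      have v0: "inner v v \<noteq> 0" using v L(2) subspace_0 by auto
      have "inner (f x) y = inner x ((c / inner v v) *\<^sub>R v)" for x
      proof -
        have "x - (inner (f x) y / c) *\<^sub>R v \<in> L"
          using c by (simp add: L_def f.diff f.scale inner_diff_left c_def)
        from orth[OF this] have "inner v x = inner (f x) y / c * inner v v"
          by (simp add: inner_diff_right)
        then show ?thesis using c v0 by (simp add: inner_commute field_simps)
      qed
      then show ?thesis by blast
    qed
  qed
  then have "\<exists>g. \<forall>x y. inner (f x) y = inner x (g y)" by metis
  then show ?thesis unfolding adjoint_def by (rule someI2_ex) blast
qed

lemma blinfun_compose_assoc: "(a o\<^sub>L b) o\<^sub>L c = a o\<^sub>L (b o\<^sub>L c)"
  by (rule blinfun_eqI) simp

section \<open>Splitting a symmetric operator into its positive and negative parts\<close>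

text \<open>The iteration \<open>q \<mapsto> (T + q\<^sup>2) / 2\<close> is dominated by the same iteration for the real number \<open>1\<close>
  in place of \<open>T\<close>, which increases to \<open>1\<close>; in the limit \<open>(1 - Q)\<^sup>2 = 1 - T\<close>.\<close>

lemma contraction_sqrt:
  fixes T :: "'h::{real_inner,banach} \<Rightarrow>\<^sub>L 'h"
  assumes T: "norm T \<le> 1" and sym: "\<And>x y. inner (T x) y = inner x (T y)"
  shows "\<exists>Q :: 'h \<Rightarrow>\<^sub>L 'h. norm Q \<le> 1 \<and> (\<forall>x y. inner (blinfun_apply Q x) y = inner x (blinfun_apply Q y)) \<and>
    Q + Q = T + (Q o\<^sub>L Q) \<and> (\<forall>B. B o\<^sub>L T = T o\<^sub>L B \<longrightarrow> B o\<^sub>L Q = Q o\<^sub>L B)"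
proof -
  interpret C: bounded_bilinear "(o\<^sub>L) :: ('h \<Rightarrow>\<^sub>L 'h) \<Rightarrow> ('h \<Rightarrow>\<^sub>L 'h) \<Rightarrow> ('h \<Rightarrow>\<^sub>L 'h)"
    by (rule bounded_bilinear_blinfun_compose)
  define q where "q = rec_nat (0 :: 'h \<Rightarrow>\<^sub>L 'h) (\<lambda>_ S. (1/2) *\<^sub>R (T + (S o\<^sub>L S)))"
  define r where "r = rec_nat (0 :: real) (\<lambda>_ s. (1 + s\<^sup>2) / 2)"
  have q: "q 0 = 0" "q (Suc n) = (1/2) *\<^sub>R (T + (q n o\<^sub>L q n))" for n
    by (simp_all add: q_def)
  have r: "r 0 = 0" "r (Suc n) = (1 + (r n)\<^sup>2) / 2" for n by (simp_all add: r_def)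
  have r01: "0 \<le> r n \<and> r n \<le> 1" for n
    by (induction n) (auto simp: r power_le_one)
  have r_mono: "r n \<le> r (Suc n)" for n
    using zero_le_power2[of "1 - r n"] by (simp add: r power2_diff)
  have norm_q: "norm (q n) \<le> r n" for n
  proof (induction n)
    case (Suc n)
    have "norm (q n o\<^sub>L q n) \<le> norm (q n) * norm (q n)" by (rule norm_blinfun_compose)
    also have "\<dots> \<le> r n * r n" using Suc r01 by (intro mult_mono) auto
    finally have "norm (T + (q n o\<^sub>L q n)) \<le> 1 + r n * r n"
      using T norm_triangle_ineq[of T "q n o\<^sub>L q n"] by linarith
    then show ?case by (simp add: q r power2_eq_square)
  qed (simp add: q r)
  have step: "norm (q (Suc n) - q n) \<le> r (Suc n) - r n" for n
  proof (induction n)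
    case 0
    show ?case using T by (simp add: q r)
  next
    case (Suc n)
    define a b where "a = q (Suc n)" and "b = q n"
    \<comment> \<open>A difference of squares that does not require \<open>a\<close> and
      \<open>b\<close> to commute; the scalar iteration satisfies the same recursion with
      equality.\<close>
    have "q (Suc (Suc n)) - a = (1/2) *\<^sub>R ((a o\<^sub>L (a - b)) + ((a - b) o\<^sub>L b))"
      unfolding a_def q(2)[of "Suc n"]
      by (simp only: q(2)[of n, folded a_def b_def] a_def[symmetric] b_def[symmetric])
        (simp add: q(2)[of n, folded a_def b_def] C.diff_left C.diff_right flip: b_def scaleR_diff_right)
    also have "norm \<dots> \<le> (1/2) * (r (Suc n) * (r (Suc n) - r n) + (r (Suc n) - r n) * r n)"
    proof -
      have "norm (a o\<^sub>L (a - b)) \<le> r (Suc n) * (r (Suc n) - r n)"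
        using norm_blinfun_compose[of a "a - b"] norm_q[of "Suc n"] Suc r01[of "Suc n"]
        by (fold a_def b_def, elim order_trans) (intro mult_mono, auto simp: a_def b_def)
      moreover have "norm ((a - b) o\<^sub>L b) \<le> (r (Suc n) - r n) * r n"
        using norm_blinfun_compose[of "a - b" b] norm_q[of n] Suc r_mono[of n]
        by (fold a_def b_def, elim order_trans) (intro mult_mono, auto simp: a_def b_def)
      ultimately show ?thesis
        using norm_triangle_ineq[of "a o\<^sub>L (a - b)" "(a - b) o\<^sub>L b"] by simp
    qed
    also have "\<dots> = r (Suc (Suc n)) - r (Suc n)"
      by (simp only: r(2)[of "Suc n"]) (simp add: r(2)[of n] power2_eq_square field_simps)
    finally show ?case by (simp add: a_def)
  qed
  have diff: "norm (q (n + m) - q n) \<le> r (n + m) - r n" for n m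
  proof (induction m)
    case (Suc m)
    have "norm (q (n + Suc m) - q n) \<le> norm (q (Suc (n + m)) - q (n + m)) + norm (q (n + m) - q n)"
      by (rule order_trans[OF _ norm_triangle_ineq]) simp
    then show ?case using step[of "n + m"] Suc by simp
  qed simp
  have "monoseq r" unfolding monoseq_Suc using r_mono by blast
  moreover have "Bseq r" using r01 by (intro BseqI'[of _ 1]) auto
  ultimately have "Cauchy r" by (intro convergent_Cauchy Bseq_monoseq_convergent)
  have "Cauchy q"
  proof (rule metric_CauchyI)
    fix e :: real assume "e > 0"
    then obtain N where N: "\<And>i j. i \<ge> N \<Longrightarrow> j \<ge> N \<Longrightarrow> dist (r i) (r j) < e"
      using metric_CauchyD[OF \<open>Cauchy r\<close>] by blast
    have *: "dist (q i) (q j) < e" if "i \<ge> N" "i \<le> j" for i j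
    proof -
      have "norm (q j - q i) \<le> r j - r i" using diff[of i "j - i"] that by simp
      also have "\<dots> < e" using N[of j i] that by (simp add: dist_real_def)
      finally show ?thesis by (simp add: dist_norm norm_minus_commute)
    qed
    have "dist (q i) (q j) < e" if "i \<ge> N" "j \<ge> N" for i j
      using *[of i j] *[of j i] that by (cases "i \<le> j") (auto simp: dist_commute)
    then show "\<exists>N. \<forall>i\<ge>N. \<forall>j\<ge>N. dist (q i) (q j) < e" by blast
  qed
  then obtain Q where Q: "q \<longlonglongrightarrow> Q" using Cauchy_convergent convergent_def by blast
  have Qx: "(\<lambda>n. q n x) \<longlonglongrightarrow> Q x" for x by (intro tendsto_intros Q)
  show ?thesis
  proof (intro exI conjI allI impI)
    have "norm (q n) \<le> 1" for n using norm_q[of n] r01[of n] by linarith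
    then show "norm Q \<le> 1" by (intro LIMSEQ_le_const2[OF tendsto_norm[OF Q]]) auto
    show "inner (Q x) y = inner x (Q y)" for x y
    proof -
      have "inner (q n x) y = inner x (q n y)" for n
        by (induction n arbitrary: x y)
          (simp_all add: q sym blinfun.add_left blinfun.scaleR_left inner_add_left inner_add_right)
      moreover have "(\<lambda>n. inner (q n x) y) \<longlonglongrightarrow> inner (Q x) y"
        "(\<lambda>n. inner x (q n y)) \<longlonglongrightarrow> inner x (Q y)" by (intro tendsto_intros Qx)+
      ultimately show ?thesis by (simp add: LIMSEQ_unique)
    qed
    show "Q + Q = T + (Q o\<^sub>L Q)"
    proof (rule LIMSEQ_unique)
      have "(\<lambda>n. q (Suc n) + q (Suc n)) \<longlonglongrightarrow> Q + Q" by (intro tendsto_intros LIMSEQ_Suc Q)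
      moreover have "q (Suc n) + q (Suc n) = T + (q n o\<^sub>L q n)" for n
        by (simp add: q flip: scaleR_add_left)
      ultimately show "(\<lambda>n. T + (q n o\<^sub>L q n)) \<longlonglongrightarrow> Q + Q" by simp
      show "(\<lambda>n. T + (q n o\<^sub>L q n)) \<longlonglongrightarrow> T + (Q o\<^sub>L Q)" by (intro tendsto_intros C.tendsto Q)
    qed
    show "B o\<^sub>L Q = Q o\<^sub>L B" if B: "B o\<^sub>L T = T o\<^sub>L B" for B
    proof -
      have "B o\<^sub>L q n = q n o\<^sub>L B" for n
      proof (induction n)
        case (Suc n)
        have "B o\<^sub>L (q n o\<^sub>L q n) = (B o\<^sub>L q n) o\<^sub>L q n" by (simp add: blinfun_compose_assoc)
        also have "\<dots> = q n o\<^sub>L (B o\<^sub>L q n)" by (simp add: blinfun_compose_assoc Suc)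
        also have "\<dots> = (q n o\<^sub>L q n) o\<^sub>L B" by (simp add: blinfun_compose_assoc Suc)
        finally show ?case by (simp add: q C.scaleR_left C.scaleR_right C.add_left C.add_right B)
      qed (simp add: q)
      moreover have "(\<lambda>n. B o\<^sub>L q n) \<longlonglongrightarrow> (B o\<^sub>L Q)" "(\<lambda>n. q n o\<^sub>L B) \<longlonglongrightarrow> (Q o\<^sub>L B)"
        by (intro C.tendsto tendsto_const Q)+
      ultimately show ?thesis by (simp add: LIMSEQ_unique)
    qed
  qed
qed

text \<open>Rescale \<open>B\<close> to a contraction \<open>D\<close> and let
  \<open>S = |D|\<close>, the positive square root of \<open>D\<^sup>2\<close>. The negative part
  lives on \<open>L = ker (S + D)\<close>; since \<open>(S + D) (S - D) = 0\<close>, on the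
  orthogonal complement of \<open>L\<close> one has \<open>D = S\<close>. Whatever commutes with
  \<open>B\<close> commutes with \<open>S\<close> and \<open>D\<close>, so \<open>L\<close> is
  invariant under \<open>A\<close>.\<close>

lemma symmetric_operator_split:
  fixes A B :: "'h::{real_inner,banach} \<Rightarrow> 'h"
  assumes B: "bounded_linear B" "\<And>x y. inner (B x) y = inner x (B y)"
    and A: "bounded_linear A" "\<And>x. A (B x) = B (A x)"
  obtains L where "closed L" "subspace L" "\<And>x. x \<in> L \<Longrightarrow> A x \<in> L"
    "\<And>x. x \<in> L \<Longrightarrow> inner (B x) x \<le> 0"
    "\<And>x. (\<And>w. w \<in> L \<Longrightarrow> inner x w = 0) \<Longrightarrow> inner (B x) x \<ge> 0"
proof -
  define b where "b = onorm B + 1"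
  have b: "b > 0" using onorm_pos_le[OF B(1)] by (simp add: b_def)
  define D where "D x = (1 / b) *\<^sub>R B x" for x
  have D: "bounded_linear D" unfolding D_def by (intro bounded_linear_const_scaleR B)
  interpret D: bounded_linear D by (fact D)
  interpret A: bounded_linear A by (fact A)
  have D_sym: "inner (D x) y = inner x (D y)" for x y by (simp add: D_def B)
  have AD: "A (D x) = D (A x)" for x by (simp add: D_def A A.scale)
  have D_le: "norm (D x) \<le> norm x" for x
  proof -
    have "norm (B x) \<le> onorm B * norm x" by (rule onorm[OF B(1)])
    also have "\<dots> \<le> b * norm x" by (simp add: b_def mult_right_mono)
    finally show ?thesis using b by (simp add: D_def field_simps)
  qed
  \<comment> \<open>\<open>contraction_sqrt\<close> gives \<open>(1 - Q)\<^sup>2 = 1 - T\<close>, so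
    this \<open>T\<close> makes \<open>1 - Q\<close> a square root of
    \<open>D\<^sup>2\<close>.\<close>
  define T where "T = id_blinfun - (Blinfun D o\<^sub>L Blinfun D)"
  have T: "T x = x - D (D x)" for x by (simp add: T_def blinfun.diff_left bounded_linear_Blinfun_apply[OF D])
  have "norm (T x) \<le> 1 * norm x" for x
  proof -
    have "(norm (T x))\<^sup>2 = (norm x)\<^sup>2 - 2 * (norm (D x))\<^sup>2 + (norm (D (D x)))\<^sup>2"
      unfolding T norm_diff_sq_real_inner by (simp flip: D_sym add: power2_norm_eq_inner)
    moreover have "(norm (D (D x)))\<^sup>2 \<le> (norm (D x))\<^sup>2" by (intro power_mono D_le) simp
    ultimately have "(norm (T x))\<^sup>2 \<le> (norm x)\<^sup>2" using zero_le_power2[of "norm (D x)"] by linarith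
    then show ?thesis by (simp add: power2_le_iff_abs_le)
  qed
  then have nT: "norm T \<le> 1" by (intro norm_blinfun_bound) auto
  have symT: "inner (T x) y = inner x (T y)" for x y
    by (simp add: T inner_diff_left inner_diff_right D_sym)
  obtain Q :: "'h \<Rightarrow>\<^sub>L 'h" where Q': "norm Q \<le> 1 \<and> (\<forall>x y. inner (blinfun_apply Q x) y = inner x (blinfun_apply Q y)) \<and>
      Q + Q = T + (Q o\<^sub>L Q) \<and> (\<forall>B. B o\<^sub>L T = T o\<^sub>L B \<longrightarrow> B o\<^sub>L Q = Q o\<^sub>L B)"
    using contraction_sqrt[OF nT symT] by (rule exE)
  note Q = conjunct1[OF Q'] Q'[THEN conjunct2, THEN conjunct1, rule_format]
    Q'[THEN conjunct2, THEN conjunct2, THEN conjunct1]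
    Q'[THEN conjunct2, THEN conjunct2, THEN conjunct2, rule_format]
  have comm: "C (Q x) = Q (C x)" if "bounded_linear C" "\<And>x. C (D x) = D (C x)" for C x
  proof -
    interpret C: bounded_linear C by (fact that)
    have "Blinfun C o\<^sub>L T = T o\<^sub>L Blinfun C"
      by (rule blinfun_eqI) (simp add: bounded_linear_Blinfun_apply that T C.diff)
    from arg_cong[OF Q(4)[OF this], of "\<lambda>f. blinfun_apply f x"] show ?thesis
      by (simp add: bounded_linear_Blinfun_apply that)
  qed
  define S where "S x = x - Q x" for x
  have S_lin: "S (x + y) = S x + S y" "S (x - y) = S x - S y" "S (c *\<^sub>R x) = c *\<^sub>R S x" "S 0 = 0" for c x y
    by (simp_all add: S_def blinfun.add_right blinfun.diff_right blinfun.scaleR_right scaleR_diff_right)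
  have S_sym: "inner (S x) y = inner x (S y)" for x y
    by (simp add: S_def inner_diff_left inner_diff_right Q)
  have S_pos: "inner (S x) x \<ge> 0" for x
  proof -
    have "norm (Q x) \<le> norm Q * norm x" by (rule norm_blinfun)
    also have "\<dots> \<le> 1 * norm x" using Q(1) by (rule mult_right_mono) simp
    finally have "norm (Q x) * norm x \<le> norm x * norm x" by (intro mult_right_mono) simp_all
    then have "inner (Q x) x \<le> norm x * norm x"
      using norm_cauchy_schwarz[of "Q x" x] by linarith
    then show ?thesis by (simp add: S_def inner_diff_left dot_square_norm power2_eq_square)
  qed
  have SS: "S (S x) = D (D x)" for x
  proof -
    have "Q x + Q x = x - D (D x) + Q (Q x)"
      using arg_cong[OF Q(3), of "\<lambda>f. blinfun_apply f x"] by (simp add: blinfun.add_left T)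
    then show ?thesis by (simp add: S_def blinfun.diff_right algebra_simps)
  qed
  have SD: "D (S x) = S (D x)" for x using comm[OF D] by (simp add: S_def D.diff)
  have SA: "A (S x) = S (A x)" for x using comm[OF A(1) AD] by (simp add: S_def A.diff)
  define L where "L = {x. S x + D x = 0}"
  have w: "S v - D v \<in> L" for v by (simp add: L_def S_lin D.diff SS SD)
  show ?thesis
  proof
    have "closed ((\<lambda>x. S x + D x) -` {0})"
      unfolding S_def by (intro continuous_closed_vimage closed_singleton) (intro continuous_intros D.isCont continuous_ident)
    then show "closed L" by (simp add: L_def vimage_def)
    show "subspace L"
    proof (rule subspaceI)
      show "x + y \<in> L" if "x \<in> L" "y \<in> L" for x y
      proof -
        have "S (x + y) + D (x + y) = (S x + D x) + (S y + D y)" by (simp add: S_lin D.add)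
        then show ?thesis using that by (simp add: L_def)
      qed
      show "c *\<^sub>R x \<in> L" if "x \<in> L" for c x
        using that by (simp add: L_def S_lin D.scale flip: scaleR_add_right)
    qed (simp add: L_def S_lin D.zero)
    show "A x \<in> L" if "x \<in> L" for x
    proof -
      have "A (S x + D x) = S (A x) + D (A x)" by (simp add: A.add SA AD)
      then show ?thesis using that by (simp add: L_def A.zero)
    qed
    show "inner (B x) x \<le> 0" if "x \<in> L" for x
    proof -
      have "D x = - S x" using that by (simp add: L_def eq_neg_iff_add_eq_0 add.commute)
      then have "inner (D x) x \<le> 0" using S_pos[of x] by simp
      then show ?thesis using b by (simp add: D_def divide_le_0_iff)
    qed
    show "inner (B x) x \<ge> 0" if "\<And>w. w \<in> L \<Longrightarrow> inner x w = 0" for x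
    proof -
      define v where "v = S x - D x"
      have "inner v v = inner x (S v - D v)"
        by (subst (1) v_def) (simp only: inner_diff_left inner_diff_right S_sym D_sym)
      then have "inner v v = 0" using that[OF w] by simp
      then have "D x = S x" by (simp add: v_def)
      then have "inner (D x) x \<ge> 0" using S_pos[of x] by simp
      then show ?thesis using b by (simp add: D_def zero_le_divide_iff)
    qed
  qed
qed

section \<open>Spectral subspaces of a positive operator\<close>

lemma no_faster_geometric_growth:
  fixes \<rho> t c C :: real
  assumes "0 \<le> t" "t < \<rho>" "0 < c" "\<And>n. \<rho> ^ n * c \<le> C * t ^ n"
  shows False
proof (cases "t = 0")
  case True
  then show False using assms(4)[of 1] assms(1-3) by (simp add: mult_le_0_iff)
next
  case False
  with assms have t: "t > 0" by simp
  then have "1 < \<rho> / t" using assms by simp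
  then obtain n where "C / c < (\<rho> / t) ^ n" using real_arch_pow by blast
  then have "C * t ^ n < \<rho> ^ n * c" using t assms by (simp add: power_divide field_simps)
  then show False using assms(4)[of n] by linarith
qed

locale positive_operator =
  fixes A :: "'h::{real_inner,banach} \<Rightarrow> 'h"
  assumes bounded: "bounded_linear A"
    and symmetric: "inner (A x) y = inner x (A y)"
    and nonneg: "inner (A x) x \<ge> 0"
begin

sublocale A: bounded_linear A by (fact bounded)

lemma bounded_linear_power: "bounded_linear (A ^^ n)"
  by (induction n) (auto simp: bounded_linear_ident id_def comp_def
      intro: bounded_linear_compose[OF bounded])

lemma power_log_convex: "(norm ((A ^^ Suc n) x))\<^sup>2 \<le> norm ((A ^^ n) x) * norm ((A ^^ Suc (Suc n)) x)"
proof -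
  have "(norm ((A ^^ Suc n) x))\<^sup>2 = inner ((A ^^ n) x) ((A ^^ Suc (Suc n)) x)"
    by (simp add: power2_norm_eq_inner symmetric)
  also have "\<dots> \<le> norm ((A ^^ n) x) * norm ((A ^^ Suc (Suc n)) x)" by (rule norm_cauchy_schwarz)
  finally show ?thesis .
qed

text \<open>By \<open>power_log_convex\<close> the successive ratios of the norms of
  \<open>(A ^^ n) x\<close> do not decrease, so none is below the first. The product form allows for
  vanishing norms.\<close>

lemma power_growth_ratio: "norm ((A ^^ Suc n) x) * norm x \<ge> norm (A x) * norm ((A ^^ n) x)"
proof (induction n)
  case (Suc n)
  define a where "a n = norm ((A ^^ n) x)" for n
  have IH: "a 1 * a n \<le> a (Suc n) * a 0" using Suc by (simp add: a_def)
  have lc: "(a (Suc n))\<^sup>2 \<le> a n * a (Suc (Suc n))" unfolding a_def by (rule power_log_convex)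
  have nn: "a i \<ge> 0" for i by (simp add: a_def)
  have "a 1 * a (Suc n) \<le> a (Suc (Suc n)) * a 0"
  proof (cases "a n = 0 \<or> a (Suc n) = 0")
    case True
    then have "a (Suc n) = 0" using lc by auto
    then show ?thesis using nn by simp
  next
    case False
    then have pos: "a n > 0" "a (Suc n) > 0" using nn[of n] nn[of "Suc n"] by auto
    have "(a 1 * a (Suc n)) * (a n * a (Suc n)) = (a 1 * a n) * (a (Suc n))\<^sup>2"
      by (simp add: power2_eq_square)
    also have "\<dots> \<le> (a (Suc n) * a 0) * (a n * a (Suc (Suc n)))"
      by (intro mult_mono IH lc) (use nn in auto)
    also have "\<dots> = (a (Suc (Suc n)) * a 0) * (a n * a (Suc n))" by simp
    finally show ?thesis using pos by (simp add: mult_le_cancel_right_pos)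
  qed
  then show ?case by (simp add: a_def)
qed simp

definition growth_space :: "real \<Rightarrow> 'h set" where
  "growth_space t = {x. \<forall>n. norm ((A ^^ n) x) \<le> t ^ n * norm x}"

text \<open>The bound improves itself: a vector stretched by a factor above \<open>t\<close> would,
  by \<open>power_growth_ratio\<close>, keep growing at that rate. Admitting an arbitrary
  \<open>C\<close> is what makes closure under sums provable, since constants add.\<close>

lemma growth_spaceI:
  assumes t: "0 \<le> t" and C: "\<And>n. norm ((A ^^ n) x) \<le> C * t ^ n"
  shows "x \<in> growth_space t"
proof -
  have A_le: "norm (A y) \<le> t * norm y" if bd: "\<And>n. norm ((A ^^ n) y) \<le> D * t ^ n" for y D
  proof (rule ccontr)
    assume "\<not> ?thesis"
    then have gt: "norm (A y) > t * norm y" by simp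
    have y: "norm y > 0" using gt by (cases "y = 0") (auto simp: A.zero)
    define \<rho> where "\<rho> = norm (A y) / norm y"
    have \<rho>: "t < \<rho>" using gt y by (simp add: \<rho>_def field_simps)
    have "\<rho> ^ n * norm y \<le> norm ((A ^^ n) y)" for n
    proof (induction n)
      case (Suc n)
      have "\<rho> ^ Suc n * norm y \<le> \<rho> * norm ((A ^^ n) y)"
        using mult_left_mono[OF Suc, of \<rho>] \<rho> t by (simp add: mult.assoc)
      also have "\<dots> \<le> norm ((A ^^ Suc n) y)"
        using power_growth_ratio[of y n] y by (simp add: \<rho>_def field_simps)
      finally show ?case .
    qed simp
    then show False
      using no_faster_geometric_growth[OF t \<rho> y, of D] bd order_trans by blast
  qed
  have "norm ((A ^^ n) x) \<le> t ^ n * norm x" for n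
  proof (induction n)
    case (Suc n)
    have "norm ((A ^^ m) ((A ^^ n) x)) \<le> (C * t ^ n) * t ^ m" for m
      using C[of "m + n"] by (simp add: funpow_add power_add mult_ac)
    \<comment> \<open>An iterate of \<open>x\<close> satisfies the same hypothesis with another
      constant, so it is itself stretched by at most \<open>t\<close>.\<close>
    from A_le[OF this] have "norm ((A ^^ Suc n) x) \<le> t * norm ((A ^^ n) x)" by simp
    also have "\<dots> \<le> t * (t ^ n * norm x)" by (intro mult_left_mono Suc t)
    finally show ?case by (simp add: mult.assoc)
  qed simp
  then show ?thesis by (simp add: growth_space_def)
qed

lemma growth_spaceD: "x \<in> growth_space t \<Longrightarrow> norm ((A ^^ n) x) \<le> t ^ n * norm x"
  by (simp add: growth_space_def)

lemma growth_space_A_le: "x \<in> growth_space t \<Longrightarrow> norm (A x) \<le> t * norm x"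
  using growth_spaceD[of x t 1] by simp

text \<open>A resolution is indexed by all reals, so negative levels have to be dealt with; there
  \<open>n = 1\<close> already excludes nonzero vectors.\<close>

lemma growth_space_neg:
  assumes "t < 0"
  shows "growth_space t = {0}"
proof -
  have "x = 0" if "x \<in> growth_space t" for x
  proof (rule ccontr)
    assume "x \<noteq> 0"
    then have "t * norm x < 0" using assms by (simp add: mult_neg_pos)
    then show False using growth_space_A_le[OF that] norm_ge_zero[of "A x"] by linarith
  qed
  moreover have "0 \<in> growth_space t"
    using bounded_linear.linear[OF bounded_linear_power] by (auto simp: growth_space_def linear_0)
  ultimately show ?thesis by blast
qed

lemma growth_space_A:
  assumes "x \<in> growth_space t"
  shows "A x \<in> growth_space t"
proof (cases "t < 0")
  case True
  then show ?thesis using assms by (simp add: growth_space_neg A.zero)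
next
  case False
  have "norm ((A ^^ n) (A x)) \<le> (t * norm x) * t ^ n" for n
    using growth_spaceD[OF assms, of "Suc n"] by (simp only: funpow_Suc_right o_def power_Suc mult_ac)
  then show ?thesis using False by (intro growth_spaceI) auto
qed

lemma growth_space_mono:
  assumes "s \<le> t"
  shows "growth_space s \<subseteq> growth_space t"
proof (cases "s < 0")
  case True
  have "0 \<in> growth_space t"
    using bounded_linear.linear[OF bounded_linear_power] by (auto simp: growth_space_def linear_0)
  then show ?thesis using True growth_space_neg by auto
next
  case False
  show ?thesis
  proof
    fix x assume x: "x \<in> growth_space s"
    have "norm ((A ^^ n) x) \<le> t ^ n * norm x" for n
      by (rule order_trans[OF growth_spaceD[OF x]]) (use False assms in \<open>intro mult_right_mono power_mono, auto\<close>)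
    then show "x \<in> growth_space t" by (simp add: growth_space_def)
  qed
qed

lemma closed_growth_space: "closed (growth_space t)"
proof -
  have "closed {x. norm ((A ^^ n) x) \<le> t ^ n * norm x}" for n
    by (intro closed_Collect_le continuous_intros linear_continuous_on bounded_linear_power)
  then show ?thesis unfolding growth_space_def by (intro closed_Collect_all) simp
qed

lemma subspace_growth_space: "subspace (growth_space t)"
proof (cases "t < 0")
  case True
  then show ?thesis by (simp add: growth_space_neg subspace_0 subspace_def)
next
  case False
  have lin: "linear (A ^^ n)" for n using bounded_linear_power by (rule bounded_linear.linear)
  show ?thesis
  proof (rule subspaceI)
    show "0 \<in> growth_space t" by (auto simp: growth_space_def lin[THEN linear_0])
    fix x y c assume xy: "x \<in> growth_space t" "y \<in> growth_space t"
    have "norm ((A ^^ n) (x + y)) \<le> (norm x + norm y) * t ^ n" for n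
    proof -
      have "norm ((A ^^ n) (x + y)) \<le> norm ((A ^^ n) x) + norm ((A ^^ n) y)"
        by (simp add: linear_add[OF lin] norm_triangle_ineq)
      also have "\<dots> \<le> t ^ n * norm x + t ^ n * norm y" by (intro add_mono growth_spaceD xy)
      finally show ?thesis by (simp add: algebra_simps)
    qed
    then show "x + y \<in> growth_space t" using False by (intro growth_spaceI) auto
  next
    fix x c assume x: "x \<in> growth_space t"
    have "norm ((A ^^ n) (c *\<^sub>R x)) \<le> t ^ n * norm (c *\<^sub>R x)" for n
      using mult_left_mono[OF growth_spaceD[OF x, of n], of "\<bar>c\<bar>"] by (simp add: linear_cmul[OF lin] mult_ac)
    then show "c *\<^sub>R x \<in> growth_space t" by (simp add: growth_space_def)
  qed
qed

lemma growth_space_top: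
  assumes "onorm A \<le> t"
  shows "growth_space t = UNIV"
proof -
  have t: "0 \<le> t" using assms onorm_pos_le[OF bounded] by linarith
  have "norm ((A ^^ n) x) \<le> t ^ n * norm x" for n x
  proof (induction n)
    case (Suc n)
    have "norm ((A ^^ Suc n) x) \<le> onorm A * norm ((A ^^ n) x)" using onorm[OF bounded] by simp
    also have "\<dots> \<le> t * (t ^ n * norm x)" by (intro mult_mono assms t Suc) simp
    finally show ?case by (simp add: mult.assoc)
  qed simp
  then show ?thesis by (auto simp: growth_space_def)
qed

text \<open>With \<open>v = s x - A x\<close> one has \<open>s (s \<langle>A x, x\<rangle> - \<parallel>A x\<parallel>\<^sup>2) = \<langle>A v, v\<rangle> + \<langle>(s - A) A x, A x\<rangle>\<close>.\<close>

lemma invariant_subspace_A_le: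
  assumes t: "0 \<le> t" and L: "subspace L" "\<And>x. x \<in> L \<Longrightarrow> A x \<in> L"
    and le: "\<And>x. x \<in> L \<Longrightarrow> inner (A x) x \<le> t * (norm x)\<^sup>2" and x: "x \<in> L"
  shows "norm (A x) \<le> t * norm x"
proof -
  \<comment> \<open>The argument divides by \<open>s\<close>, which is positive even when
    \<open>t = 0\<close>; afterwards \<open>s\<close> decreases to \<open>t\<close>.\<close>
  have *: "norm (A x) \<le> s * norm x" if s: "s > t" for s
  proof -
    define v where "v = s *\<^sub>R x - A x"
    have "inner (A v) v + (s * (norm (A x))\<^sup>2 - inner (A (A x)) (A x)) =
        s * (s * inner (A x) x - (norm (A x))\<^sup>2)"
      by (simp add: v_def A.diff A.scale inner_diff_left inner_diff_right power2_norm_eq_inner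
          symmetric algebra_simps)
    moreover have "inner (A (A x)) (A x) \<le> s * (norm (A x))\<^sup>2"
      using le[OF L(2)[OF x]] s mult_right_mono[of t s "(norm (A x))\<^sup>2"] by simp
    ultimately have "s * (s * inner (A x) x - (norm (A x))\<^sup>2) \<ge> 0" using nonneg[of v] by linarith
    then have "(norm (A x))\<^sup>2 \<le> s * inner (A x) x" using s t by (simp add: zero_le_mult_iff)
    also have "\<dots> \<le> s * (s * (norm x)\<^sup>2)"
    proof (intro mult_left_mono)
      show "inner (A x) x \<le> s * (norm x)\<^sup>2"
        using le[OF x] s mult_right_mono[of t s "(norm x)\<^sup>2"] by simp
    qed (use s t in simp)
    finally have "(norm (A x))\<^sup>2 \<le> (s * norm x)\<^sup>2" by (simp add: power2_eq_square mult_ac)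
    then show ?thesis by (rule power2_le_imp_le) (use s t in simp)
  qed
  show ?thesis
  proof (cases "x = 0")
    case True
    then show ?thesis by (simp add: A.zero)
  next
    case False
    have "norm (A x) / norm x \<le> t"
      by (rule dense_ge) (use * False in \<open>simp add: field_simps\<close>)
    then show ?thesis using False by (simp add: field_simps)
  qed
qed

text \<open>Together with \<open>growth_space_A\<close> and \<open>growth_space_upper\<close> this
  makes \<open>growth_space t\<close> the largest invariant subspace on which the quadratic form of
  \<open>A\<close> is at most \<open>t\<close>. Existence and uniqueness of the resolution both rest
  on this maximality.\<close>

lemma invariant_subspace_growth:
  assumes t: "0 \<le> t" and L: "subspace L" "\<And>x. x \<in> L \<Longrightarrow> A x \<in> L"
    and le: "\<And>x. x \<in> L \<Longrightarrow> inner (A x) x \<le> t * (norm x)\<^sup>2"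
  shows "L \<subseteq> growth_space t"
proof
  fix x assume x: "x \<in> L"
  have "(A ^^ n) x \<in> L \<and> norm ((A ^^ n) x) \<le> norm x * t ^ n" for n
  proof (induction n)
    case (Suc n)
    have "norm ((A ^^ Suc n) x) \<le> t * norm ((A ^^ n) x)"
      using invariant_subspace_A_le[OF t L le] Suc by simp
    also have "\<dots> \<le> t * (norm x * t ^ n)" using Suc t by (intro mult_left_mono) auto
    finally show ?case using L(2) Suc by (simp add: mult_ac)
  qed (simp add: x)
  then show "x \<in> growth_space t" by (intro growth_spaceI t) auto
qed

lemma growth_space_upper:
  assumes "x \<in> growth_space t"
  shows "inner (A x) x \<le> t * (norm x)\<^sup>2"
proof -
  have "inner (A x) x \<le> norm (A x) * norm x" by (rule norm_cauchy_schwarz)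
  also have "\<dots> \<le> (t * norm x) * norm x" by (intro mult_right_mono growth_space_A_le assms) simp
  finally show ?thesis by (simp add: power2_eq_square mult_ac)
qed

text \<open>Split \<open>A - t\<close>. Its nonpositive part is an invariant subspace with
  \<open>A\<close> at most \<open>t\<close>, hence inside \<open>growth_space t\<close> by
  maximality; a vector orthogonal to the latter sees only the nonnegative part.\<close>

lemma growth_space_orthogonal_lower:
  assumes x: "\<And>w. w \<in> growth_space t \<Longrightarrow> inner x w = 0"
  shows "inner (A x) x \<ge> t * (norm x)\<^sup>2"
proof (cases "t < 0")
  case True
  then have "t * (norm x)\<^sup>2 \<le> 0" by (simp add: mult_le_0_iff)
  then show ?thesis using nonneg[of x] by linarith
next
  case False
  define B where "B y = A y - t *\<^sub>R y" for y
  have B: "bounded_linear B" unfolding B_def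
    by (intro bounded_linear_sub bounded bounded_linear_scaleR_right)
  have "inner (B y) z = inner y (B z)" for y z
    by (simp add: B_def inner_diff_left inner_diff_right symmetric)
  moreover have "A (B y) = B (A y)" for y by (simp add: B_def A.diff A.scale)
  ultimately obtain L where L: "closed L" "subspace L" "\<And>x. x \<in> L \<Longrightarrow> A x \<in> L"
    "\<And>x. x \<in> L \<Longrightarrow> inner (B x) x \<le> 0"
    "\<And>x. (\<And>w. w \<in> L \<Longrightarrow> inner x w = 0) \<Longrightarrow> inner (B x) x \<ge> 0"
    using symmetric_operator_split[OF B _ bounded] by metis
  have BA: "inner (B y) y = inner (A y) y - t * (norm y)\<^sup>2" for y
    by (simp add: B_def inner_diff_left power2_norm_eq_inner)
  have "L \<subseteq> growth_space t"
    by (rule invariant_subspace_growth[OF _ L(2,3)]) (use False L(4) BA in auto)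
  then have "inner (B x) x \<ge> 0" by (intro L(5) x) auto
  then show ?thesis by (simp add: BA)
qed

end

section \<open>Spectral resolutions of a positive operator\<close>

text \<open>On a partition into equal pieces the increments of \<open>H\<close> add up to at most
  the mesh times the total increment of \<open>F\<close>. This takes the place of Riemann-Stieltjes
  sums when the quadratic form of \<open>A\<close> is compared with the spectral integral.\<close>

lemma const_if_diff_le_mono:
  fixes F H :: "real \<Rightarrow> real"
  assumes H: "\<And>s t. s \<le> t \<Longrightarrow> \<bar>H t - H s\<bar> \<le> (t - s) * (F t - F s)" and ab: "a \<le> b"
  shows "H a = H b"
proof -
  have bound: "\<bar>H b - H a\<bar> \<le> ((b - a) * (F b - F a)) / real (Suc n)" for n
  proof -
    define h where "h = (b - a) / real (Suc n)"
    define p where "p i = a + real i * h" for i :: nat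
    have h: "h \<ge> 0" using ab by (simp add: h_def)
    have p0: "p 0 = a" and pn: "p (Suc n) = b" by (simp_all add: p_def h_def field_simps)
    have "\<bar>H b - H a\<bar> = \<bar>\<Sum>i<Suc n. H (p (Suc i)) - H (p i)\<bar>"
      using sum_lessThan_telescope[of "\<lambda>i. H (p i)" "Suc n"] by (simp only: p0 pn)
    also have "\<dots> \<le> (\<Sum>i<Suc n. \<bar>H (p (Suc i)) - H (p i)\<bar>)" by (rule sum_abs)
    also have "\<dots> \<le> (\<Sum>i<Suc n. h * (F (p (Suc i)) - F (p i)))"
    proof (rule sum_mono)
      fix i
      have "p i \<le> p (Suc i)" "p (Suc i) - p i = h" using h by (simp_all add: p_def algebra_simps)
      then show "\<bar>H (p (Suc i)) - H (p i)\<bar> \<le> h * (F (p (Suc i)) - F (p i))" using H by metis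
    qed
    also have "\<dots> = h * (F b - F a)"
      using sum_lessThan_telescope[of "\<lambda>i. F (p i)" "Suc n"]
      by (simp only: p0 pn flip: sum_distrib_left)
    finally show ?thesis by (simp add: h_def)
  qed
  have "\<bar>H b - H a\<bar> \<le> 0"
  proof (rule LIMSEQ_le_const)
    show "(\<lambda>n. ((b - a) * (F b - F a)) / real (Suc n)) \<longlonglongrightarrow> 0"
      using tendsto_mult[OF tendsto_const LIMSEQ_inverse_real_of_nat, of "(b - a) * (F b - F a)"]
      by (simp add: divide_inverse)
  qed (use bound in blast)
  then show ?thesis by simp
qed

lemma projection_onto_nested:
  fixes M N :: "'h::{real_inner,complete_space} set"
  assumes "closed M" "subspace M" "closed N" "subspace N" "M \<subseteq> N"
  shows "projection_onto M (projection_onto N x) = projection_onto M x"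
proof (rule projection_onto_eqI[OF assms(2)])
  show "projection_onto M x \<in> M" by (rule projection_onto[OF assms(1,2)])
  fix w assume w: "w \<in> M"
  then have "inner (x - projection_onto M x) w = 0" "inner (x - projection_onto N x) w = 0"
    using assms(5) by (auto intro: projection_onto[OF assms(1,2)] projection_onto[OF assms(3,4)])
  then show "inner (projection_onto N x - projection_onto M x) w = 0"
    by (simp add: inner_diff_left)
qed

lemma resolution_of_identityD:
  assumes "resolution_of_identity E"
  shows "orthogonal_projection (E t)" "s \<le> t \<Longrightarrow> E s (E t x) = E s x"
    "s \<le> t \<Longrightarrow> E t (E s x) = E s x" "((\<lambda>s. E s x) \<longlongrightarrow> E t x) (at_right t)"
    "((\<lambda>t. E t x) \<longlongrightarrow> 0) at_bot" "((\<lambda>t. E t x) \<longlongrightarrow> x) at_top"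
    "s \<le> t \<Longrightarrow> (norm (E t x - E s x))\<^sup>2 = inner (E t x) x - inner (E s x) x"
proof -
  show E: "orthogonal_projection (E t)" and 1: "s \<le> t \<Longrightarrow> E s (E t x) = E s x"
    and "((\<lambda>s. E s x) \<longlongrightarrow> E t x) (at_right t)"
    and "((\<lambda>t. E t x) \<longlongrightarrow> 0) at_bot" "((\<lambda>t. E t x) \<longlongrightarrow> x) at_top" for s t x
    using assms by (auto simp: resolution_of_identity_def continuous_within)
  note sym = orthogonal_projectionD(3)[OF E]
  show 2: "E t (E s x) = E s x" if "s \<le> t" for s t x
  proof (rule vector_eq_ldot[THEN iffD1], rule allI)
    show "inner y (E t (E s x)) = inner y (E s x)" for y
      by (metis sym 1[OF that])
  qed
  show "(norm (E t x - E s x))\<^sup>2 = inner (E t x) x - inner (E s x) x" if "s \<le> t"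
  proof -
    have "inner (E t x) (E s x) = inner (E s x) x" by (metis sym 1[OF that] inner_commute)
    then show ?thesis
      by (simp add: norm_diff_sq_real_inner orthogonal_projectionD(4)[OF E])
  qed
qed

locale spectral_measure =
  fixes E :: "real \<Rightarrow> 'h::real_inner \<Rightarrow> 'h" and x :: 'h
  assumes resolution: "resolution_of_identity E"
begin

lemmas E = resolution_of_identityD[OF resolution]

definition F :: "real \<Rightarrow> real" where "F t = inner (E t x) x"

definition \<mu> :: "real measure" where "\<mu> = interval_measure F"

lemma F_mono: "s \<le> t \<Longrightarrow> F s \<le> F t"
  using E(7)[of s t x] zero_le_power2[of "norm (E t x - E s x)"] by (simp add: F_def)

lemma F_right: "continuous (at_right t) F"
  unfolding continuous_within F_def by (intro tendsto_intros E)

lemma F_bot: "(F \<longlongrightarrow> 0) at_bot"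
  unfolding F_def using tendsto_inner[OF E(5) tendsto_const, of x x] by simp

lemma F_top: "(F \<longlongrightarrow> (norm x)\<^sup>2) at_top"
  unfolding F_def power2_norm_eq_inner by (intro tendsto_intros E)

sublocale finite_borel_measure \<mu>
  unfolding \<mu>_def by (rule finite_borel_measure_interval_measure[OF F_mono F_right F_bot F_top]) auto

lemma sets_\<mu> [simp, measurable_cong]: "sets \<mu> = sets borel" by (simp add: \<mu>_def)

lemma space_\<mu> [simp]: "space \<mu> = UNIV" by (simp add: \<mu>_def)

lemma measure_UNIV: "measure \<mu> UNIV = (norm x)\<^sup>2"
  using interval_measure_UNIV[of F "(norm x)\<^sup>2", OF F_mono F_right F_bot F_top]
  by (simp add: \<mu>_def measure_def)

lemma measure_Iic: "measure \<mu> {..t} = F t"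
  unfolding \<mu>_def by (rule measure_interval_measure_Iic[OF F_mono F_right F_bot])

lemma measure_Ioi: "measure \<mu> {t<..} = (norm x)\<^sup>2 - F t"
  using finite_measure_compl[of "{..t}"] by (simp add: measure_UNIV measure_Iic Compl_eq_Diff_UNIV[symmetric])

lemma measure_Ioc: "s \<le> t \<Longrightarrow> measure \<mu> {s<..t} = F t - F s"
  unfolding \<mu>_def by (rule measure_interval_measure_Ioc[OF _ F_mono F_right])

lemma AE_Iic: "F t = (norm x)\<^sup>2 \<Longrightarrow> AE u in \<mu>. u \<le> t"
  by (rule AE_I[where N = "{t<..}"]) (auto simp: emeasure_eq_measure measure_Ioi)

lemma AE_Ioi: "F t = 0 \<Longrightarrow> AE u in \<mu>. t < u"
  by (rule AE_I[where N = "{..t}"]) (auto simp: emeasure_eq_measure measure_Iic)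

end

section \<open>Existence: the projections onto the growth spaces form a resolution\<close>

context positive_operator
begin

abbreviation spectral_proj :: "real \<Rightarrow> 'h \<Rightarrow> 'h" where
  "spectral_proj t \<equiv> projection_onto (growth_space t)"

lemmas proj_growth = projection_onto[OF closed_growth_space subspace_growth_space]

lemma spectral_proj_neg: "t < 0 \<Longrightarrow> spectral_proj t x = 0"
  using proj_growth(1)[of t x] growth_space_neg by blast

lemma spectral_proj_top: "onorm A \<le> t \<Longrightarrow> spectral_proj t x = x"
  by (rule projection_onto_id[OF closed_growth_space subspace_growth_space]) (simp add: growth_space_top)

text \<open>The projections decrease with the level, so by Pythagoras their squared norms control
  their differences and a sequence of levels falling to \<open>t\<close> gives a limit. The
  inequalities defining the growth spaces pass to the limit in the level, which places it in
  \<open>growth_space t\<close>.\<close>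

lemma spectral_proj_right: "((\<lambda>s. spectral_proj s x) \<longlongrightarrow> spectral_proj t x) (at_right t)"
proof -
  note cs = closed_growth_space subspace_growth_space
  note proj = orthogonal_projectionD[OF orthogonal_projection_onto[OF cs]]
  note nest = projection_onto_nested[OF cs cs growth_space_mono]
  define s where "s n = t + inverse (real (Suc n))" for n
  have s_gt: "s n > t" for n by (simp add: s_def)
  have s_anti: "s m \<le> s n" if "n \<le> m" for n m using that by (auto simp: s_def intro!: le_imp_inverse_le)
  have s_lim: "s \<longlonglongrightarrow> t" using tendsto_add[OF tendsto_const LIMSEQ_inverse_real_of_nat, of t]
    by (simp add: s_def[abs_def])
  define z where "z n = spectral_proj (s n) x" for n
  define f where "f n = (norm (z n))\<^sup>2" for n
  have diff: "(norm (z n - z m))\<^sup>2 = f n - f m" if "n \<le> m" for n m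
  proof -
    have "inner (z n) (z m) = f m"
    proof -
      have "inner (z n) (z m) = inner (z n) (spectral_proj (s m) (z m))" by (simp add: z_def proj)
      also have "\<dots> = inner (spectral_proj (s m) (z n)) (z m)" by (simp add: proj)
      also have "spectral_proj (s m) (z n) = z m" unfolding z_def by (rule nest[OF s_anti[OF that]])
      finally show ?thesis by (simp add: f_def power2_norm_eq_inner)
    qed
    then show ?thesis by (simp add: norm_diff_sq_real_inner f_def)
  qed
  have "Cauchy f"
  proof -
    have "f (Suc n) \<le> f n" for n using diff[of n "Suc n"] zero_le_power2[of "norm (z n - z (Suc n))"] by simp
    then have "monoseq f" unfolding monoseq_Suc by blast
    moreover have "f n \<le> (norm x)\<^sup>2" for n unfolding f_def z_def by (intro power_mono proj) simp
    then have "Bseq f" by (intro BseqI'[of _ "(norm x)\<^sup>2"]) (auto simp: f_def)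
    ultimately show ?thesis by (intro convergent_Cauchy Bseq_monoseq_convergent)
  qed
  have "Cauchy z"
  proof (rule metric_CauchyI)
    fix e :: real assume e: "e > 0"
    then have "e\<^sup>2 > 0" by simp
    then obtain N where N: "\<And>i j. i \<ge> N \<Longrightarrow> j \<ge> N \<Longrightarrow> dist (f i) (f j) < e\<^sup>2"
      using metric_CauchyD[OF \<open>Cauchy f\<close>] by blast
    have *: "dist (z i) (z j) < e" if "i \<ge> N" "i \<le> j" for i j
    proof -
      have "(norm (z i - z j))\<^sup>2 < e\<^sup>2" using diff[of i j] N[of i j] that by (simp add: dist_real_def)
      then show ?thesis unfolding dist_norm by (rule power2_less_imp_less) (use e in simp)
    qed
    have "dist (z i) (z j) < e" if "i \<ge> N" "j \<ge> N" for i j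
      using *[of i j] *[of j i] that by (cases "i \<le> j") (auto simp: dist_commute)
    then show "\<exists>N. \<forall>i\<ge>N. \<forall>j\<ge>N. dist (z i) (z j) < e" by blast
  qed
  then obtain l where l: "z \<longlonglongrightarrow> l" using Cauchy_convergent convergent_def by blast
  have "spectral_proj t x = l"
  proof (rule projection_onto_eqI[OF subspace_growth_space])
    have "norm ((A ^^ n) l) \<le> t ^ n * norm l" for n
    proof (rule LIMSEQ_le)
      have "z m \<in> growth_space (s m)" for m unfolding z_def by (rule proj_growth)
      then show "\<exists>N. \<forall>m\<ge>N. norm ((A ^^ n) (z m)) \<le> s m ^ n * norm (z m)" using growth_spaceD by blast
      show "(\<lambda>m. norm ((A ^^ n) (z m))) \<longlonglongrightarrow> norm ((A ^^ n) l)"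
        by (intro tendsto_norm bounded_linear.tendsto[OF bounded_linear_power] l)
      show "(\<lambda>m. s m ^ n * norm (z m)) \<longlonglongrightarrow> t ^ n * norm l" by (intro tendsto_intros s_lim l)
    qed
    then show "l \<in> growth_space t" by (simp add: growth_space_def)
    fix w assume w: "w \<in> growth_space t"
    have "inner (x - z n) w = 0" for n
      unfolding z_def using w growth_space_mono[of t "s n"] s_gt[of n] by (intro proj_growth) auto
    moreover have "(\<lambda>n. inner (x - z n) w) \<longlonglongrightarrow> inner (x - l) w" by (intro tendsto_intros l)
    ultimately show "inner (x - l) w = 0" by (simp add: LIMSEQ_const_iff)
  qed
  then have z: "z \<longlonglongrightarrow> spectral_proj t x" using l by simp
  show ?thesis
  proof (rule tendstoI)
    fix e :: real assume "e > 0"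
    then obtain n where n: "dist (z n) (spectral_proj t x) < e"
      using metric_LIMSEQ_D[OF z] by blast
    \<comment> \<open>The projection at \<open>r\<close> sends \<open>z n\<close> to
      \<open>spectral_proj r x\<close> and fixes \<open>spectral_proj t x\<close>; being a
      contraction, it carries the estimate from the sequence over to all \<open>r\<close>.\<close>
    have "dist (spectral_proj r x) (spectral_proj t x) < e" if r: "t < r" "r < s n" for r
    proof -
      have 1: "spectral_proj r (z n) = spectral_proj r x" unfolding z_def by (rule nest) (use r in simp)
      have 2: "spectral_proj r (spectral_proj t x) = spectral_proj t x"
        using growth_space_mono[of t r] r proj_growth(1)[of t x] by (intro projection_onto_id[OF cs]) auto
      have "norm (spectral_proj r (z n - spectral_proj t x)) \<le> norm (z n - spectral_proj t x)" by (rule proj)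
      then show ?thesis using n by (simp add: proj 1 2 dist_norm)
    qed
    then show "\<forall>\<^sub>F r in at_right t. dist (spectral_proj r x) (spectral_proj t x) < e"
      unfolding eventually_at_right_field using s_gt by blast
  qed
qed

lemma resolution_spectral_proj: "resolution_of_identity spectral_proj"
  unfolding resolution_of_identity_def
proof (intro conjI allI impI)
  note cs = closed_growth_space subspace_growth_space
  show "orthogonal_projection (spectral_proj t)" for t by (rule orthogonal_projection_onto[OF cs])
  show "s \<le> t \<Longrightarrow> spectral_proj s (spectral_proj t x) = spectral_proj s x" for s t x
    by (rule projection_onto_nested[OF cs cs growth_space_mono])
  show "continuous (at_right t) (\<lambda>s. spectral_proj s x)" for t x
    unfolding continuous_within by (rule spectral_proj_right)
  show "((\<lambda>t. spectral_proj t x) \<longlongrightarrow> 0) at_bot" for x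
    by (rule tendsto_eventually) (auto simp: eventually_at_bot_dense spectral_proj_neg intro!: exI[of _ 0])
  show "((\<lambda>t. spectral_proj t x) \<longlongrightarrow> x) at_top" for x
    by (rule tendsto_eventually) (auto simp: eventually_at_top_linorder spectral_proj_top intro!: exI[of _ "onorm A"])
qed

text \<open>Cut off at \<open>t\<close>, the quadratic form (\<open>G\<close>) and the spectral
  integral (\<open>I\<close>) both change over \<open>]s, t]\<close> by an amount between
  \<open>s\<close> and \<open>t\<close> times the spectral mass. By
  \<open>const_if_diff_le_mono\<close> their difference is constant; it vanishes at
  \<open>-1\<close>, and at \<open>onorm A\<close> nothing is cut off.\<close>

theorem spectral_resolution_exists: "spectral_resolution A spectral_proj"
proof -
  have "integrable (interval_measure (\<lambda>t. inner (spectral_proj t x) x)) (\<lambda>t. t) \<and>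
      inner (A x) x = (\<integral>t. t \<partial>interval_measure (\<lambda>t. inner (spectral_proj t x) x))" for x
  proof -
    interpret S: spectral_measure spectral_proj x by (unfold_locales) (rule resolution_spectral_proj)
    have \<mu>: "interval_measure (\<lambda>t. inner (spectral_proj t x) x) = S.\<mu>" by (simp add: S.\<mu>_def S.F_def[abs_def])
    define b where "b = onorm A"
    have b: "b \<ge> 0" by (simp add: b_def onorm_pos_le bounded)
    have "AE u in S.\<mu>. -1 < u" by (rule S.AE_Ioi) (simp add: S.F_def spectral_proj_neg)
    moreover have "AE u in S.\<mu>. u \<le> b"
      by (rule S.AE_Iic) (simp add: S.F_def spectral_proj_top b_def power2_norm_eq_inner)
    ultimately have AE: "AE u in S.\<mu>. u \<in> {-1<..b}" by eventually_elim simp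
    have int: "integrable S.\<mu> (\<lambda>u. u)"
    proof (rule S.integrable_const_bound[where B = "b + 1"])
      show "AE u in S.\<mu>. norm u \<le> b + 1" using AE by eventually_elim (use b in auto)
    qed simp
    have int_Ioc: "integrable S.\<mu> (\<lambda>u. indicator {s<..t} u * u)" for s t
      using integrable_mult_indicator[OF _ int, of "{s<..t}"] by simp
    define G where "G t = inner (A (spectral_proj t x)) (spectral_proj t x)" for t
    \<comment> \<open>The level \<open>-1\<close> lies strictly below the spectrum, so a possible
      atom at 0, coming from the kernel of \<open>A\<close>, is included.\<close>
    define I where "I t = (\<integral>u. indicator {-1<..t} u * u \<partial>S.\<mu>)" for t
    have G: "s * (S.F t - S.F s) \<le> G t - G s \<and> G t - G s \<le> t * (S.F t - S.F s)" if st: "s \<le> t" for s t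
    proof -
      define v where "v = spectral_proj t x - spectral_proj s x"
      have nv: "(norm v)\<^sup>2 = S.F t - S.F s" unfolding v_def S.F_def by (rule S.E(7)[OF st])
      have vt: "v \<in> growth_space t" unfolding v_def
        using growth_space_mono[OF st] proj_growth(1) by (intro subspace_diff subspace_growth_space) auto
      have vs: "inner v w = 0" if w: "w \<in> growth_space s" for w
      proof -
        have "inner (x - spectral_proj t x) w = 0" "inner (x - spectral_proj s x) w = 0"
          using w growth_space_mono[OF st] by (auto intro: proj_growth)
        then show ?thesis by (simp add: v_def inner_diff_left)
      qed
      have "spectral_proj t x = v + spectral_proj s x" by (simp add: v_def)
      then have "G t = inner (A v) v + 2 * inner v (A (spectral_proj s x)) + G s"
        by (simp add: G_def A.add inner_add_left inner_add_right symmetric inner_commute)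
      \<comment> \<open>The cross term vanishes: \<open>v\<close> is orthogonal to
        \<open>growth_space s\<close>, which \<open>A\<close> preserves.\<close>
      then have "G t - G s = inner (A v) v" using vs growth_space_A proj_growth(1) by simp
      then show ?thesis
        using growth_space_upper[OF vt] growth_space_orthogonal_lower[OF vs] by (simp flip: nv)
    qed
    have I: "s * (S.F t - S.F s) \<le> I t - I s \<and> I t - I s \<le> t * (S.F t - S.F s)" if st: "-1 \<le> s" "s \<le> t" for s t
    proof -
      have "I t - I s = (\<integral>u. indicator {-1<..t} u * u - indicator {-1<..s} u * u \<partial>S.\<mu>)"
        unfolding I_def by (rule Bochner_Integration.integral_diff[symmetric]) (intro int_Ioc)+
      also have "\<dots> = (\<integral>u. indicator {s<..t} u * u \<partial>S.\<mu>)"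
        by (rule Bochner_Integration.integral_cong) (use st in \<open>auto simp: indicator_def\<close>)
      finally have eq: "I t - I s = (\<integral>u. indicator {s<..t} u * u \<partial>S.\<mu>)" .
      have c: "(\<integral>u. indicator {s<..t} u * c \<partial>S.\<mu>) = c * (S.F t - S.F s)" for c
        using S.measure_Ioc[OF st(2)] by simp
      have ic: "integrable S.\<mu> (\<lambda>u. indicator {s<..t} u * (c::real))" for c
        by (intro integrable_mult_left) (simp add: S.emeasure_eq_measure)
      have "(\<integral>u. indicator {s<..t} u * s \<partial>S.\<mu>) \<le> (\<integral>u. indicator {s<..t} u * u \<partial>S.\<mu>)"
        by (intro integral_mono ic int_Ioc) (auto simp: indicator_def)
      moreover have "(\<integral>u. indicator {s<..t} u * u \<partial>S.\<mu>) \<le> (\<integral>u. indicator {s<..t} u * t \<partial>S.\<mu>)"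
        by (intro integral_mono ic int_Ioc) (auto simp: indicator_def)
      ultimately show ?thesis unfolding eq c by simp
    qed
    \<comment> \<open>The estimate for \<open>I\<close> starts at \<open>-1\<close>, so both
      functions are frozen below that level.\<close>
    define H where "H t = G (max (-1) t) - I (max (-1) t)" for t
    have "H (-1) = H (max (-1) b)"
    proof (rule const_if_diff_le_mono[where H = H and F = "\<lambda>t. S.F (max (-1) t)"])
      fix s t :: real assume st: "s \<le> t"
      define s' t' where "s' = max (-1) s" and "t' = max (-1) t"
      have *: "-1 \<le> s'" "s' \<le> t'" "t' - s' \<le> t - s" using st by (auto simp: s'_def t'_def)
      have "\<bar>H t - H s\<bar> \<le> (t' - s') * (S.F t' - S.F s')"
      proof -
        have "H t - H s = (G t' - G s') - (I t' - I s')" by (simp add: H_def s'_def t'_def)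
        then show ?thesis using G[of s' t'] I[of s' t'] * unfolding left_diff_distrib by linarith
      qed
      also have "\<dots> \<le> (t - s) * (S.F t' - S.F s')"
        using * S.F_mono[of s' t'] by (intro mult_right_mono) auto
      finally show "\<bar>H t - H s\<bar> \<le> (t - s) * (S.F (max (-1) t) - S.F (max (-1) s))" by (simp add: s'_def t'_def)
    qed simp
    moreover have "H (-1) = 0" by (simp add: H_def G_def I_def spectral_proj_neg A.zero)
    moreover have "max (-1) b = b" using b by simp
    ultimately have "G b = I b" by (simp add: H_def)
    moreover have "I b = (\<integral>u. u \<partial>S.\<mu>)"
      unfolding I_def
    proof (rule integral_cong_AE)
      show "AE u in S.\<mu>. indicator {-1<..b} u * u = u" using AE by eventually_elim simp
    qed measurable
    moreover have "G b = inner (A x) x" by (simp add: G_def b_def spectral_proj_top)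
    ultimately show ?thesis using int by (simp add: \<mu>)
  qed
  then show ?thesis unfolding spectral_resolution_def using resolution_spectral_proj by blast
qed

end

section \<open>Uniqueness of the spectral resolution\<close>

context spectral_measure
begin

lemma norm_sq_diff: "(norm (x - E t x))\<^sup>2 = (norm x)\<^sup>2 - F t"
  unfolding norm_diff_sq_real_inner F_def using orthogonal_projectionD(4)[OF E(1), of t x]
  by (simp add: inner_commute)

end

locale resolved_operator = positive_operator A for A :: "'h::{real_inner,banach} \<Rightarrow> 'h" +
  fixes E :: "real \<Rightarrow> 'h \<Rightarrow> 'h"
  assumes resolved: "spectral_resolution A E"
begin

lemma resolution: "resolution_of_identity E"
  using resolved by (simp add: spectral_resolution_def)

lemmas E = resolution_of_identityD[OF resolution]
lemmas proj = orthogonal_projectionD[OF E(1)]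

sublocale S: spectral_measure E x for x
  by unfold_locales (rule resolution)

lemma integrable_id: "integrable (S.\<mu> x) (\<lambda>u. u)"
  and quadratic_form: "inner (A x) x = (\<integral>u. u \<partial>S.\<mu> x)"
proof -
  have "interval_measure (\<lambda>t. inner (E t x) x) = S.\<mu> x" by (simp add: S.\<mu>_def S.F_def[abs_def])
  moreover have "integrable (interval_measure (\<lambda>t. inner (E t x) x)) (\<lambda>t. t) \<and>
      inner (A x) x = (\<integral>t. t \<partial>interval_measure (\<lambda>t. inner (E t x) x))"
    using resolved unfolding spectral_resolution_def by blast
  ultimately show "integrable (S.\<mu> x) (\<lambda>u. u)" "inner (A x) x = (\<integral>u. u \<partial>S.\<mu> x)"
    by simp_all
qed

lemma range_upper:
  assumes "E t x = x"
  shows "inner (A x) x \<le> t * (norm x)\<^sup>2"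
proof -
  have "AE u in S.\<mu> x. u \<le> t" by (rule S.AE_Iic) (simp add: S.F_def assms power2_norm_eq_inner)
  then have "(\<integral>u. u \<partial>S.\<mu> x) \<le> (\<integral>u. t \<partial>S.\<mu> x)"
    by (intro integral_mono_AE integrable_id) auto
  then show ?thesis by (simp add: quadratic_form S.measure_UNIV mult.commute)
qed

lemma kernel_lower:
  assumes "E t x = 0"
  shows "t * (norm x)\<^sup>2 \<le> inner (A x) x"
proof -
  have "AE u in S.\<mu> x. t < u" by (rule S.AE_Ioi) (simp add: S.F_def assms)
  then have "AE u in S.\<mu> x. t \<le> u" by eventually_elim simp
  then have "(\<integral>u. t \<partial>S.\<mu> x) \<le> (\<integral>u. u \<partial>S.\<mu> x)"
    by (intro integral_mono_AE integrable_id) auto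
  then show ?thesis by (simp add: quadratic_form S.measure_UNIV mult.commute)
qed

text \<open>A resolution gives only the quadratic form of \<open>A\<close>. The projections decouple
  \<open>y\<close> from \<open>z\<close>, so \<open>y + z\<close> and \<open>y - z\<close> have the
  same spectral measure and hence the same quadratic form; the difference of the two forms is a
  multiple of the mixed term.\<close>

lemma range_kernel_orthogonal: "inner (A (E t u)) (v - E t v) = 0"
proof -
  define y z where "y = E t u" and "z = v - E t v"
  have cross: "inner (E s y) z = 0" for s
  proof (cases "s \<le> t")
    case True
    have "inner (E s y) z = inner y (E s z)" by (rule proj)
    also have "E s z = 0" using True by (simp add: z_def proj E)
    finally show ?thesis by simp
  next
    case False
    then have "E s y = E t u" by (simp add: y_def E)
    also have "inner \<dots> z = inner u (E t z)" by (rule proj)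
    also have "E t z = 0" by (simp add: z_def proj)
    finally show ?thesis by simp
  qed
  have cross': "inner (E s z) y = 0" "inner y (E s z) = 0" "inner z (E s y) = 0" for s
    by (metis cross proj(3) inner_commute)+
  have "S.F (y + z) = S.F (y - z)"
    by (rule ext) (simp add: S.F_def proj inner_add_left inner_add_right inner_diff_left
        inner_diff_right cross cross')
  then have "S.\<mu> (y + z) = S.\<mu> (y - z)" by (simp add: S.\<mu>_def)
  then have "inner (A (y + z)) (y + z) = inner (A (y - z)) (y - z)" by (simp add: quadratic_form)
  then have "inner (A y) z + inner (A z) y = 0"
    by (simp add: A.add A.diff inner_add_left inner_add_right inner_diff_left inner_diff_right)
  moreover have "inner (A z) y = inner (A y) z" by (metis symmetric inner_commute)
  ultimately show ?thesis by (simp add: y_def z_def)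
qed

lemma commute: "E t (A x) = A (E t x)"
proof (rule vector_eq_rdot[THEN iffD1], rule allI)
  fix w
  have "inner (A (E t w)) (x - E t x) = 0" "inner (A (E t x)) (w - E t w) = 0"
    by (rule range_kernel_orthogonal)+
  then have "inner (A (E t w)) x = inner (A (E t w)) (E t x)" "inner (A (E t x)) w = inner (A (E t x)) (E t w)"
    by (simp_all add: inner_diff_right)
  then show "inner (E t (A x)) w = inner (A (E t x)) w"
    by (metis proj(3) symmetric inner_commute)
qed

lemma commute_power: "E t ((A ^^ n) x) = (A ^^ n) (E t x)"
  by (induction n) (simp_all add: commute)

lemma norm_compl_le: "norm (x - E t x) \<le> norm x"
proof -
  have "(norm (x - E t x))\<^sup>2 \<le> (norm x)\<^sup>2"
    using S.norm_sq_diff[of x t] proj(4)[of t x] by (simp add: S.F_def)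
  then show ?thesis by (rule power2_le_imp_le) simp
qed

text \<open>The part of \<open>w\<close> beyond a level \<open>s > t\<close> grows at least like
  \<open>s ^ n\<close> by \<open>kernel_lower\<close>, but at most like \<open>t ^ n\<close> because
  \<open>E s\<close> commutes with \<open>A\<close>. So it is zero, and right continuity brings
  \<open>s\<close> down to \<open>t\<close>.\<close>

lemma growth_space_fixed:
  assumes t: "0 \<le> t" and w: "w \<in> growth_space t"
  shows "E t w = w"
proof -
  have fix_s: "E s w = w" if s: "t < s" for s
  proof (rule ccontr)
    assume ne: "E s w \<noteq> w"
    define y where "y = w - E s w"
    have y: "norm y > 0" using ne by (simp add: y_def)
    have ker: "E s ((A ^^ n) y) = 0" for n
      by (simp add: commute_power) (simp add: y_def proj bounded_linear_power[THEN bounded_linear.linear, THEN linear_0])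
    have low: "s ^ n * norm y \<le> norm ((A ^^ n) y)" for n
    proof (induction n)
      case (Suc n)
      define v where "v = (A ^^ n) y"
      have "s * (norm v)\<^sup>2 \<le> inner (A v) v" unfolding v_def by (rule kernel_lower[OF ker])
      also have "\<dots> \<le> norm (A v) * norm v" by (rule norm_cauchy_schwarz)
      finally have "s * norm v \<le> norm (A v)" by (cases "v = 0") (auto simp: power2_eq_square)
      moreover have "s * (s ^ n * norm y) \<le> s * norm v" using Suc s t by (simp add: v_def)
      ultimately show ?case by (simp add: v_def mult.assoc)
    qed simp
    have up: "norm ((A ^^ n) y) \<le> norm w * t ^ n" for n
    proof -
      have "(A ^^ n) y = (A ^^ n) w - E s ((A ^^ n) w)"
        by (simp add: y_def commute_power linear_diff[OF bounded_linear.linear[OF bounded_linear_power]])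
      then have "norm ((A ^^ n) y) \<le> norm ((A ^^ n) w)" by (simp add: norm_compl_le)
      then show ?thesis using growth_spaceD[OF w, of n] by (simp add: mult.commute)
    qed
    show False
      by (rule no_faster_geometric_growth[OF t s y order_trans[OF low up]])
  qed
  have "((\<lambda>s. E s w) \<longlongrightarrow> w) (at_right t)"
    by (rule tendsto_eventually) (use fix_s in \<open>auto simp: eventually_at_right_less eventually_at_right_field intro!: exI[of _ "t + 1"]\<close>)
  then show ?thesis using tendsto_unique[OF _ E(4)] by fastforce
qed

text \<open>The range of \<open>E t\<close> is invariant with \<open>A\<close> at most
  \<open>t\<close>, hence lies in \<open>growth_space t\<close> by maximality;
  \<open>growth_space_fixed\<close> is the converse inclusion. This is the uniqueness of the
  resolution.\<close>

lemma eq_spectral_proj: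
  assumes t: "0 \<le> t"
  shows "E t x = spectral_proj t x"
proof (rule projection_onto_eqI[OF subspace_growth_space, symmetric])
  have "{y. E t y = y} \<subseteq> growth_space t"
  proof (rule invariant_subspace_growth[OF t])
    show "subspace {y. E t y = y}" by (auto simp: subspace_def proj)
  qed (auto simp: commute range_upper)
  then show "E t x \<in> growth_space t" using proj(2) by blast
  fix w assume "w \<in> growth_space t"
  then have w: "E t w = w" by (rule growth_space_fixed[OF t])
  have "inner (x - E t x) w = inner (x - E t x) (E t w)" by (simp add: w)
  also have "\<dots> = inner (E t (x - E t x)) w" by (simp add: proj(3))
  finally show "inner (x - E t x) w = 0" by (simp add: proj)
qed

text \<open>\<open>V\<close> is both adjoint and inverse of \<open>U\<close>. A unitary commuting
  with \<open>A\<close> preserves the norms that define the growth spaces, hence the spaces and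
  their projections.\<close>

lemma commute_unitary:
  assumes UV: "\<And>x y. inner (U x) y = inner x (V y)" "\<And>x. V (U x) = x" "\<And>x. U (V x) = x"
    and U: "\<And>x. A (U x) = U (A x)" and t: "0 \<le> t"
  shows "E t (U x) = U (E t x)"
proof -
  have V: "A (V x) = V (A x)" for x by (metis U UV(2,3))
  have nU: "norm (U x) = norm x" and nV: "norm (V x) = norm x" for x
    by (simp_all add: norm_eq_sqrt_inner UV(1,2)) (metis UV inner_commute)
  have "(A ^^ n) (U x) = U ((A ^^ n) x)" "(A ^^ n) (V x) = V ((A ^^ n) x)" for n x
    by (induction n) (simp_all add: U V)
  then have gU: "x \<in> growth_space t \<Longrightarrow> U x \<in> growth_space t"
    and gV: "x \<in> growth_space t \<Longrightarrow> V x \<in> growth_space t" for x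
    by (simp_all add: growth_space_def nU nV)
  show ?thesis unfolding eq_spectral_proj[OF t]
  proof (rule projection_onto_eqI[OF subspace_growth_space])
    show "U (spectral_proj t x) \<in> growth_space t" by (rule gU[OF proj_growth(1)])
    fix w assume "w \<in> growth_space t"
    then have "inner (x - spectral_proj t x) (V w) = 0" by (intro proj_growth(2) gV)
    then show "inner (U x - U (spectral_proj t x)) w = 0" by (simp add: inner_diff_left UV)
  qed
qed

end

section \<open>The Sobolev inequality\<close>

lemma sum_powers_of_two_le:
  fixes m :: int
  assumes "finite J" "J \<subseteq> {..m}"
  shows "(\<Sum>j\<in>J. 2 powr real_of_int j) \<le> 2 * 2 powr real_of_int m"
proof -
  have inj: "inj_on (\<lambda>j. nat (m - j)) J" 
  proof (rule inj_onI)
    fix a b assume "a \<in> J" "b \<in> J" and eq: "nat (m - a) = nat (m - b)"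
    then have "a \<le> m" "b \<le> m" using assms(2) by auto
    with eq show "a = b" by simp
  qed
  have "(\<Sum>j\<in>J. 2 powr real_of_int j) = (\<Sum>j\<in>J. 2 powr real_of_int m * (1/2) ^ nat (m - j))"
  proof (rule sum.cong[OF refl])
    fix j assume "j \<in> J"
    then have "j = m - int (nat (m - j))" using assms(2) by auto
    then have "real_of_int j = real_of_int m - real (nat (m - j))" by linarith
    then have "2 powr real_of_int j = 2 powr (real_of_int m - real (nat (m - j)))" by (rule arg_cong)
    also have "\<dots> = 2 powr real_of_int m * (1/2) ^ nat (m - j)"
      unfolding powr_diff by (simp add: powr_realpow power_one_over del: of_nat_nat)
    finally show "2 powr real_of_int j = 2 powr real_of_int m * (1/2) ^ nat (m - j)" .
  qed
  also have "\<dots> = 2 powr real_of_int m * (\<Sum>i\<in>(\<lambda>j. nat (m - j)) ` J. (1/2) ^ i)"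
    by (simp add: sum_distrib_left sum.reindex[OF inj])
  also have "\<dots> \<le> 2 powr real_of_int m * (\<Sum>i. (1/2) ^ i)"
    using assms(1) by (intro mult_left_mono sum_le_suminf) (auto simp: summable_geometric)
  also have "(\<Sum>i. (1/2) ^ i) = (2::real)" by (simp add: suminf_geometric)
  finally show ?thesis by (simp add: mult.commute)
qed

context resolved_operator
begin

context
  fixes z :: 'h
  assumes z: "E 0 z = 0"
begin

text \<open>The condition \<open>E 0 z = 0\<close> expresses orthogonality to the kernel of
  \<open>A\<close>. It puts the spectral measure on the positive half-line, where \<open>u\<close>
  dominates multiples of indicators.\<close>

lemma AE_pos: "AE u in S.\<mu> z. 0 < u"
  by (rule S.AE_Ioi) (simp add: S.F_def z)

text \<open>Chebyshev's inequality for the spectral measure of \<open>z\<close>.\<close>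

lemma spectral_band_le:
  assumes "0 < s" "s \<le> t"
  shows "s * (norm (E t z - E s z))\<^sup>2 \<le> inner (A z) z"
proof -
  have "s * (norm (E t z - E s z))\<^sup>2 = (\<integral>u. indicator {s<..t} u * s \<partial>S.\<mu> z)"
    using S.measure_Ioc[OF assms(2), of z] E(7)[OF assms(2), of z] by (simp add: S.F_def mult.commute)
  also have "\<dots> \<le> (\<integral>u. u \<partial>S.\<mu> z)"
  proof (rule integral_mono_AE)
    show "AE u in S.\<mu> z. indicator {s<..t} u * s \<le> u"
      using AE_pos by eventually_elim (use assms in \<open>auto simp: indicator_def\<close>)
    show "integrable (S.\<mu> z) (\<lambda>u. indicator {s<..t} u * s)"
      by (intro integrable_mult_left) (simp add: S.emeasure_eq_measure)
  qed (rule integrable_id)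
  finally show ?thesis by (simp add: quadratic_form)
qed

text \<open>Integrate a pointwise bound: the powers of 2 below \<open>u\<close> add up to at most
  twice the largest of them, hence to at most \<open>2 * u\<close>. All dyadic levels together thus
  cost no more than twice the energy.\<close>

lemma dyadic_tails_le:
  assumes J: "finite J"
  shows "(\<Sum>j\<in>J. 2 powr real_of_int j * (norm (z - E (2 powr real_of_int j) z))\<^sup>2) \<le> 2 * inner (A z) z"
proof -
  define g :: "real \<Rightarrow> real" where
    "g u = (\<Sum>j\<in>J. 2 powr real_of_int j * indicator {2 powr real_of_int j<..} u)" for u
  have ind: "integrable (S.\<mu> z) (indicat_real {s<..})" for s
    by (simp add: S.emeasure_eq_measure)
  then have int: "integrable (S.\<mu> z) (\<lambda>u. c * indicator {s<..} u)" for c s :: real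
    by (rule integrable_mult_right)
  have "(\<Sum>j\<in>J. 2 powr real_of_int j * (norm (z - E (2 powr real_of_int j) z))\<^sup>2) = (\<integral>u. g u \<partial>S.\<mu> z)"
    unfolding g_def by (subst Bochner_Integration.integral_sum) (auto intro: ind int simp: S.norm_sq_diff S.measure_Ioi)
  also have "\<dots> \<le> (\<integral>u. 2 * u \<partial>S.\<mu> z)"
  proof (rule integral_mono_AE)
    show "integrable (S.\<mu> z) g" unfolding g_def by (intro Bochner_Integration.integrable_sum int)
    show "integrable (S.\<mu> z) (\<lambda>u. 2 * u)" by (intro integrable_mult_right integrable_id)
    show "AE u in S.\<mu> z. g u \<le> 2 * u" using AE_pos
    proof eventually_elim
      case (elim u)
      define J' where "J' = {j\<in>J. 2 powr real_of_int j < u}"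
      have g: "g u = (\<Sum>j\<in>J'. 2 powr real_of_int j)"
      proof -
        have "g u = (\<Sum>j\<in>J. if 2 powr real_of_int j < u then 2 powr real_of_int j else 0)"
          unfolding g_def by (intro sum.cong) (auto simp: indicator_def)
        then show ?thesis by (simp add: J'_def sum.inter_filter[OF J])
      qed
      show ?case
      proof (cases "J' = {}")
        case True
        then show ?thesis using elim by (simp add: g)
      next
        case False
        have fin: "finite J'" using J by (simp add: J'_def)
        have "g u \<le> 2 * 2 powr real_of_int (Max J')"
          unfolding g by (rule sum_powers_of_two_le) (use fin in auto)
        moreover have "Max J' \<in> J'" using fin False by simp
        ultimately show ?thesis by (simp add: J'_def)
      qed
    qed
  qed
  finally show ?thesis by (simp add: quadratic_form)
qed

text \<open>Telescoping over the dyadic spectral bands below \<open>l\<close>.\<close>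

lemma low_frequency_bound:
  assumes \<beta>: "\<beta> > 0" and C: "C \<ge> 0" and l: "l > 0"
    and \<delta>: "\<And>t. t > 0 \<Longrightarrow> (norm (E t \<delta> - E 0 \<delta>))\<^sup>2 \<le> C * t powr (2 * \<beta> + 1)"
  shows "\<bar>inner (E l z) \<delta>\<bar> \<le> sqrt (2 * C * inner (A z) z) / (1 - 2 powr (-\<beta>)) * l powr \<beta>"
proof -
  define D where "D = inner (A z) z"
  have D: "D \<ge> 0" by (simp add: D_def nonneg)
  define q where "q = 2 powr (-\<beta>)"
  have q: "0 < q" "q < 1" using \<beta> by (simp_all add: q_def powr_less_one)
  define s where "s n = l / 2 ^ n" for n :: nat
  have s: "s n > 0" "s (Suc n) \<le> s n" "s n = 2 * s (Suc n)" for n using l by (simp_all add: s_def field_simps)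
  have s_powr: "s n powr \<beta> = l powr \<beta> * q ^ n" for n
  proof -
    have "(2 ^ n :: real) powr \<beta> = 2 powr (real n * \<beta>)"
      by (simp add: powr_powr flip: powr_realpow)
    moreover have "q ^ n = 2 powr (- (real n * \<beta>))"
      using q by (simp add: q_def powr_powr mult.commute flip: powr_realpow)
    ultimately show ?thesis using l by (simp add: s_def powr_divide powr_minus_divide)
  qed
  define a where "a n = inner (E (s n) z) \<delta>" for n
  define c where "c = sqrt (2 * C * D) * l powr \<beta>"
  have c: "c \<ge> 0" using C D by (simp add: c_def)
  have step: "\<bar>a n - a (Suc n)\<bar> \<le> c * q ^ n" for n
  proof -
    \<comment> \<open>\<open>P\<close> projects onto one dyadic band. It may be put on both sides of
      the inner product, so that the energy bounds one factor and the hypothesis on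
      \<open>\<delta>\<close> the other.\<close>
    define P where "P x = E (s n) x - E (s (Suc n)) x" for x
    have "inner (P z) (P \<delta>) = inner (P z) \<delta>"
    proof -
      have "P (P z) = P z" using s(2)[of n] by (simp add: P_def proj E)
      moreover have "inner (P (P z)) \<delta> = inner (P z) (P \<delta>)"
        by (simp add: P_def[of "P z"] P_def[of \<delta>] inner_diff_left inner_diff_right proj(3))
      ultimately show ?thesis by simp
    qed
    then have "\<bar>a n - a (Suc n)\<bar> \<le> norm (P z) * norm (P \<delta>)"
      using Cauchy_Schwarz_ineq2[of "P z" "P \<delta>"] by (simp add: a_def P_def inner_diff_left)
    moreover have "(norm (P z) * norm (P \<delta>))\<^sup>2 \<le> (c * q ^ n)\<^sup>2"
    proof -
      have "s (Suc n) * (norm (P z))\<^sup>2 \<le> D"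
        unfolding P_def D_def by (rule spectral_band_le[OF s(1,2)])
      \<comment> \<open>The lower end of the band is half of \<open>s n\<close>, whence the factor
        2.\<close>
      then have 1: "(norm (P z))\<^sup>2 \<le> 2 * D / s n" using s(1)[of "Suc n"] s(3)[of n] by (simp add: field_simps)
      have "P \<delta> = (E (s n) \<delta> - E 0 \<delta>) - E (s (Suc n)) (E (s n) \<delta> - E 0 \<delta>)"
        using s(1)[of "Suc n"] s(2)[of n] by (simp add: P_def proj E)
      then have "norm (P \<delta>) \<le> norm (E (s n) \<delta> - E 0 \<delta>)" by (simp only: norm_compl_le)
      then have "(norm (P \<delta>))\<^sup>2 \<le> (norm (E (s n) \<delta> - E 0 \<delta>))\<^sup>2" by (rule power_mono) simp
      also have "\<dots> \<le> C * s n powr (2 * \<beta> + 1)" by (rule \<delta>[OF s(1)])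
      \<comment> \<open>The exponent \<open>2 * \<beta> + 1\<close> is made for this: the factor
        \<open>s n\<close> cancels the \<open>1 / s n\<close> from Chebyshev and leaves a geometric
        sequence.\<close>
      also have "\<dots> = C * s n * (s n powr \<beta>)\<^sup>2"
      proof -
        have "s n powr (2 * \<beta> + 1) = s n powr (\<beta> + \<beta> + 1)" by simp
        also have "\<dots> = s n * (s n powr \<beta>)\<^sup>2"
          using s(1)[of n] unfolding powr_add by (simp add: power2_eq_square)
        finally show ?thesis by simp
      qed
      finally have 2: "(norm (P \<delta>))\<^sup>2 \<le> C * s n * (s n powr \<beta>)\<^sup>2" .
      have "(norm (P z) * norm (P \<delta>))\<^sup>2 \<le> (2 * D / s n) * (C * s n * (s n powr \<beta>)\<^sup>2)"
        unfolding power_mult_distrib by (intro mult_mono 1 2) (use D s(1)[of n] in auto)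
      also have "\<dots> = (c * q ^ n)\<^sup>2"
        using s(1)[of n] C D by (simp add: s_powr c_def power_mult_distrib)
      finally show ?thesis .
    qed
    then have "norm (P z) * norm (P \<delta>) \<le> c * q ^ n"
      by (rule power2_le_imp_le) (use c q in auto)
    ultimately show ?thesis by linarith
  qed
  have tele: "\<bar>a 0\<bar> \<le> \<bar>a n\<bar> + c / (1 - q)" for n
  proof -
    have "\<bar>a 0\<bar> \<le> \<bar>a n\<bar> + (\<Sum>i<n. c * q ^ i)"
    proof (induction n)
      case (Suc n)
      then show ?case using step[of n] by simp
    qed simp
    also have "\<dots> \<le> \<bar>a n\<bar> + c * (\<Sum>i. q ^ i)"
      using q c unfolding sum_distrib_left[symmetric]
      by (intro add_left_mono mult_left_mono sum_le_suminf) (auto simp: summable_geometric)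
    finally show ?thesis using q by (simp add: suminf_geometric divide_inverse)
  qed
  \<comment> \<open>As the cut tends to 0 from above, right continuity turns the remaining
    coefficient into that of \<open>E 0 z\<close>, which is zero.\<close>
  have "(\<lambda>n. \<bar>a n\<bar> + c / (1 - q)) \<longlonglongrightarrow> \<bar>inner (E 0 z) \<delta>\<bar> + c / (1 - q)"
  proof -
    have "filterlim s (at_right 0) sequentially"
      unfolding filterlim_at
    proof
      have "(\<lambda>n. l * (1/2) ^ n) \<longlonglongrightarrow> l * 0" by (intro tendsto_intros LIMSEQ_power_zero) simp
      moreover have "s = (\<lambda>n. l * (1/2) ^ n)" by (simp add: fun_eq_iff s_def power_one_over)
      ultimately show "s \<longlonglongrightarrow> 0" by simp
      show "\<forall>\<^sub>F n in sequentially. s n \<in> {0<..} \<and> s n \<noteq> 0"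
        by (intro always_eventually allI) (simp add: s(1) order_less_imp_not_eq2[OF s(1)])
    qed
    from filterlim_compose[OF E(4) this] show ?thesis unfolding a_def by (intro tendsto_intros)
  qed
  then have "\<bar>a 0\<bar> \<le> \<bar>inner (E 0 z) \<delta>\<bar> + c / (1 - q)"
    by (rule LIMSEQ_le_const) (use tele in blast)
  then have "\<bar>inner (E l z) \<delta>\<bar> \<le> c / (1 - q)" by (simp add: z a_def s_def)
  then show ?thesis by (simp add: c_def q_def D_def)
qed

text \<open>At each index the splitting frequency \<open>2\<^sup>j\<close> is chosen so that the part of \<open>z\<close> below it
  accounts for at most half of the coefficient; the parts above are summed by
  \<open>dyadic_tails_le\<close>.\<close>

lemma sobolev_inequality:
  fixes e :: "'i \<Rightarrow> 'h"
  assumes \<beta>: "\<beta> > 0" and C: "C > 0"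
    and e: "\<And>i t. i \<in> S \<Longrightarrow> t > 0 \<Longrightarrow> (norm (E t (e i) - E 0 (e i)))\<^sup>2 \<le> C * t powr (2 * \<beta> + 1)"
    and bessel: "\<And>W v. finite W \<Longrightarrow> W \<subseteq> S \<Longrightarrow> (\<Sum>i\<in>W. (inner v (e i))\<^sup>2) \<le> (norm v)\<^sup>2"
  defines "b \<equiv> sqrt (2 * C) / (1 - 2 powr (-\<beta>))"
  shows "i \<in> S \<Longrightarrow> \<bar>inner z (e i)\<bar> \<le> (b + sqrt 2) * sqrt (inner (A z) z)"
    and "finite W \<Longrightarrow> W \<subseteq> S \<Longrightarrow> (\<Sum>i\<in>W. \<bar>inner z (e i)\<bar> powr (2 + 1 / \<beta>)) \<le>
      16 * (2 * (b * sqrt (inner (A z) z))) powr (1 / \<beta>) * inner (A z) z"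
proof -
  define D where "D = inner (A z) z"
  have D: "D \<ge> 0" by (simp add: D_def nonneg)
  define B where "B = b * sqrt D"
  have b: "b > 0" using C \<beta> by (simp add: b_def powr_less_one)
  have low: "\<bar>inner (E t z) (e i)\<bar> \<le> B * t powr \<beta>" if "i \<in> S" "t > 0" for i t
    using low_frequency_bound[OF \<beta> _ that(2) e[OF that(1)]] C by (simp add: B_def b_def D_def real_sqrt_mult)
  have bessel1: "\<bar>inner v (e i)\<bar> \<le> norm v" if "i \<in> S" for v i
  proof -
    have "(inner v (e i))\<^sup>2 \<le> (norm v)\<^sup>2" using bessel[of "{i}" v] that by simp
    then show ?thesis using abs_le_square_iff[of "inner v (e i)" "norm v"] by simp
  qed
  show sup: "\<bar>inner z (e i)\<bar> \<le> (b + sqrt 2) * sqrt (inner (A z) z)" if i: "i \<in> S" for i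
  proof -
    have "inner z (e i) = inner (E 1 z) (e i) + inner (z - E 1 z) (e i)" by (simp add: inner_diff_left)
    moreover have "\<bar>inner (E 1 z) (e i)\<bar> \<le> B" using low[OF i, of 1] by simp
    moreover have "\<bar>inner (z - E 1 z) (e i)\<bar> \<le> sqrt (2 * D)"
    proof (rule order_trans[OF bessel1[OF i]])
      \<comment> \<open>The cut at frequency 1 is the dyadic level \<open>j = 0\<close>.\<close>
      have "(norm (z - E 1 z))\<^sup>2 \<le> 2 * D" using dyadic_tails_le[of "{0}"] by (simp add: D_def)
      then show "norm (z - E 1 z) \<le> sqrt (2 * D)" by (rule real_le_rsqrt)
    qed
    ultimately show ?thesis by (simp add: B_def real_sqrt_mult algebra_simps flip: D_def)
  qed
  show "(\<Sum>i\<in>W. \<bar>inner z (e i)\<bar> powr (2 + 1 / \<beta>)) \<le> 16 * (2 * (b * sqrt (inner (A z) z))) powr (1 / \<beta>) * inner (A z) z"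
    if W: "finite W" "W \<subseteq> S"
  proof (cases "D = 0")
    \<comment> \<open>Here \<open>B = 0\<close>, by which the main case divides; the supremum bound
      makes every coefficient vanish.\<close>
    case True
    have "inner z (e i) = 0" if "i \<in> W" for i using sup[of i] that W True by (auto simp flip: D_def)
    then show ?thesis using True by (simp flip: D_def)
  next
    case False
    then have B: "B > 0" using D b by (simp add: B_def)
    define c where "c i = \<bar>inner z (e i)\<bar>" for i
    \<comment> \<open>\<open>(c i / (2 * B)) powr (1 / \<beta>)\<close> is the frequency
      \<open>t\<close> at which the low-frequency bound \<open>B * t powr \<beta>\<close> equals
      half of \<open>c i\<close>; for \<open>c i > 0\<close>, \<open>p i\<close> is this frequency
      rounded down to a power of 2.\<close>
    define j where "j i = \<lfloor>log 2 ((c i / (2 * B)) powr (1 / \<beta>))\<rfloor>" for i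
    define p where "p i = 2 powr real_of_int (j i)" for i
    define W' where "W' = {i\<in>W. c i \<noteq> 0}"
    have finW': "finite W'" using W by (simp add: W'_def)
    \<comment> \<open>The 8 is 4, from squaring a half, times 2, from the dyadic rounding.\<close>
    have pt: "c i powr (2 + 1 / \<beta>) \<le> 8 * (2 * B) powr (1 / \<beta>) * (p i * (inner (z - E (p i) z) (e i))\<^sup>2)"
      if i: "i \<in> W'" for i
    proof -
      have iS: "i \<in> S" and ci: "c i > 0" using i W by (auto simp: W'_def c_def)
      define y where "y = (c i / (2 * B)) powr (1 / \<beta>)"
      have y: "y > 0" using ci B by (simp add: y_def)
      have p: "p i \<le> y" "y \<le> 2 * p i"
      proof -
        have "p i \<le> 2 powr (log 2 y)" unfolding p_def j_def y_def[symmetric] by (intro powr_mono) auto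
        then show "p i \<le> y" using y by simp
        have "2 powr (log 2 y) \<le> 2 powr (real_of_int (j i) + 1)"
          unfolding j_def y_def[symmetric] by (intro powr_mono) linarith+
        then show "y \<le> 2 * p i" using y by (simp add: p_def powr_add)
      qed
      have "\<bar>inner (E (p i) z) (e i)\<bar> \<le> B * p i powr \<beta>" by (rule low[OF iS]) (simp add: p_def)
      also have "\<dots> \<le> B * y powr \<beta>" using B \<beta> p by (intro mult_left_mono powr_mono2) (auto simp: p_def)
      also have "\<dots> = c i / 2" using ci B \<beta> by (simp add: y_def powr_powr)
      finally have "c i / 2 \<le> \<bar>inner (z - E (p i) z) (e i)\<bar>"
        unfolding c_def inner_diff_left by linarith
      then have "(c i / 2)\<^sup>2 \<le> \<bar>inner (z - E (p i) z) (e i)\<bar>\<^sup>2" by (rule power_mono) (use ci in simp)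
      then have 1: "(c i)\<^sup>2 \<le> 4 * (inner (z - E (p i) z) (e i))\<^sup>2"
        unfolding power2_abs power_divide by simp
      have "c i powr (1 / \<beta>) = (2 * B) powr (1 / \<beta>) * y" using ci B unfolding y_def
        by (subst powr_divide) auto
      also have "\<dots> \<le> (2 * B) powr (1 / \<beta>) * (2 * p i)" using p by (intro mult_left_mono) auto
      finally have 2: "c i powr (1 / \<beta>) \<le> (2 * B) powr (1 / \<beta>) * (2 * p i)" .
      have "c i powr (2 + 1 / \<beta>) = (c i)\<^sup>2 * c i powr (1 / \<beta>)"
        using ci by (simp add: powr_add)
      also have "\<dots> \<le> (4 * (inner (z - E (p i) z) (e i))\<^sup>2) * ((2 * B) powr (1 / \<beta>) * (2 * p i))"
        by (intro mult_mono 1 2) auto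
      finally show ?thesis by (simp add: mult_ac)
    qed
    have "(\<Sum>i\<in>W. c i powr (2 + 1 / \<beta>)) = (\<Sum>i\<in>W'. c i powr (2 + 1 / \<beta>))"
      using W(1) by (intro sum.mono_neutral_right) (auto simp: W'_def)
    also have "\<dots> \<le> (\<Sum>i\<in>W'. 8 * (2 * B) powr (1 / \<beta>) * (p i * (inner (z - E (p i) z) (e i))\<^sup>2))"
      by (intro sum_mono pt)
    also have "\<dots> = 8 * (2 * B) powr (1 / \<beta>) * (\<Sum>i\<in>W'. p i * (inner (z - E (p i) z) (e i))\<^sup>2)"
      by (simp add: sum_distrib_left)
    also have "\<dots> \<le> 8 * (2 * B) powr (1 / \<beta>) * (2 * D)"
    proof (rule mult_left_mono)
      \<comment> \<open>Indices of the same level share one tail of \<open>z\<close>, to which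
        Bessel's inequality applies; \<open>dyadic_tails_le\<close> then adds up the levels.\<close>
      have "(\<Sum>i\<in>W'. p i * (inner (z - E (p i) z) (e i))\<^sup>2) =
          (\<Sum>l\<in>j ` W'. \<Sum>i\<in>{i\<in>W'. j i = l}. p i * (inner (z - E (p i) z) (e i))\<^sup>2)"
        by (rule sum.image_gen[OF finW'])
      also have "\<dots> \<le> (\<Sum>l\<in>j ` W'. 2 powr real_of_int l * (norm (z - E (2 powr real_of_int l) z))\<^sup>2)"
      proof (rule sum_mono)
        fix l
        define v where "v = z - E (2 powr real_of_int l) z"
        have "(\<Sum>i\<in>{i\<in>W'. j i = l}. p i * (inner (z - E (p i) z) (e i))\<^sup>2) =
            2 powr real_of_int l * (\<Sum>i\<in>{i\<in>W'. j i = l}. (inner v (e i))\<^sup>2)"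
          by (simp add: p_def v_def sum_distrib_left)
        also have "\<dots> \<le> 2 powr real_of_int l * (norm v)\<^sup>2"
          using finW' W by (intro mult_left_mono bessel) (auto simp: W'_def)
        finally show "(\<Sum>i\<in>{i\<in>W'. j i = l}. p i * (inner (z - E (p i) z) (e i))\<^sup>2) \<le>
            2 powr real_of_int l * (norm (z - E (2 powr real_of_int l) z))\<^sup>2" by (simp add: v_def)
      qed
      also have "\<dots> \<le> 2 * D" unfolding D_def by (rule dyadic_tails_le) (simp add: finW')
      finally show "(\<Sum>i\<in>W'. p i * (inner (z - E (p i) z) (e i))\<^sup>2) \<le> 2 * D" .
    qed simp
    finally show ?thesis by (simp add: c_def B_def D_def mult_ac)
  qed
qed

end

end

section \<open>Completeness of the space of square-summable functions\<close>

lemma Rep_ell2_diff: "Rep_ell2 (f - g) x = Rep_ell2 f x - Rep_ell2 g x"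
  unfolding minus_ell2_def plus_ell2.rep_eq uminus_ell2.rep_eq by simp

lemma norm_ell2_sq: "(norm f)\<^sup>2 = (\<Sum>\<^sub>\<infinity>x. (Rep_ell2 f x)\<^sup>2)"
  unfolding power2_norm_eq_inner inner_ell2.rep_eq by (simp add: power2_eq_square)

lemma bessel_ell2: "finite W \<Longrightarrow> (\<Sum>x\<in>W. (Rep_ell2 f x)\<^sup>2) \<le> (norm f)\<^sup>2"
  unfolding norm_ell2_sq by (rule finite_sum_le_infsum[OF Rep_ell2_summable]) auto

lemma abs_Rep_ell2_le: "\<bar>Rep_ell2 f x\<bar> \<le> norm f"
  using bessel_ell2[of "{x}" f] abs_le_square_iff[of "Rep_ell2 f x" "norm f"] by simp

lemma inner_delta: "inner f (delta x) = Rep_ell2 f x"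
proof -
  have "inner f (delta x) = (\<Sum>\<^sub>\<infinity>y. Rep_ell2 f y * indicator {x} y)"
    by (simp add: inner_ell2.rep_eq Rep_ell2_delta)
  also have "\<dots> = (\<Sum>\<^sub>\<infinity>y\<in>{x}. Rep_ell2 f y * indicator {x} y)"
    by (rule infsum_cong_neutral) auto
  finally show ?thesis by simp
qed

lemma square_summableI:
  fixes f :: "'a \<Rightarrow> real"
  assumes "\<And>W. finite W \<Longrightarrow> (\<Sum>x\<in>W. (f x)\<^sup>2) \<le> c"
  shows "(\<lambda>x. (f x)\<^sup>2) summable_on UNIV"
  by (rule nonneg_bdd_above_summable_on) (use assms in \<open>auto intro!: bdd_aboveI[of _ c]\<close>)

lemma norm_ell2_le:
  assumes "\<And>W. finite W \<Longrightarrow> (\<Sum>x\<in>W. (Rep_ell2 f x)\<^sup>2) \<le> c\<^sup>2" "0 \<le> c"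
  shows "norm f \<le> c"
proof (rule power2_le_imp_le[OF _ assms(2)])
  show "(norm f)\<^sup>2 \<le> c\<^sup>2"
    unfolding norm_ell2_sq by (rule infsum_le_finite_sums[OF Rep_ell2_summable]) (rule assms(1))
qed

lemma Cauchy_ell2_convergent:
  fixes X :: "nat \<Rightarrow> 'a ell2"
  assumes X: "Cauchy X"
  shows "convergent X"
proof -
  have "Cauchy (\<lambda>n. Rep_ell2 (X n) x)" for x
  proof (rule metric_CauchyI)
    fix e :: real assume "e > 0"
    then obtain N where N: "\<And>m n. m \<ge> N \<Longrightarrow> n \<ge> N \<Longrightarrow> dist (X m) (X n) < e"
      using metric_CauchyD[OF X] by blast
    have "dist (Rep_ell2 (X m) x) (Rep_ell2 (X n) x) \<le> dist (X m) (X n)" for m n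
      using abs_Rep_ell2_le[of "X m - X n" x] by (simp add: dist_norm Rep_ell2_diff)
    then show "\<exists>N. \<forall>m\<ge>N. \<forall>n\<ge>N. dist (Rep_ell2 (X m) x) (Rep_ell2 (X n) x) < e"
      using N le_less_trans by blast
  qed
  then have "\<forall>x. \<exists>l. (\<lambda>n. Rep_ell2 (X n) x) \<longlonglongrightarrow> l"
    unfolding Cauchy_convergent_iff convergent_def by blast
  from choice[OF this] obtain g where "\<forall>x. (\<lambda>n. Rep_ell2 (X n) x) \<longlonglongrightarrow> g x" by (rule exE)
  then have g: "(\<lambda>n. Rep_ell2 (X n) x) \<longlonglongrightarrow> g x" for x by (rule spec)
  have close: "\<exists>N. \<forall>n\<ge>N. \<forall>W. finite W \<longrightarrow> (\<Sum>x\<in>W. (Rep_ell2 (X n) x - g x)\<^sup>2) \<le> e\<^sup>2"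
    if e: "e > 0" for e
  proof -
    obtain N where N: "\<And>m n. m \<ge> N \<Longrightarrow> n \<ge> N \<Longrightarrow> dist (X m) (X n) < e"
      using metric_CauchyD[OF X e] by blast
    have "(\<Sum>x\<in>W. (Rep_ell2 (X n) x - g x)\<^sup>2) \<le> e\<^sup>2" if "n \<ge> N" "finite W" for n W
    proof (rule LIMSEQ_le_const2)
      show "(\<lambda>m. \<Sum>x\<in>W. (Rep_ell2 (X n) x - Rep_ell2 (X m) x)\<^sup>2) \<longlonglongrightarrow> (\<Sum>x\<in>W. (Rep_ell2 (X n) x - g x)\<^sup>2)"
        by (intro tendsto_intros g)
      have "(\<Sum>x\<in>W. (Rep_ell2 (X n) x - Rep_ell2 (X m) x)\<^sup>2) \<le> e\<^sup>2" if "m \<ge> N" for m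
      proof -
        have "(\<Sum>x\<in>W. (Rep_ell2 (X n - X m) x)\<^sup>2) \<le> (norm (X n - X m))\<^sup>2"
          by (rule bessel_ell2) fact
        also have "\<dots> \<le> e\<^sup>2"
          using N[OF \<open>n \<ge> N\<close> that] by (intro power_mono) (auto simp: dist_norm)
        finally show ?thesis by (simp add: Rep_ell2_diff)
      qed
      then show "\<exists>N. \<forall>m\<ge>N. (\<Sum>x\<in>W. (Rep_ell2 (X n) x - Rep_ell2 (X m) x)\<^sup>2) \<le> e\<^sup>2" by blast
    qed
    then show ?thesis by blast
  qed
  from close[OF zero_less_one] obtain N where
    "\<forall>n\<ge>N. \<forall>W. finite W \<longrightarrow> (\<Sum>x\<in>W. (Rep_ell2 (X n) x - g x)\<^sup>2) \<le> 1\<^sup>2" by (rule exE)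
  then have "(\<Sum>x\<in>W. (Rep_ell2 (X N) x - g x)\<^sup>2) \<le> 1\<^sup>2" if "finite W" for W
    using that by blast
  from square_summableI[OF this]
  have r: "Rep_ell2 (Abs_ell2 (\<lambda>x. Rep_ell2 (X N) x - g x)) = (\<lambda>x. Rep_ell2 (X N) x - g x)"
    by (intro Abs_ell2_inverse) simp
  \<comment> \<open>What is known so far is that \<open>X N - g\<close> is square summable, so the
    limit is recovered from this difference.\<close>
  define l where "l = X N - Abs_ell2 (\<lambda>x. Rep_ell2 (X N) x - g x)"
  have l: "Rep_ell2 l x = g x" for x by (simp add: l_def Rep_ell2_diff r)
  have "X \<longlonglongrightarrow> l"
  proof (rule metric_LIMSEQ_I)
    fix e :: real assume e: "e > 0"
    from close[OF half_gt_zero[OF e]] obtain M where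
      M: "\<forall>n\<ge>M. \<forall>W. finite W \<longrightarrow> (\<Sum>x\<in>W. (Rep_ell2 (X n) x - g x)\<^sup>2) \<le> (e / 2)\<^sup>2" by (rule exE)
    have "dist (X n) l < e" if n: "n \<ge> M" for n
    proof -
      have "norm (X n - l) \<le> e / 2"
      proof (rule norm_ell2_le)
        show "(\<Sum>x\<in>W. (Rep_ell2 (X n - l) x)\<^sup>2) \<le> (e / 2)\<^sup>2" if "finite W" for W
          using M n that by (simp add: Rep_ell2_diff l)
      qed (use e in simp)
      also have "e / 2 < e" using e by simp
      finally show ?thesis by (simp add: dist_norm)
    qed
    then show "\<exists>M. \<forall>n\<ge>M. dist (X n) l < e" by blast
  qed
  then show ?thesis by (rule convergentI)
qed

instance ell2 :: (type) banach
  by intro_classes (rule Cauchy_ell2_convergent)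

section \<open>The coboundary operator\<close>

lemma coboundary_add: "coboundary X \<pi> k (\<lambda>\<sigma>. f \<sigma> + g \<sigma>) \<tau> = coboundary X \<pi> k f \<tau> + coboundary X \<pi> k g \<tau>"
  by (simp add: coboundary_def distrib_left sum.distrib)

lemma coboundary_scale: "coboundary X \<pi> k (\<lambda>\<sigma>. c * f \<sigma>) \<tau> = c * coboundary X \<pi> k f \<tau>"
  by (simp add: coboundary_def sum_distrib_left mult.left_commute)

text \<open>Cauchy-Schwarz over the \<open>k + 2\<close> faces of a simplex gives one factor; after
  exchanging the sums, the number of cofaces of a face, at most \<open>card K\<close>, gives the
  other. Being uniform in \<open>W\<close>, the estimate bounds the operator norm.\<close>

lemma sum_coboundary_sq_le:
  assumes cov: "simplicial_covering X K \<pi>" and K: "finite K" and W: "finite W"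
  shows "(\<Sum>\<tau>\<in>W. (coboundary X \<pi> k (Rep_ell2 f) \<tau>)\<^sup>2) \<le> real (k + 2) * real (card K) * (norm f)\<^sup>2"
proof -
  have asc: "abstract_simplicial_complex X" using cov by (simp add: simplicial_covering_def)
  define W' where "W' = W \<inter> simplexes X (k + 1)"
  have W': "finite W'" "W' \<subseteq> simplexes X (k + 1)" using W by (auto simp: W'_def)
  have fin: "finite \<tau>" if "\<tau> \<in> W'" for \<tau>
    using that W' asc by (auto simp: simplexes_def abstract_simplicial_complex_def)
  define S where "S = (\<Union>\<tau>\<in>W'. (\<lambda>v. \<tau> - {v}) ` \<tau>)"
  have S: "finite S" unfolding S_def using W' fin by auto
  define a where "a \<sigma> = (Rep_ell2 f \<sigma>)\<^sup>2" for \<sigma>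
  have "(\<Sum>\<tau>\<in>W. (coboundary X \<pi> k (Rep_ell2 f) \<tau>)\<^sup>2) = (\<Sum>\<tau>\<in>W'. (coboundary X \<pi> k (Rep_ell2 f) \<tau>)\<^sup>2)"
    unfolding W'_def using W by (intro sum.mono_neutral_right) (auto simp: coboundary_def)
  also have "\<dots> \<le> (\<Sum>\<tau>\<in>W'. real (k + 2) * (\<Sum>\<sigma>\<in>{\<sigma>\<in>S. \<sigma> \<subseteq> \<tau>}. a \<sigma>))"
  proof (rule sum_mono)
    fix \<tau> assume \<tau>: "\<tau> \<in> W'"
    have sign: "((-1) ^ m * c)\<^sup>2 = c\<^sup>2" for m and c :: real by (cases "even m") simp_all
    have "(coboundary X \<pi> k (Rep_ell2 f) \<tau>)\<^sup>2 =
        (\<Sum>v\<in>\<tau>. (-1) ^ card {u\<in>\<tau>. \<pi> u < \<pi> v} * Rep_ell2 f (\<tau> - {v}))\<^sup>2"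
      using \<tau> W' by (auto simp: coboundary_def)
    also have "\<dots> \<le> (\<Sum>v\<in>\<tau>. ((-1) ^ card {u\<in>\<tau>. \<pi> u < \<pi> v} * Rep_ell2 f (\<tau> - {v}))\<^sup>2) * real (card \<tau>)"
      by (rule sum_squared_le_sum_of_squares)
    also have "\<dots> = real (k + 2) * (\<Sum>v\<in>\<tau>. a (\<tau> - {v}))"
      unfolding sign a_def using \<tau> W' by (auto simp: simplexes_def mult.commute)
    also have "(\<Sum>v\<in>\<tau>. a (\<tau> - {v})) = (\<Sum>\<sigma>\<in>(\<lambda>v. \<tau> - {v}) ` \<tau>. a \<sigma>)"
      by (subst sum.reindex) (auto intro!: inj_onI)
    also have "real (k + 2) * \<dots> \<le> real (k + 2) * (\<Sum>\<sigma>\<in>{\<sigma>\<in>S. \<sigma> \<subseteq> \<tau>}. a \<sigma>)"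
    proof (intro mult_left_mono sum_mono2)
      show "(\<lambda>v. \<tau> - {v}) ` \<tau> \<subseteq> {\<sigma>\<in>S. \<sigma> \<subseteq> \<tau>}" using \<tau> by (auto simp: S_def)
    qed (use S in \<open>auto simp: a_def\<close>)
    finally show "(coboundary X \<pi> k (Rep_ell2 f) \<tau>)\<^sup>2 \<le> real (k + 2) * (\<Sum>\<sigma>\<in>{\<sigma>\<in>S. \<sigma> \<subseteq> \<tau>}. a \<sigma>)" .
  qed
  also have "\<dots> = real (k + 2) * (\<Sum>\<sigma>\<in>S. \<Sum>\<tau>\<in>{\<tau>\<in>W'. \<sigma> \<subseteq> \<tau>}. a \<sigma>)"
    using sum.swap_restrict[OF W'(1) S, of "\<lambda>\<tau> \<sigma>. a \<sigma>" "\<lambda>\<tau> \<sigma>. \<sigma> \<subseteq> \<tau>"]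
    by (simp add: sum_distrib_left[symmetric])
  also have "\<dots> \<le> real (k + 2) * (\<Sum>\<sigma>\<in>S. real (card K) * a \<sigma>)"
  proof (intro mult_left_mono sum_mono)
    fix \<sigma> assume "\<sigma> \<in> S"
    then have "\<sigma> \<in> simplexes X k" using W' simplexes_D[OF asc] by (auto simp: S_def)
    then have "\<sigma> \<noteq> {}" by (auto simp: simplexes_def)
    note c = card_cofaces_le[OF cov K this]
    have "card {\<tau>\<in>W'. \<sigma> \<subseteq> \<tau>} \<le> card {\<tau>\<in>X. \<sigma> \<subseteq> \<tau>}"
      using c W'(2) by (intro card_mono) (auto simp: simplexes_def)
    then have "real (card {\<tau>\<in>W'. \<sigma> \<subseteq> \<tau>}) \<le> real (card K)" using c by linarith
    then show "(\<Sum>\<tau>\<in>{\<tau>\<in>W'. \<sigma> \<subseteq> \<tau>}. a \<sigma>) \<le> real (card K) * a \<sigma>"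
      by (simp add: a_def mult_right_mono)
  qed simp
  also have "\<dots> = real (k + 2) * real (card K) * (\<Sum>\<sigma>\<in>S. a \<sigma>)"
    by (simp add: sum_distrib_left mult.assoc)
  also have "\<dots> \<le> real (k + 2) * real (card K) * (norm f)\<^sup>2"
    unfolding a_def by (intro mult_left_mono bessel_ell2 S) simp
  finally show ?thesis .
qed

lemma bounded_linear_ell2_coboundary:
  assumes cov: "simplicial_covering X K \<pi>" and K: "finite K"
  shows "bounded_linear (ell2_coboundary X \<pi> k)"
proof (rule bounded_linear_intro)
  note rep = Rep_ell2_coboundary[OF cov K]
  show "ell2_coboundary X \<pi> k (f + g) = ell2_coboundary X \<pi> k f + ell2_coboundary X \<pi> k g" for f g
    by (rule Rep_ell2_inject[THEN iffD1]) (simp add: rep plus_ell2.rep_eq coboundary_add fun_eq_iff)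
  show "ell2_coboundary X \<pi> k (c *\<^sub>R f) = c *\<^sub>R ell2_coboundary X \<pi> k f" for c f
    by (rule Rep_ell2_inject[THEN iffD1]) (simp add: rep scaleR_ell2.rep_eq coboundary_scale fun_eq_iff)
  show "norm (ell2_coboundary X \<pi> k f) \<le> norm f * sqrt (real (k + 2) * real (card K))" for f
  proof (rule norm_ell2_le)
    fix W :: "'a set set" assume "finite W"
    then show "(\<Sum>x\<in>W. (Rep_ell2 (ell2_coboundary X \<pi> k f) x)\<^sup>2) \<le> (norm f * sqrt (real (k + 2) * real (card K)))\<^sup>2"
      using sum_coboundary_sq_le[OF cov K, of W k f] by (simp add: rep power_mult_distrib mult_ac)
  qed simp
qed

text \<open>The contribution of deleting \<open>v\<close>, then \<open>w\<close>, is antisymmetric: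
  deleting the smaller vertex shifts the position of the larger by one, while deleting the larger
  leaves that of the smaller. This holds for every function \<open>f\<close>, in particular for
  cochains that are not square summable.\<close>

lemma coboundary_coboundary:
  assumes cov: "simplicial_covering X K \<pi>"
  shows "coboundary X \<pi> (k + 1) (coboundary X \<pi> k f) \<tau> = 0"
proof (cases "\<tau> \<in> simplexes X (k + 1 + 1)")
  case False
  then show ?thesis by (simp add: coboundary_def)
next
  case True
  have asc: "abstract_simplicial_complex X" using cov by (simp add: simplicial_covering_def)
  have \<tau>: "\<tau> \<in> X" "finite \<tau>"
    using True asc by (auto simp: simplexes_def abstract_simplicial_complex_def)
  have inj: "inj_on \<pi> \<tau>" using cov \<tau> by (auto simp: simplicial_covering_def)
  define s :: "'a set \<Rightarrow> 'a \<Rightarrow> real" where "s \<rho> v = (-1) ^ card {u\<in>\<rho>. \<pi> u < \<pi> v}" for \<rho> v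
  \<comment> \<open>The diagonal is set to 0 so that both sums can run over all of
    \<open>\<tau>\<close>.\<close>
  define G where "G v w = (if v = w then 0 else s \<tau> v * s (\<tau> - {v}) w * f (\<tau> - {v} - {w}))" for v w
  have anti1: "G v w = - G w v" if vw: "v \<in> \<tau>" "w \<in> \<tau>" "\<pi> v < \<pi> w" for v w
  proof -
    have "{u\<in>\<tau>. \<pi> u < \<pi> w} = insert v {u\<in>\<tau> - {v}. \<pi> u < \<pi> w}" using vw by auto
    then have "s \<tau> w = - s (\<tau> - {v}) w" using \<tau>(2) by (simp add: s_def)
    moreover have "{u\<in>\<tau> - {w}. \<pi> u < \<pi> v} = {u\<in>\<tau>. \<pi> u < \<pi> v}" using vw by auto
    then have "s (\<tau> - {w}) v = s \<tau> v" by (simp add: s_def)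
    moreover have "\<tau> - {v} - {w} = \<tau> - {w} - {v}" by auto
    ultimately show ?thesis using vw by (simp add: G_def)
  qed
  have anti: "G v w = - G w v" if vw: "v \<in> \<tau>" "w \<in> \<tau>" for v w
  proof (cases "v = w")
    case False
    then have "\<pi> v < \<pi> w \<or> \<pi> w < \<pi> v" using inj vw by (metis inj_onD linorder_neqE)
    then show ?thesis using anti1 vw by fastforce
  qed (simp add: G_def)
  have "coboundary X \<pi> (k + 1) (coboundary X \<pi> k f) \<tau> = (\<Sum>v\<in>\<tau>. s \<tau> v * coboundary X \<pi> k f (\<tau> - {v}))"
    using True by (simp add: coboundary_def s_def)
  also have "\<dots> = (\<Sum>v\<in>\<tau>. \<Sum>w\<in>\<tau>. G v w)"
  proof (rule sum.cong[OF refl])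
    fix v assume v: "v \<in> \<tau>"
    then have "\<tau> - {v} \<in> simplexes X (k + 1)" using simplexes_D[OF asc True] by blast
    then have "coboundary X \<pi> k f (\<tau> - {v}) = (\<Sum>w\<in>\<tau> - {v}. s (\<tau> - {v}) w * f (\<tau> - {v} - {w}))"
      unfolding coboundary_def s_def by simp
    moreover have "s \<tau> v * (s (\<tau> - {v}) w * f (\<tau> - {v} - {w})) = G v w" if "w \<in> \<tau> - {v}" for w
      using that unfolding G_def by (subst if_not_P) (auto simp: mult.assoc)
    ultimately have "s \<tau> v * coboundary X \<pi> k f (\<tau> - {v}) = (\<Sum>w\<in>\<tau> - {v}. G v w)"
      by (simp only: sum_distrib_left cong: sum.cong)
    also have "\<dots> = (\<Sum>w\<in>\<tau>. G v w)" using v \<tau> by (intro sum.mono_neutral_left) (auto simp: G_def)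
    finally show "s \<tau> v * coboundary X \<pi> k f (\<tau> - {v}) = (\<Sum>w\<in>\<tau>. G v w)" .
  qed
  finally have 1: "coboundary X \<pi> (k + 1) (coboundary X \<pi> k f) \<tau> = (\<Sum>v\<in>\<tau>. \<Sum>w\<in>\<tau>. G v w)" .
  have "(\<Sum>v\<in>\<tau>. \<Sum>w\<in>\<tau>. G v w) = (\<Sum>v\<in>\<tau>. \<Sum>w\<in>\<tau>. - G w v)"
    by (intro sum.cong refl anti)
  also have "\<dots> = - (\<Sum>w\<in>\<tau>. \<Sum>v\<in>\<tau>. G w v)" by (subst sum.swap) (simp add: sum_negf)
  finally show ?thesis using 1 by simp
qed

lemma positive_operator_adjoint_comp:
  fixes d :: "'h::{real_inner,banach} \<Rightarrow> 'h"
  assumes d: "bounded_linear d"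
  shows "positive_operator (adjoint d \<circ> d)" and "inner ((adjoint d \<circ> d) x) y = inner (d x) (d y)"
proof -
  interpret d: bounded_linear d by fact
  let ?A = "adjoint d \<circ> d"
  show A: "inner (?A x) y = inner (d x) (d y)" for x y
    using adjoint_bounded[OF d, of y "d x"] by (simp add: inner_commute)
  show "positive_operator ?A"
  proof (rule positive_operator.intro)
    show "inner (?A x) y = inner x (?A y)" for x y
      using A[of x y] A[of y x] by (simp only: inner_commute)
    show "inner (?A x) x \<ge> 0" for x unfolding A by simp
    show "bounded_linear ?A"
    proof (rule bounded_linear_intro)
      show "?A (x + y) = ?A x + ?A y" for x y
        by (rule vector_eq_rdot[THEN iffD1], rule allI) (simp only: A inner_add_left d.add)
      show "?A (c *\<^sub>R x) = c *\<^sub>R ?A x" for c x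
        by (rule vector_eq_rdot[THEN iffD1], rule allI) (simp only: A inner_scaleR_left d.scale)
      show "norm (?A x) \<le> norm x * (onorm d * onorm d)" for x
      proof -
        have "norm (?A x) * norm (?A x) = inner (d x) (d (?A x))"
          by (simp only: A[symmetric] power2_norm_eq_inner[symmetric] power2_eq_square)
        also have "\<dots> \<le> norm (d x) * norm (d (?A x))" by (rule norm_cauchy_schwarz)
        also have "\<dots> \<le> (onorm d * norm x) * (onorm d * norm (?A x))"
          by (intro mult_mono onorm[OF d]) (auto simp: onorm_pos_le[OF d])
        finally have "norm (?A x) * norm (?A x) \<le> (norm x * (onorm d * onorm d)) * norm (?A x)"
          by (simp only: mult_ac)
        then show ?thesis
          using onorm_pos_le[OF d] by (cases "?A x = 0") (auto simp: mult_le_cancel_right)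
      qed
    qed
  qed
qed

section \<open>Translation invariance\<close>

text \<open>A pullback, unitary when \<open>T\<close> is a bijection; it sends
  \<open>delta (T x)\<close> to \<open>delta x\<close>.\<close>

definition reindex_ell2 :: "('a \<Rightarrow> 'a) \<Rightarrow> 'a ell2 \<Rightarrow> 'a ell2" where
  "reindex_ell2 T f = Abs_ell2 (\<lambda>x. Rep_ell2 f (T x))"

lemma Rep_reindex_ell2:
  assumes "bij T"
  shows "Rep_ell2 (reindex_ell2 T f) = (\<lambda>x. Rep_ell2 f (T x))"
  unfolding reindex_ell2_def
  by (rule Abs_ell2_inverse)
    (use summable_on_reindex_bij_betw[OF assms, of "\<lambda>x. (Rep_ell2 f x)\<^sup>2"] Rep_ell2_summable in simp)

lemma inner_reindex_ell2:
  assumes "bij T"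
  shows "inner (reindex_ell2 T f) (reindex_ell2 T g) = inner f g"
  using infsum_reindex_bij_betw[OF assms, of "\<lambda>x. Rep_ell2 f x * Rep_ell2 g x"]
  by (simp add: inner_ell2.rep_eq Rep_reindex_ell2[OF assms])

lemma reindex_ell2_inverse:
  assumes "bij S" "bij T" "\<And>x. S (T x) = x"
  shows "reindex_ell2 T (reindex_ell2 S f) = f"
  by (rule Rep_ell2_inject[THEN iffD1]) (simp add: Rep_reindex_ell2 assms)

lemma reindex_ell2_delta:
  assumes "bij T"
  shows "reindex_ell2 T (delta (T x)) = delta x"
  by (rule Rep_ell2_inject[THEN iffD1])
    (auto simp: Rep_reindex_ell2 assms Rep_ell2_delta fun_eq_iff indicator_def dest: bij_is_inj[OF assms, THEN injD])

locale finite_deck_covering =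
  fixes \<Gamma> :: "('g, 'b) monoid_scheme" and \<phi> :: "'g \<Rightarrow> 'v \<Rightarrow> 'v"
    and X :: "'v set set" and K :: "'w::linorder set set" and \<pi> :: "'v \<Rightarrow> 'w"
    and R :: "'v set set" and k :: nat
  assumes finite_base: "finite K"
    and deck: "deck_covering \<Gamma> \<phi> X K \<pi>"
    and representatives: "orbit_representatives \<Gamma> \<phi> (simplexes X k) R"
begin

lemma covering: "simplicial_covering X K \<pi>"
  using deck by (simp add: deck_covering_def)

sublocale group_action \<Gamma> "\<Union>X" \<phi>
  using deck by (simp add: deck_covering_def)

lemma complex: "abstract_simplicial_complex X"
  using covering by (simp add: simplicial_covering_def)

lemma translate_simplex: "g \<in> carrier \<Gamma> \<Longrightarrow> \<sigma> \<in> X \<Longrightarrow> \<phi> g ` \<sigma> \<in> X"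
  using deck by (simp add: deck_covering_def)

lemma orbit_fibre: "v \<in> \<Union>X \<Longrightarrow> orbit \<Gamma> \<phi> v = {w\<in>\<Union>X. \<pi> w = \<pi> v}"
  using deck unfolding deck_covering_def by blast

lemma \<pi>_translate:
  assumes "g \<in> carrier \<Gamma>" "v \<in> \<Union>X"
  shows "\<pi> (\<phi> g v) = \<pi> v"
proof -
  have "\<phi> g v \<in> orbit \<Gamma> \<phi> v" using assms by (auto simp: orbit_def)
  then show ?thesis using orbit_fibre[OF assms(2)] by simp
qed

lemma unique_lift:
  assumes "v \<in> \<sigma>" "v \<in> \<sigma>'" "\<sigma> \<in> X" "\<sigma>' \<in> X" "\<pi> ` \<sigma> = \<pi> ` \<sigma>'"
  shows "\<sigma> = \<sigma>'"
proof -
  have "\<forall>v\<in>\<Union>X. \<forall>\<tau>\<in>K. \<pi> v \<in> \<tau> \<longrightarrow> (\<exists>!\<sigma>. \<sigma> \<in> X \<and> v \<in> \<sigma> \<and> \<pi> ` \<sigma> = \<tau>)"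
    using covering unfolding simplicial_covering_def by (elim conjE)
  moreover have "v \<in> \<Union>X" "\<pi> ` \<sigma> \<in> K" "\<pi> v \<in> \<pi> ` \<sigma>"
    using assms covering by (auto simp: simplicial_covering_def)
  ultimately have "\<exists>!\<rho>. \<rho> \<in> X \<and> v \<in> \<rho> \<and> \<pi> ` \<rho> = \<pi> ` \<sigma>" by blast
  then show ?thesis using assms by (metis (no_types, lifting))
qed

text \<open>A sum over an infinite set would be 0, and the trace would bound nothing.
  Representatives inject into \<open>K\<close>: if two have the same image, a deck transformation
  carries a vertex of one to a vertex of the other, and unique lifting makes the simplexes
  agree.\<close>

lemma finite_representatives: "finite R"
proof (rule inj_on_finite[OF _ _ finite_base])
  have RX: "\<rho> \<in> simplexes X k" if "\<rho> \<in> R" for \<rho>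
    using representatives that by (auto simp: orbit_representatives_def)
  show "(`) \<pi> ` R \<subseteq> K" using RX covering by (fastforce simp: simplexes_def simplicial_covering_def)
  show "inj_on ((`) \<pi>) R"
  proof (rule inj_onI)
    fix \<rho> \<rho>' assume R: "\<rho> \<in> R" "\<rho>' \<in> R" and eq: "\<pi> ` \<rho> = \<pi> ` \<rho>'"
    have X: "\<rho> \<in> X" "\<rho>' \<in> X" using R RX by (auto simp: simplexes_def)
    have "\<rho> \<noteq> {}" using RX[OF R(1)] by (auto simp: simplexes_def)
    then obtain v where v: "v \<in> \<rho>" by blast
    then obtain v' where v': "v' \<in> \<rho>'" "\<pi> v' = \<pi> v" using eq by (metis imageE imageI)
    have "v' \<in> orbit \<Gamma> \<phi> v" using v v' X orbit_fibre[of v] by auto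
    then obtain g where g: "g \<in> carrier \<Gamma>" "\<phi> g v = v'" by (auto simp: orbit_def)
    have "\<pi> ` \<phi> g ` \<rho> = \<pi> ` \<rho>" unfolding image_image
      using \<pi>_translate[OF g(1)] X by (intro image_cong) auto
    then have "\<phi> g ` \<rho> = \<rho>'"
      using g v v' X eq translate_simplex by (intro unique_lift[of v']) auto
    moreover have "\<phi> \<one>\<^bsub>\<Gamma>\<^esub> ` \<rho>' = \<rho>'"
      using X(2) by (subst id_eq_one[symmetric]) (auto simp: image_def)
    ultimately have "\<exists>g\<in>carrier \<Gamma>. \<phi> g ` \<rho> = \<rho>'" "\<exists>g\<in>carrier \<Gamma>. \<phi> g ` \<rho>' = \<rho>'"
      using g(1) group.is_monoid[OF group_hom.axioms(1)[OF group_hom]] monoid.one_closed by blast+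
    moreover have "\<exists>!\<rho>. \<rho> \<in> R \<and> (\<exists>g\<in>carrier \<Gamma>. \<phi> g ` \<rho> = \<rho>')"
      using representatives RX[OF R(2)] by (simp add: orbit_representatives_def)
    ultimately show "\<rho> = \<rho>'" using R by blast
  qed
qed

text \<open>\<open>\<phi> g\<close> is controlled only on the vertices of \<open>X\<close>. Fixing
  all other sets gives a bijection of the whole index set of the Hilbert space.\<close>

definition translate :: "'g \<Rightarrow> 'v set \<Rightarrow> 'v set" where
  "translate g \<sigma> = (if \<sigma> \<in> X then \<phi> g ` \<sigma> else \<sigma>)"

lemma inj_on_simplex: "g \<in> carrier \<Gamma> \<Longrightarrow> \<sigma> \<in> X \<Longrightarrow> inj_on (\<phi> g) \<sigma>"
  by (rule inj_on_subset[OF inj_prop]) auto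

lemma translate_inverse:
  assumes g: "g \<in> carrier \<Gamma>"
  shows "translate (inv\<^bsub>\<Gamma>\<^esub> g) (translate g \<sigma>) = \<sigma>"
proof (cases "\<sigma> \<in> X")
  case True
  have "\<phi> (inv\<^bsub>\<Gamma>\<^esub> g) ` \<phi> g ` \<sigma> = (\<lambda>v. v) ` \<sigma>" unfolding image_image
    using True orbit_sym_aux[OF g] by (intro image_cong) auto
  then show ?thesis using True translate_simplex[OF g True] by (simp add: translate_def)
qed (simp add: translate_def)

lemma bij_translate:
  assumes g: "g \<in> carrier \<Gamma>"
  shows "bij (translate g)"
proof -
  have G: "group \<Gamma>" using group_hom by (simp add: group_hom_def)
  have "translate g (translate (inv\<^bsub>\<Gamma>\<^esub> g) \<sigma>) = \<sigma>" for \<sigma>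
    using translate_inverse[of "inv\<^bsub>\<Gamma>\<^esub> g" \<sigma>] g G by (simp add: group.inv_closed group.inv_inv)
  then show ?thesis using translate_inverse[OF g] by (intro o_bij[of "translate (inv\<^bsub>\<Gamma>\<^esub> g)"]) (auto simp: fun_eq_iff)
qed

lemma translate_simplexes_iff:
  assumes g: "g \<in> carrier \<Gamma>"
  shows "translate g \<sigma> \<in> simplexes X n \<longleftrightarrow> \<sigma> \<in> simplexes X n"
  using translate_simplex[OF g] card_image[OF inj_on_simplex[OF g]]
  by (auto simp: translate_def simplexes_def)

text \<open>The signs see only the order of the images under \<open>\<pi>\<close>, which deck
  transformations do not change.\<close>

lemma coboundary_translate:
  assumes g: "g \<in> carrier \<Gamma>"
  shows "coboundary X \<pi> n (\<lambda>\<sigma>. f (translate g \<sigma>)) \<tau> = coboundary X \<pi> n f (translate g \<tau>)"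
proof (cases "\<tau> \<in> simplexes X (n + 1)")
  case False
  then show ?thesis using translate_simplexes_iff[OF g, of \<tau> "n + 1"] by (simp add: coboundary_def)
next
  case True
  then have \<tau>: "\<tau> \<in> X" by (simp add: simplexes_def)
  have T: "translate g \<tau> = \<phi> g ` \<tau>" using \<tau> by (simp add: translate_def)
  note inj = inj_on_simplex[OF g \<tau>]
  have sign: "card {u\<in>\<phi> g ` \<tau>. \<pi> u < \<pi> (\<phi> g v)} = card {u\<in>\<tau>. \<pi> u < \<pi> v}" if v: "v \<in> \<tau>" for v
  proof -
    have "\<pi> (\<phi> g u) = \<pi> u" if "u \<in> \<tau>" for u using \<pi>_translate[OF g, of u] \<tau> that by blast
    then have "{u\<in>\<phi> g ` \<tau>. \<pi> u < \<pi> (\<phi> g v)} = \<phi> g ` {u\<in>\<tau>. \<pi> u < \<pi> v}" using v by auto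
    then show ?thesis using card_image[OF inj_on_subset[OF inj, of "{u\<in>\<tau>. \<pi> u < \<pi> v}"]] by auto
  qed
  have face: "translate g (\<tau> - {v}) = \<phi> g ` \<tau> - {\<phi> g v}" if v: "v \<in> \<tau>" for v
  proof -
    have "\<tau> - {v} \<in> X" using simplexes_D[OF complex True v] by (simp add: simplexes_def)
    then show ?thesis using inj_on_image_set_diff[OF inj, of \<tau> "{v}"] v by (simp add: translate_def)
  qed
  have "coboundary X \<pi> n f (translate g \<tau>) =
      (\<Sum>w\<in>\<phi> g ` \<tau>. (-1) ^ card {u\<in>\<phi> g ` \<tau>. \<pi> u < \<pi> w} * f (\<phi> g ` \<tau> - {w}))"
    using True translate_simplexes_iff[OF g, of \<tau> "n + 1"] by (simp add: coboundary_def T)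
  also have "\<dots> = (\<Sum>v\<in>\<tau>. (-1) ^ card {u\<in>\<tau>. \<pi> u < \<pi> v} * f (translate g (\<tau> - {v})))"
    by (subst sum.reindex[OF inj]) (auto intro!: sum.cong simp: sign face)
  finally show ?thesis using True by (simp add: coboundary_def)
qed

section \<open>The Laplacian and the deck invariance of its spectral projections\<close>

abbreviation d :: "'v set ell2 \<Rightarrow> 'v set ell2" where "d \<equiv> ell2_coboundary X \<pi> k"

abbreviation laplacian :: "'v set ell2 \<Rightarrow> 'v set ell2" where "laplacian \<equiv> adjoint d \<circ> d"

lemmas bounded_d = bounded_linear_ell2_coboundary[OF covering finite_base, of k]

lemmas Rep_d = Rep_ell2_coboundary[OF covering finite_base]

lemmas inner_laplacian = positive_operator_adjoint_comp(2)[OF bounded_d]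

sublocale laplacian: positive_operator laplacian
  by (rule positive_operator_adjoint_comp(1)[OF bounded_d])

lemma d_reindex:
  assumes g: "g \<in> carrier \<Gamma>"
  shows "d (reindex_ell2 (translate g) f) = reindex_ell2 (translate g) (d f)"
  by (rule Rep_ell2_inject[THEN iffD1])
    (simp add: Rep_d Rep_reindex_ell2[OF bij_translate[OF g]] coboundary_translate[OF g] fun_eq_iff)

text \<open>The very choice made in \<open>spectral_projection_Ioc\<close>, so that the spectral
  distribution can be rewritten in terms of \<open>E\<close>.\<close>

definition E :: "real \<Rightarrow> 'v set ell2 \<Rightarrow> 'v set ell2" where
  "E = (SOME E. spectral_resolution laplacian E)"

sublocale resolved_operator laplacian E
proof
  show "spectral_resolution laplacian E"
    unfolding E_def
    by (rule someI[where P = "spectral_resolution laplacian"]) (rule laplacian.spectral_resolution_exists)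
qed

lemma E_translate:
  assumes g: "g \<in> carrier \<Gamma>" and t: "0 \<le> t"
  shows "E t (reindex_ell2 (translate g) f) = reindex_ell2 (translate g) (E t f)"
proof -
  define h where "h = inv\<^bsub>\<Gamma>\<^esub> g"
  have G: "group \<Gamma>" using group_hom by (simp add: group_hom_def)
  have h: "h \<in> carrier \<Gamma>" using g G by (simp add: h_def group.inv_closed)
  have gh: "translate h (translate g \<sigma>) = \<sigma>" "translate g (translate h \<sigma>) = \<sigma>" for \<sigma>
    using translate_inverse[OF g] translate_inverse[OF h] g G by (simp_all add: h_def group.inv_inv)
  let ?U = "reindex_ell2 (translate g)" and ?V = "reindex_ell2 (translate h)"
  note bij = bij_translate[OF g] bij_translate[OF h]
  have UV: "?V (?U f) = f" "?U (?V f) = f" for f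
    by (simp_all add: reindex_ell2_inverse bij gh)
  have adj: "inner (?U f) f' = inner f (?V f')" for f f'
    using inner_reindex_ell2[OF bij(1), of f "?V f'"] by (simp add: UV)
  have "laplacian (?U f) = ?U (laplacian f)" for f
  proof (rule vector_eq_rdot[THEN iffD1], rule allI)
    fix f'
    have "inner (laplacian (?U f)) f' = inner (?U (d f)) (d f')" by (simp only: inner_laplacian d_reindex[OF g])
    also have "\<dots> = inner (d f) (d (?V f'))" by (simp only: adj d_reindex[OF h])
    also have "\<dots> = inner (laplacian f) (?V f')" by (simp only: inner_laplacian)
    finally show "inner (laplacian (?U f)) f' = inner (?U (laplacian f)) f'" by (simp only: adj)
  qed
  then show ?thesis by (rule commute_unitary[OF adj UV _ t])
qed

lemma spectral_distribution_bound:
  assumes \<sigma>: "\<sigma> \<in> simplexes X k" and t: "0 < t"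
  shows "(norm (E t (delta \<sigma>) - E 0 (delta \<sigma>)))\<^sup>2 \<le> spectral_distribution \<Gamma> \<phi> R X \<pi> k t"
proof -
  define q where "q \<rho> = inner (delta \<rho>) (E t (delta \<rho>) - E 0 (delta \<rho>))" for \<rho>
  have q: "q \<rho> = (norm (E t (delta \<rho>) - E 0 (delta \<rho>)))\<^sup>2" for \<rho>
    using E(7)[of 0 t "delta \<rho>"] t by (simp add: q_def inner_diff_right inner_commute)
  have one: "\<phi> \<one>\<^bsub>\<Gamma>\<^esub> ` \<rho> = \<rho>" if "\<rho> \<in> R" for \<rho>
  proof -
    have "\<rho> \<subseteq> \<Union>X" using that representatives by (auto simp: orbit_representatives_def simplexes_def)
    then show ?thesis by (subst id_eq_one[symmetric]) (auto simp: image_def)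
  qed
  have "spectral_distribution \<Gamma> \<phi> R X \<pi> k t = (\<Sum>\<rho>\<in>R. q \<rho>)"
    unfolding spectral_distribution_def von_Neumann_trace_def operator_kernel_def
      spectral_projection_Ioc_def Let_def E_def[symmetric]
    by (intro sum.cong) (simp_all add: one q_def)
  moreover have "\<exists>!\<rho>. \<rho> \<in> R \<and> (\<exists>g\<in>carrier \<Gamma>. \<phi> g ` \<rho> = \<sigma>)"
    using representatives \<sigma> by (simp add: orbit_representatives_def)
  then obtain \<rho> g where \<rho>: "\<rho> \<in> R" "g \<in> carrier \<Gamma>" "\<phi> g ` \<rho> = \<sigma>"
    by (elim ex1E) blast
  have "q \<rho> \<le> (\<Sum>\<rho>\<in>R. q \<rho>)"
    by (rule member_le_sum[OF \<rho>(1) _ finite_representatives]) (simp add: q)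
  moreover have "q \<rho> = q \<sigma>"
  proof -
    have "\<rho> \<in> X" using \<rho>(1) representatives by (auto simp: orbit_representatives_def simplexes_def)
    then have T: "translate g \<rho> = \<sigma>" using \<rho> by (simp add: translate_def)
    note bij = bij_translate[OF \<rho>(2)]
    have \<delta>: "delta \<rho> = reindex_ell2 (translate g) (delta \<sigma>)"
      using reindex_ell2_delta[OF bij, of \<rho>] by (simp add: T)
    show ?thesis unfolding q_def inner_diff_right \<delta>
      using t by (simp add: E_translate[OF \<rho>(2)] inner_reindex_ell2[OF bij])
  qed
  ultimately show ?thesis by (simp add: q[symmetric])
qed

end

section \<open>Coboundaries of p-summable cochains\<close>

text \<open>Above the exponent \<open>q\<close> the surplus power is absorbed by the supremum bound
  \<open>B\<close>; for \<open>p = \<infinity>\<close> the bound \<open>B\<close> acts by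
  itself.\<close>

lemma lp_cochainsI:
  fixes p :: ereal and f :: "'v set \<Rightarrow> real"
  assumes zero: "\<And>\<sigma>. \<sigma> \<notin> simplexes X k \<Longrightarrow> f \<sigma> = 0"
    and sup: "\<And>\<sigma>. \<bar>f \<sigma>\<bar> \<le> B"
    and q: "(\<lambda>\<sigma>. \<bar>f \<sigma>\<bar> powr q) summable_on simplexes X k" and p: "ereal q \<le> p"
  shows "f \<in> lp_cochains p X k"
proof (cases p)
  case (real r)
  then have qr: "q \<le> r" using p by simp
  have "(\<lambda>\<sigma>. \<bar>f \<sigma>\<bar> powr r) summable_on simplexes X k"
  proof (rule summable_on_comparison_test)
    show "(\<lambda>\<sigma>. B powr (r - q) * \<bar>f \<sigma>\<bar> powr q) summable_on simplexes X k"
      by (rule summable_on_cmult_right[OF q])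
    show "\<bar>f \<sigma>\<bar> powr r \<le> B powr (r - q) * \<bar>f \<sigma>\<bar> powr q" for \<sigma>
    proof -
      have "\<bar>f \<sigma>\<bar> powr r = \<bar>f \<sigma>\<bar> powr (r - q) * \<bar>f \<sigma>\<bar> powr q" by (simp flip: powr_add)
      also have "\<dots> \<le> B powr (r - q) * \<bar>f \<sigma>\<bar> powr q"
        using qr by (intro mult_right_mono powr_mono2 sup) auto
      finally show ?thesis .
    qed
  qed simp
  then show ?thesis using zero real by (simp add: lp_cochains_def)
next
  case PInf
  have "bounded (f ` simplexes X k)" using sup by (auto intro!: boundedI)
  then show ?thesis using zero PInf by (simp add: lp_cochains_def)
qed (use p in simp)

text \<open>\<open>2 + 4 / (\<alpha> - 2)\<close> equals
  \<open>2 * \<alpha> / (\<alpha> - 2)\<close>, the exponent whose reciprocal is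
  \<open>1 / 2 - 1 / \<alpha>\<close>.\<close>

lemma conjugate_exponent_le:
  fixes p :: ereal and \<alpha> :: real
  assumes \<alpha>: "\<alpha> > 2" and p: "p \<ge> 2" "1 / p \<le> ereal (1 / 2 - 1 / \<alpha>)"
  shows "ereal (2 + 4 / (\<alpha> - 2)) \<le> p"
proof (cases p)
  case (real r)
  have r2: "r \<ge> 2" using p(1) unfolding real numeral_eq_ereal by simp
  then have "1 / p = ereal (1 / r)" by (simp add: real one_ereal_def)
  then have r: "1 / r \<le> 1 / 2 - 1 / \<alpha>" using p(2) by simp
  have "2 * \<alpha> \<le> r * (\<alpha> - 2)" using r r2 \<alpha> by (simp add: field_simps)
  then have "2 + 4 / (\<alpha> - 2) \<le> r" using \<alpha> by (simp add: field_simps)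
  then show ?thesis by (simp add: real)
qed (use p in auto)

lemma subspace_closure:
  fixes V :: "'h::real_normed_vector set"
  assumes V: "subspace V"
  shows "subspace (closure V)"
proof (rule subspaceI)
  show "0 \<in> closure V" using subspace_0[OF V] closure_subset by blast
  fix x assume x: "x \<in> closure V"
  then obtain f where f: "\<And>n. f n \<in> V" "f \<longlonglongrightarrow> x" unfolding closure_sequential by blast
  show "c *\<^sub>R x \<in> closure V" for c
    unfolding closure_sequential
    by (intro exI[of _ "\<lambda>n. c *\<^sub>R f n"] conjI allI subspace_scale[OF V] f(1)
        tendsto_scaleR[OF tendsto_const f(2)])
  fix y assume "y \<in> closure V"
  then obtain g where g: "\<And>n. g n \<in> V" "g \<longlonglongrightarrow> y" unfolding closure_sequential by blast
  show "x + y \<in> closure V"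
    unfolding closure_sequential
    by (intro exI[of _ "\<lambda>n. f n + g n"] conjI allI subspace_add[OF V] f(1) g(1)
        tendsto_add[OF f(2) g(2)])
qed

lemma is_singleton_quotient_space_self:
  assumes W: "subspace W"
  shows "is_singleton (quotient_space W W)"
proof -
  have "(\<lambda>w. v + w) ` W = W" if v: "v \<in> W" for v
  proof
    show "(\<lambda>w. v + w) ` W \<subseteq> W" using W v by (auto intro: subspace_add)
    show "W \<subseteq> (\<lambda>w. v + w) ` W"
    proof
      fix w assume "w \<in> W"
      then have "w - v \<in> W" using W v by (simp add: subspace_diff)
      then show "w \<in> (\<lambda>w. v + w) ` W" by (intro image_eqI[of _ _ "w - v"]) simp_all
    qed
  qed
  then have "quotient_space W W = {W}"
    unfolding quotient_space_def using subspace_0[OF W] by (auto simp: image_iff)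
  then show ?thesis by simp
qed

lemma quotient_space_singletonD:
  assumes "is_singleton (quotient_space V W)" "0 \<in> V" "0 \<in> W"
  shows "V \<subseteq> W"
proof
  fix v assume v: "v \<in> V"
  obtain a where "quotient_space V W = {a}" using assms(1) by (rule is_singletonE)
  then have "(\<lambda>w. u + w) ` W = a" if "u \<in> V" for u
    using that unfolding quotient_space_def by (metis imageI singletonD)
  from this[OF v] this[OF assms(2)] have "(\<lambda>w. v + w) ` W = W" by simp
  moreover have "v + 0 \<in> (\<lambda>w. v + w) ` W" using assms(3) by (intro imageI)
  ultimately show "v \<in> W" by simp
qed

context finite_deck_covering
begin

text \<open>At level 0 \<open>range_upper\<close> makes the energy vanish. Subtracting
  \<open>E 0 f\<close> from \<open>f\<close> therefore keeps the coboundary and achieves the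
  condition \<open>E 0 z = 0\<close> of the Sobolev inequality.\<close>

lemma d_E_0: "d (E 0 f) = 0"
proof -
  have "inner (laplacian (E 0 f)) (E 0 f) \<le> 0 * (norm (E 0 f))\<^sup>2" by (rule range_upper) (rule proj(2))
  then have "inner (d (E 0 f)) (d (E 0 f)) \<le> 0" by (simp only: inner_laplacian mult_zero_left)
  then show ?thesis by (metis inner_eq_zero_iff inner_ge_zero order_antisym)
qed

text \<open>A sequence of coboundaries converging in \<open>\<ell>\<^sup>2\<close> has preimages orthogonal to \<open>ker d\<close>; by
  the Sobolev inequality these converge pointwise and are bounded in \<open>\<ell>\<^sup>q\<close>.\<close>

lemma closure_coboundaries:
  assumes \<beta>: "\<beta> > 0"
    and F: "\<And>t. t > 0 \<Longrightarrow> spectral_distribution \<Gamma> \<phi> R X \<pi> k t \<le> C * t powr (2 * \<beta> + 1)"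
    and y: "y \<in> closure (d ` ell2_cochains X k)"
  obtains x B where "\<And>\<sigma>. \<sigma> \<notin> simplexes X k \<Longrightarrow> x \<sigma> = 0" "\<And>\<sigma>. \<bar>x \<sigma>\<bar> \<le> B"
    "(\<lambda>\<sigma>. \<bar>x \<sigma>\<bar> powr (2 + 1 / \<beta>)) summable_on simplexes X k" "coboundary X \<pi> k x = Rep_ell2 y"
proof -
  interpret d: bounded_linear d by (rule bounded_d)
  define S where "S = simplexes X k"
  \<comment> \<open>\<open>C\<close> comes without a sign, while the Sobolev inequality asks for a
    positive constant.\<close>
  define C' where "C' = max C 1"
  have C': "C' > 0" by (simp add: C'_def)
  have e: "(norm (E t (delta \<sigma>) - E 0 (delta \<sigma>)))\<^sup>2 \<le> C' * t powr (2 * \<beta> + 1)"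
    if "\<sigma> \<in> S" "t > 0" for \<sigma> t
  proof -
    have "(norm (E t (delta \<sigma>) - E 0 (delta \<sigma>)))\<^sup>2 \<le> C * t powr (2 * \<beta> + 1)"
      using spectral_distribution_bound[of \<sigma> t] F[of t] that by (simp add: S_def)
    also have "\<dots> \<le> C' * t powr (2 * \<beta> + 1)" by (intro mult_right_mono) (simp_all add: C'_def)
    finally show ?thesis .
  qed
  have bessel: "(\<Sum>\<sigma>\<in>W. (inner v (delta \<sigma>))\<^sup>2) \<le> (norm v)\<^sup>2" if "finite W" "W \<subseteq> S" for W v
    using bessel_ell2[OF that(1), of v] by (simp add: inner_delta)
  define b where "b = sqrt (2 * C') / (1 - 2 powr (-\<beta>))"
  have b: "b > 0" using C' \<beta> by (simp add: b_def powr_less_one)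
  have D: "inner (laplacian z) z = (norm (d z))\<^sup>2" for z by (simp only: inner_laplacian power2_norm_eq_inner)
  have sob_sup: "\<bar>Rep_ell2 z \<sigma>\<bar> \<le> (b + sqrt 2) * norm (d z)" if "E 0 z = 0" "\<sigma> \<in> S" for z \<sigma>
    using sobolev_inequality(1)[OF that(1) \<beta> C' e bessel that(2)] unfolding D inner_delta b_def by simp
  have sob: "(\<Sum>\<sigma>\<in>W. \<bar>Rep_ell2 z \<sigma>\<bar> powr (2 + 1 / \<beta>)) \<le> 16 * (2 * (b * norm (d z))) powr (1 / \<beta>) * (norm (d z))\<^sup>2"
    if "E 0 z = 0" "finite W" "W \<subseteq> S" for z W
    using sobolev_inequality(2)[OF that(1) \<beta> C' e bessel that(2,3)] unfolding D inner_delta b_def by simp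
  obtain ys where ys: "\<And>n. ys n \<in> d ` ell2_cochains X k" "ys \<longlonglongrightarrow> y"
    using y unfolding closure_sequential by blast
  then have "\<forall>n. \<exists>z. ys n = d z" by blast
  from choice[OF this] obtain zs where zs: "\<And>n. ys n = d (zs n)" by blast
  define z where "z n = zs n - E 0 (zs n)" for n
  have E0z: "E 0 (z n) = 0" "E 0 (z n - z m) = 0" for n m by (simp_all add: z_def proj)
  have dz: "d (z n) = ys n" for n by (simp add: z_def d.diff d_E_0 zs)
  have "Bseq ys" using ys(2) by (intro convergent_imp_Bseq convergentI)
  then obtain N where N: "N > 0" "\<And>n. norm (ys n) \<le> N" by (auto simp: Bseq_def)
  \<comment> \<open>The norms of the \<open>z n\<close> are not controlled; their coefficients are,
    by the supremum bound applied to differences.\<close>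
  have "\<exists>l. (\<lambda>n. Rep_ell2 (z n) \<sigma>) \<longlonglongrightarrow> l" if \<sigma>: "\<sigma> \<in> S" for \<sigma>
  proof -
    have "Cauchy ys" using ys(2) by (rule LIMSEQ_imp_Cauchy)
    have "Cauchy (\<lambda>n. Rep_ell2 (z n) \<sigma>)"
    proof (rule metric_CauchyI)
      fix \<epsilon> :: real assume "\<epsilon> > 0"
      then have "\<epsilon> / (b + sqrt 2) > 0" using b by (simp add: add_pos_pos)
      then obtain M where M: "\<And>m n. m \<ge> M \<Longrightarrow> n \<ge> M \<Longrightarrow> dist (ys m) (ys n) < \<epsilon> / (b + sqrt 2)"
        using metric_CauchyD[OF \<open>Cauchy ys\<close>] by meson
      have "dist (Rep_ell2 (z m) \<sigma>) (Rep_ell2 (z n) \<sigma>) < \<epsilon>" if "m \<ge> M" "n \<ge> M" for m n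
      proof -
        have "dist (Rep_ell2 (z m) \<sigma>) (Rep_ell2 (z n) \<sigma>) \<le> (b + sqrt 2) * dist (ys m) (ys n)"
          using sob_sup[OF E0z(2)[of m n] \<sigma>] by (simp add: dist_norm Rep_ell2_diff d.diff dz)
        also have "\<dots> < \<epsilon>" using M[OF that] b by (simp add: field_simps add_pos_pos)
        finally show ?thesis .
      qed
      then show "\<exists>M. \<forall>m\<ge>M. \<forall>n\<ge>M. dist (Rep_ell2 (z m) \<sigma>) (Rep_ell2 (z n) \<sigma>) < \<epsilon>" by blast
    qed
    then show ?thesis by (simp add: Cauchy_convergent_iff convergent_def)
  qed
  then have "\<forall>\<sigma>. \<exists>l. \<sigma> \<in> S \<longrightarrow> (\<lambda>n. Rep_ell2 (z n) \<sigma>) \<longlonglongrightarrow> l" by blast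
  from choice[OF this] obtain x0 where x0: "\<And>\<sigma>. \<sigma> \<in> S \<Longrightarrow> (\<lambda>n. Rep_ell2 (z n) \<sigma>) \<longlonglongrightarrow> x0 \<sigma>" by blast
  \<comment> \<open>Off the \<open>k\<close>-simplexes nothing is known about \<open>z n\<close>.
    The limit is set to 0 there, and the coboundary does not see these values.\<close>
  define x where "x \<sigma> = (if \<sigma> \<in> S then x0 \<sigma> else 0)" for \<sigma>
  have x: "(\<lambda>n. Rep_ell2 (z n) \<sigma>) \<longlonglongrightarrow> x \<sigma>" if "\<sigma> \<in> S" for \<sigma> using x0 that by (simp add: x_def)
  define B where "B = (b + sqrt 2) * N"
  have B0: "B \<ge> 0" using b N by (simp add: B_def)
  show thesis
  proof
    show "x \<sigma> = 0" if "\<sigma> \<notin> simplexes X k" for \<sigma> using that by (simp add: x_def S_def)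
    show "\<bar>x \<sigma>\<bar> \<le> B" for \<sigma>
    proof (cases "\<sigma> \<in> S")
      case True
      have "\<bar>Rep_ell2 (z n) \<sigma>\<bar> \<le> B" for n
      proof -
        have "\<bar>Rep_ell2 (z n) \<sigma>\<bar> \<le> (b + sqrt 2) * norm (ys n)"
          using sob_sup[OF E0z(1)[of n] True] by (simp only: dz)
        also have "\<dots> \<le> B" unfolding B_def using b N by (intro mult_left_mono) auto
        finally show ?thesis .
      qed
      then show ?thesis by (intro LIMSEQ_le_const2[OF tendsto_rabs[OF x[OF True]]]) auto
    qed (simp add: x_def B0)
    define P where "P = 16 * (2 * (b * N)) powr (1 / \<beta>) * N\<^sup>2"
    \<comment> \<open>Fatou's lemma in elementary form: a bound on finite sums, uniform in
      \<open>W\<close>, survives the pointwise limit.\<close>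
    have "(\<Sum>\<sigma>\<in>W. \<bar>x \<sigma>\<bar> powr (2 + 1 / \<beta>)) \<le> P" if W: "finite W" "W \<subseteq> S" for W
    proof (rule LIMSEQ_le_const2)
      show "(\<lambda>n. \<Sum>\<sigma>\<in>W. \<bar>Rep_ell2 (z n) \<sigma>\<bar> powr (2 + 1 / \<beta>)) \<longlonglongrightarrow> (\<Sum>\<sigma>\<in>W. \<bar>x \<sigma>\<bar> powr (2 + 1 / \<beta>))"
        using W x \<beta> by (intro tendsto_sum tendsto_powr' tendsto_rabs tendsto_const) (auto intro: add_pos_pos)
      have "(\<Sum>\<sigma>\<in>W. \<bar>Rep_ell2 (z n) \<sigma>\<bar> powr (2 + 1 / \<beta>)) \<le> P" for n
      proof -
        have "(\<Sum>\<sigma>\<in>W. \<bar>Rep_ell2 (z n) \<sigma>\<bar> powr (2 + 1 / \<beta>)) \<le>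
            16 * (2 * (b * norm (ys n))) powr (1 / \<beta>) * (norm (ys n))\<^sup>2"
          using sob[OF E0z(1)[of n] W] by (simp only: dz)
        also have "\<dots> \<le> P"
          unfolding P_def using b N \<beta> by (intro mult_mono powr_mono2 power_mono mult_left_mono) auto
        finally show ?thesis .
      qed
      then show "\<exists>n0. \<forall>n\<ge>n0. (\<Sum>\<sigma>\<in>W. \<bar>Rep_ell2 (z n) \<sigma>\<bar> powr (2 + 1 / \<beta>)) \<le> P" by blast
    qed
    then show "(\<lambda>\<sigma>. \<bar>x \<sigma>\<bar> powr (2 + 1 / \<beta>)) summable_on simplexes X k"
      unfolding S_def by (intro nonneg_bdd_above_summable_on) (auto intro!: bdd_aboveI[of _ P])
    show "coboundary X \<pi> k x = Rep_ell2 y"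
    proof
      fix \<tau>
      have "(\<lambda>n. Rep_ell2 (ys n) \<tau>) \<longlonglongrightarrow> Rep_ell2 y \<tau>"
        using tendsto_inner[OF ys(2) tendsto_const, of "delta \<tau>"] by (simp add: inner_delta)
      then have 1: "(\<lambda>n. coboundary X \<pi> k (Rep_ell2 (z n)) \<tau>) \<longlonglongrightarrow> Rep_ell2 y \<tau>"
        by (simp flip: dz add: Rep_d)
      \<comment> \<open>Each value of the coboundary is a finite sum, so pointwise convergence
        suffices.\<close>
      have 2: "(\<lambda>n. coboundary X \<pi> k (Rep_ell2 (z n)) \<tau>) \<longlonglongrightarrow> coboundary X \<pi> k x \<tau>"
      proof (cases "\<tau> \<in> simplexes X (k + 1)")
        case True
        then have "\<tau> - {v} \<in> S" if "v \<in> \<tau>" for v using simplexes_D[OF complex True that] by (simp add: S_def)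
        then have "(\<lambda>n. \<Sum>v\<in>\<tau>. (-1) ^ card {u\<in>\<tau>. \<pi> u < \<pi> v} * Rep_ell2 (z n) (\<tau> - {v}))
            \<longlonglongrightarrow> (\<Sum>v\<in>\<tau>. (-1) ^ card {u\<in>\<tau>. \<pi> u < \<pi> v} * x (\<tau> - {v}))"
          by (intro tendsto_sum tendsto_mult tendsto_const x)
        then show ?thesis using True by (simp add: coboundary_def)
      qed (simp add: coboundary_def)
      show "coboundary X \<pi> k x \<tau> = Rep_ell2 y \<tau>" by (rule LIMSEQ_unique[OF 2 1])
    qed
  qed
qed

lemma subspace_coboundaries: "subspace (closure (d ` ell2_cochains X k))"
proof -
  interpret d: bounded_linear d by (rule bounded_d)
  have "subspace (ell2_cochains X k)"
    by (rule subspaceI) (auto simp: ell2_cochains_iff zero_ell2.rep_eq plus_ell2.rep_eq scaleR_ell2.rep_eq)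
  then have "subspace (d ` ell2_cochains X k)" using linear_subspace_image[OF d.linear_axioms] by blast
  then show ?thesis by (rule subspace_closure)
qed

end

theorem corollary5p4:
  fixes \<Gamma> :: "('g, 'b) monoid_scheme" and \<phi> :: "'g \<Rightarrow> 'v \<Rightarrow> 'v"
    and X :: "'v set set" and K :: "'w::linorder set set" and \<pi> :: "'v \<Rightarrow> 'w"
    and R :: "'v set set" and k :: nat and C \<alpha> :: real and p :: ereal
  assumes "finite K"
    and "deck_covering \<Gamma> \<phi> X K \<pi>"
    and "orbit_representatives \<Gamma> \<phi> (simplexes X k) R"
    and "\<alpha> > 2"
    and "\<forall>t>0. spectral_distribution \<Gamma> \<phi> R X \<pi> k t \<le> C * t powr (\<alpha> / 2)"
    and "is_singleton (reduced_ell2_cohomology_Suc X \<pi> k)"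
    and "p \<ge> 2" and "1 / p \<le> ereal (1 / 2 - 1 / \<alpha>)"
  shows "coboundaries_lp2_Suc p X \<pi> k = closure (ell2_coboundary X \<pi> k ` ell2_cochains X k) \<and>
         is_singleton (torsion_lp2_Suc p X \<pi> k)"
proof -
  interpret finite_deck_covering \<Gamma> \<phi> X K \<pi> R k by unfold_locales fact+
  define W where "W = closure (d ` ell2_cochains X k)"
  have W: "subspace W" unfolding W_def by (rule subspace_coboundaries)
  \<comment> \<open>Forced by \<open>2 * \<beta> + 1 = \<alpha> / 2\<close>; the Sobolev exponent
    \<open>2 + 1 / \<beta>\<close> then has reciprocal \<open>1 / 2 - 1 / \<alpha>\<close>.\<close>
  define \<beta> where "\<beta> = (\<alpha> - 2) / 4"
  have \<beta>: "\<beta> > 0" "2 * \<beta> + 1 = \<alpha> / 2" "1 / \<beta> = 4 / (\<alpha> - 2)"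
    using \<open>\<alpha> > 2\<close> by (simp_all add: \<beta>_def field_simps)
  have "coboundaries_lp2_Suc p X \<pi> k = W"
  proof
    have ker: "{f \<in> ell2_cochains X (k + 1). ell2_coboundary X \<pi> (k + 1) f = 0} \<subseteq> W"
      using assms(6) unfolding reduced_ell2_cohomology_Suc_def W_def[symmetric]
    proof (rule quotient_space_singletonD)
      have "linear (ell2_coboundary X \<pi> (k + 1))"
        by (rule bounded_linear.linear[OF bounded_linear_ell2_coboundary[OF covering finite_base]])
      then show "0 \<in> {f \<in> ell2_cochains X (k + 1). ell2_coboundary X \<pi> (k + 1) f = 0}"
        by (simp add: linear_0 ell2_cochains_iff zero_ell2.rep_eq)
    qed (rule subspace_0[OF W])
    show "coboundaries_lp2_Suc p X \<pi> k \<subseteq> W"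
    proof
      fix f assume f: "f \<in> coboundaries_lp2_Suc p X \<pi> k"
      then obtain g where g: "Rep_ell2 f = coboundary X \<pi> k g" by (auto simp: coboundaries_lp2_Suc_def)
      have "ell2_coboundary X \<pi> (k + 1) f = 0"
        by (rule Rep_ell2_inject[THEN iffD1])
          (simp add: Rep_d g coboundary_coboundary[OF covering, simplified] zero_ell2.rep_eq fun_eq_iff)
      then show "f \<in> W" using f ker by (auto simp: coboundaries_lp2_Suc_def)
    qed
    show "W \<subseteq> coboundaries_lp2_Suc p X \<pi> k"
    proof
      fix y assume "y \<in> W"
      then obtain x B where x: "\<And>\<sigma>. \<sigma> \<notin> simplexes X k \<Longrightarrow> x \<sigma> = 0" "\<And>\<sigma>. \<bar>x \<sigma>\<bar> \<le> B"
        "(\<lambda>\<sigma>. \<bar>x \<sigma>\<bar> powr (2 + 1 / \<beta>)) summable_on simplexes X k" "coboundary X \<pi> k x = Rep_ell2 y"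
        unfolding W_def using closure_coboundaries[OF \<beta>(1), of C y] assms(5) \<beta>(2) by metis
      have "x \<in> lp_cochains p X k"
        using conjugate_exponent_le[OF assms(4,7,8)] by (intro lp_cochainsI[OF x(1,2,3)]) (simp_all add: \<beta>)
      moreover have "y \<in> ell2_cochains X (k + 1)"
        unfolding ell2_cochains_iff x(4)[symmetric] by (simp add: coboundary_def)
      ultimately show "y \<in> coboundaries_lp2_Suc p X \<pi> k"
        unfolding coboundaries_lp2_Suc_def using x(4) by (auto intro!: image_eqI[of _ _ x])
    qed
  qed
  \<comment> \<open>Since the space of coboundaries has turned out closed, the torsion is
    \<open>W\<close> modulo itself.\<close>
  moreover have "closure W = W" by (simp add: W_def)
  ultimately show ?thesis
    using is_singleton_quotient_space_self[OF W] by (simp add: torsion_lp2_Suc_def W_def)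
qed

end
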